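(* Let $n\ge3$. For every $\gamma\in G(\mathbb{R}^n)$ and $a\in\mathcal{M}(H^{1,2}_e(\mathbb{R}^n))$, one has $a\circ\gamma^{-1}\in\mathcal{M}(H^{1,2}_e(\mathbb{R}^n))$ and \[ \|a\circ\gamma^{-1}\|_{\mathcal{M}(H^{1,2}_e(\mathbb{R}^n))}=\|a\|_{\mathcal{M}(H^{1,2}_e(\mathbb{R}^n))}. \] Thus $G(\mathbb{R}^n)$ acts isometrically on $\mathcal{M}(H^{1,2}_e(\mathbb{R}^n))$ via $a\mapsto a\circ\gamma^{-1}$.
   Context: $G(\mathbb{R}^n)$ is the Möbius group generated by translations, orthogonal maps, dilations $x\mapsto sx$ ($s>0$) and the inversion $x\mapsto x/|x|^2$. $H^{1,2}_e(\mathbb{R}^n)$ is the extended Dirichlet space of $\mathcal{D}[b]=\int|\nabla b|^2dx$ (a.e. limits of $\mathcal{D}$-Cauchy sequences in $H^{1,2}(\mathbb{R}^n)$), a Hilbert space with norm $\sqrt{\mathcal{D}}$ for $n\ge3$. $\mathcal{M}(H^{1,2}_e(\mathbb{R}^n))$ is the algebra of measurable $a$ with $aH^{1,2}_e(\mathbb{R}^n)\subseteq H^{1,2}_e(\mathbb{R}^n)$, normed by the operator norm of $b\mapsto ab$ on $(H^{1,2}_e(\mathbb{R}^n),\sqrt{\mathcal{D}})$. *)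

theory Defs
  imports "HOL-Analysis.Analysis"
begin

inductive mobius_generator :: "(real^'n \<Rightarrow> real^'n) \<Rightarrow> bool" where
  translation: "mobius_generator (\<lambda>x. x + c)"
| orthogonal: "orthogonal_transformation f \<Longrightarrow> mobius_generator f"
| dilation: "s > 0 \<Longrightarrow> mobius_generator (\<lambda>x. s *\<^sub>R x)"
| inversion: "mobius_generator (\<lambda>x. x /\<^sub>R (norm x)\<^sup>2)"

text \<open>The generators are bijections of R^n (the inversion sends 0 to 0, a null set
  convention) and the generating set is closed under inverses, so the group they
  generate is the set of finite compositions of generators.\<close>

inductive_set mobius_group :: "(real^'n \<Rightarrow> real^'n) set" where
  ident: "id \<in> mobius_group"
| comp: "\<gamma> \<in> mobius_group \<Longrightarrow> mobius_generator g \<Longrightarrow> g \<circ> \<gamma> \<in> mobius_group"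

definition partial_deriv :: "'n::finite \<Rightarrow> (real^'n \<Rightarrow> real) \<Rightarrow> real^'n \<Rightarrow> real" where
  "partial_deriv i \<phi> x = frechet_derivative \<phi> (at x) (axis i 1)"

coinductive smooth_fun :: "(real^'n::finite \<Rightarrow> real) \<Rightarrow> bool" where
  "(\<forall>x. \<phi> differentiable (at x)) \<Longrightarrow> (\<forall>i. smooth_fun (partial_deriv i \<phi>))
     \<Longrightarrow> smooth_fun \<phi>"

definition test_fun :: "(real^'n::finite \<Rightarrow> real) \<Rightarrow> bool" where
  "test_fun \<phi> \<longleftrightarrow> smooth_fun \<phi> \<and> compact (closure {x. \<phi> x \<noteq> 0})"

definition weak_gradient :: "(real^'n::finite \<Rightarrow> real) \<Rightarrow> (real^'n \<Rightarrow> real^'n) \<Rightarrow> bool" where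
  "weak_gradient b g \<longleftrightarrow>
     (\<forall>\<phi> i. test_fun \<phi> \<longrightarrow>
        (\<integral>x. b x * partial_deriv i \<phi> x \<partial>lebesgue) = - (\<integral>x. g x $ i * \<phi> x \<partial>lebesgue))"

definition H12 :: "(real^'n::finite \<Rightarrow> real) set" where
  "H12 = {b. b \<in> borel_measurable lebesgue \<and> integrable lebesgue (\<lambda>x. (b x)\<^sup>2) \<and>
             (\<exists>g. g \<in> borel_measurable lebesgue \<and> integrable lebesgue (\<lambda>x. (norm (g x))\<^sup>2)
                  \<and> weak_gradient b g)}"

definition weak_grad :: "(real^'n::finite \<Rightarrow> real) \<Rightarrow> real^'n \<Rightarrow> real^'n" where
  "weak_grad b = (SOME g. g \<in> borel_measurable lebesgue \<and>
                     integrable lebesgue (\<lambda>x. (norm (g x))\<^sup>2) \<and> weak_gradient b g)"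

definition Dir :: "(real^'n::finite \<Rightarrow> real) \<Rightarrow> real" where
  "Dir b = (\<integral>x. (norm (weak_grad b x))\<^sup>2 \<partial>lebesgue)"

definition approx_seq :: "(real^'n::finite \<Rightarrow> real) \<Rightarrow> (nat \<Rightarrow> real^'n \<Rightarrow> real) \<Rightarrow> bool" where
  "approx_seq b f \<longleftrightarrow> (\<forall>k. f k \<in> H12) \<and>
     (\<forall>e>0. \<exists>N. \<forall>m\<ge>N. \<forall>k\<ge>N. Dir (\<lambda>x. f m x - f k x) < e) \<and>
     (AE x in lebesgue. (\<lambda>k. f k x) \<longlonglongrightarrow> b x)"

definition H12e :: "(real^'n::finite \<Rightarrow> real) set" where
  "H12e = {b. \<exists>f. approx_seq b f}"

text \<open>Extension of D to the extended Dirichlet space (independent of the approximating sequence).\<close>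
definition Dir_e :: "(real^'n::finite \<Rightarrow> real) \<Rightarrow> real" where
  "Dir_e b = lim (\<lambda>k. Dir ((SOME f. approx_seq b f) k))"

definition multipliers :: "(real^'n::finite \<Rightarrow> real) set" where
  "multipliers = {a. a \<in> borel_measurable lebesgue \<and> (\<forall>b\<in>H12e. (\<lambda>x. a x * b x) \<in> H12e)}"

definition mult_norm :: "(real^'n::finite \<Rightarrow> real) \<Rightarrow> ereal" where
  "mult_norm a = (SUP b\<in>{b\<in>H12e. Dir_e b \<le> 1}. ereal (sqrt (Dir_e (\<lambda>x. a x * b x))))"

end

(* The operator T b = w * (b o g), with w the power (n-2)/2 of the conformal factor of g, is an
   isometry of the extended Dirichlet space for each similarity g and (as the Kelvin transform) for
   the inversion; T intertwines multiplication by a with multiplication by a o g, so multiplier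
   norms agree, and one composes generators. For test functions supported away from 0 the isometry
   is a pointwise identity: as w is harmonic,
     |grad (w u)|^2 = w^2 |grad u|^2 + div (w u^2 grad w)   for u = phi o g,
   and a change of variables treats the first term. Such test functions are dense (mollify, cut off
   at infinity, and cut off at 0, a point of zero capacity), and Hardy's inequality shows that D
   extends to almost everywhere limits independently of the approximating sequence. *)

theory Submission
  imports Defs "HOL-Real_Asymp.Real_Asymp"
begin

section \<open>Smooth functions on open sets\<close>

text \<open>The Kelvin transform does not map \<open>H12\<close> into itself: it turns the plain L2
  norm into one weighted by |x|^(-4). So T can be compared with D directly only on test functions
  vanishing near 0, whose images are again test functions, and it reaches \<open>H12e\<close> only
  through almost everywhere limits. Two facts carry this passage: the generators preserve null sets,
  and \<open>Dir_e\<close>, which is computed along one arbitrarily chosen sequence, has the same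
  value along every approximating sequence. The power (n-2)/2 is forced: after the substitution the
  Jacobian s^n must equal w^2 s^2, where s^2 comes from the gradient. For a similarity w is
  constant; for the inversion it is |x|^(2-n), up to a factor the fundamental solution of the
  Laplacian, which is why it is harmonic off 0. \<open>weak_grad\<close> is likewise a choice, so
  even the triangle inequality for \<open>Dir\<close> rests on uniqueness of weak gradients, and
  that is obtained from mollification.\<close>

definition grad :: "(real^'n::finite \<Rightarrow> real) \<Rightarrow> real^'n \<Rightarrow> real^'n" where
  "grad \<phi> x = (\<chi> i. partial_deriv i \<phi> x)"

lemma grad_nth [simp]: "grad \<phi> x $ i = partial_deriv i \<phi> x"
  by (simp add: grad_def)

lemma partial_deriv_eqI:
  assumes "(\<phi> has_derivative D) (at x)"
  shows "partial_deriv i \<phi> x = D (axis i 1)"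
  using frechet_derivative_at[OF assms] by (simp add: partial_deriv_def)

lemma has_derivative_grad:
  fixes \<phi> :: "real^'n::finite \<Rightarrow> real"
  assumes "\<phi> differentiable (at x)"
  shows "(\<phi> has_derivative (\<lambda>h. grad \<phi> x \<bullet> h)) (at x)"
proof -
  let ?D = "frechet_derivative \<phi> (at x)"
  have D: "(\<phi> has_derivative ?D) (at x)"
    using assms frechet_derivative_works by blast
  then have l: "linear ?D" by (rule has_derivative_linear)
  have "?D h = grad \<phi> x \<bullet> h" for h
  proof -
    have "?D h = ?D (\<Sum>i\<in>UNIV. h $ i *\<^sub>R axis i 1)"
      using basis_expansion[of h] by (simp add: scalar_mult_eq_scaleR)
    also have "\<dots> = (\<Sum>i\<in>UNIV. h $ i * ?D (axis i 1))"
      by (simp add: linear_sum[OF l] linear_cmul[OF l])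
    finally show ?thesis by (simp add: inner_vec_def partial_deriv_def mult.commute)
  qed
  then show ?thesis using D by (metis (no_types, lifting) ext)
qed

lemma grad_eqI:
  assumes "(\<phi> has_derivative (\<lambda>h. v \<bullet> h)) (at x)"
  shows "grad \<phi> x = v"
  by (simp add: vec_eq_iff partial_deriv_eqI[OF assms] inner_axis)

lemma partial_deriv_cong_open:
  assumes "open S" "x \<in> S" "\<And>y. y \<in> S \<Longrightarrow> \<phi> y = \<psi> y"
  shows "partial_deriv i \<phi> x = partial_deriv i \<psi> x"
    and "\<phi> differentiable (at x) \<longleftrightarrow> \<psi> differentiable (at x)"
proof -
  have *: "(\<phi> has_derivative D) (at x) \<longleftrightarrow> (\<psi> has_derivative D) (at x)" for D
    using assms by (metis has_derivative_transform_within_open)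
  then show "partial_deriv i \<phi> x = partial_deriv i \<psi> x"
    by (simp add: partial_deriv_def frechet_derivative_def)
  show "\<phi> differentiable (at x) \<longleftrightarrow> \<psi> differentiable (at x)"
    by (simp add: differentiable_def *)
qed

text \<open>The coinductive \<open>smooth_fun\<close> is unfolded into finite stages so that closure
  properties can be shown by induction on the order. Stage 0 already demands differentiability, so
  stage n means n + 1 derivatives; the set S admits functions that are singular elsewhere.\<close>

primrec Ck_on :: "nat \<Rightarrow> (real^'n::finite) set \<Rightarrow> (real^'n \<Rightarrow> real) \<Rightarrow> bool" where
  "Ck_on 0 S \<phi> \<longleftrightarrow> (\<forall>x\<in>S. \<phi> differentiable (at x))"
| "Ck_on (Suc n) S \<phi> \<longleftrightarrow> (\<forall>x\<in>S. \<phi> differentiable (at x)) \<and> (\<forall>i. Ck_on n S (partial_deriv i \<phi>))"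

definition smooth_on :: "(real^'n::finite) set \<Rightarrow> (real^'n \<Rightarrow> real) \<Rightarrow> bool" where
  "smooth_on S \<phi> \<longleftrightarrow> (\<forall>n. Ck_on n S \<phi>)"

lemma Ck_on_differentiable: "Ck_on n S \<phi> \<Longrightarrow> x \<in> S \<Longrightarrow> \<phi> differentiable (at x)"
  by (cases n) auto

lemma Ck_on_SucD: "Ck_on (Suc n) S \<phi> \<Longrightarrow> Ck_on n S \<phi>"
  by (induction n arbitrary: \<phi>) auto

lemma Ck_on_cong:
  assumes "open S" "\<And>y. y \<in> S \<Longrightarrow> \<phi> y = \<psi> y"
  shows "Ck_on n S \<phi> \<longleftrightarrow> Ck_on n S \<psi>"
  using assms(2)
proof (induction n arbitrary: \<phi> \<psi>)
  case 0
  then show ?case using partial_deriv_cong_open(2)[OF \<open>open S\<close>] by (metis Ck_on.simps(1))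
next
  case (Suc n)
  have "Ck_on n S (partial_deriv i \<phi>) \<longleftrightarrow> Ck_on n S (partial_deriv i \<psi>)" for i
    by (rule Suc.IH) (use partial_deriv_cong_open(1)[OF \<open>open S\<close>] Suc.prems in metis)
  then show ?case using partial_deriv_cong_open(2)[OF \<open>open S\<close>] Suc.prems by (metis Ck_on.simps(2))
qed

lemma Ck_on_mono: "Ck_on n S \<phi> \<Longrightarrow> T \<subseteq> S \<Longrightarrow> Ck_on n T \<phi>"
  by (induction n arbitrary: \<phi>) auto

lemma Ck_on_Un: "Ck_on n S \<phi> \<Longrightarrow> Ck_on n T \<phi> \<Longrightarrow> Ck_on n (S \<union> T) \<phi>"
  by (induction n arbitrary: \<phi>) auto

lemma smooth_on_differentiable: "smooth_on S \<phi> \<Longrightarrow> x \<in> S \<Longrightarrow> \<phi> differentiable (at x)"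
  unfolding smooth_on_def using Ck_on_differentiable by blast

lemma smooth_on_partial_deriv: "smooth_on S \<phi> \<Longrightarrow> smooth_on S (partial_deriv i \<phi>)"
  unfolding smooth_on_def using Ck_on.simps(2) by blast

lemma smooth_on_cong:
  "open S \<Longrightarrow> (\<And>y. y \<in> S \<Longrightarrow> \<phi> y = \<psi> y) \<Longrightarrow> smooth_on S \<phi> \<longleftrightarrow> smooth_on S \<psi>"
  unfolding smooth_on_def using Ck_on_cong by blast

lemma smooth_on_mono: "smooth_on S \<phi> \<Longrightarrow> T \<subseteq> S \<Longrightarrow> smooth_on T \<phi>"
  unfolding smooth_on_def using Ck_on_mono by blast

lemma smooth_on_Un: "smooth_on S \<phi> \<Longrightarrow> smooth_on T \<phi> \<Longrightarrow> smooth_on (S \<union> T) \<phi>"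
  unfolding smooth_on_def using Ck_on_Un by blast

lemma smooth_on_continuous: "smooth_on S \<phi> \<Longrightarrow> continuous_on S \<phi>"
  by (simp add: continuous_at_imp_continuous_on differentiable_imp_continuous_within smooth_on_differentiable)

text \<open>From left to right each stage unfolds the coinductive rule once more; conversely
  smoothness is itself a coinduction invariant, being inherited by partial derivatives.\<close>

lemma smooth_fun_iff: "smooth_fun \<phi> \<longleftrightarrow> smooth_on UNIV \<phi>"
proof
  assume "smooth_fun \<phi>"
  then have "Ck_on n UNIV \<phi>" for n
    by (induction n arbitrary: \<phi>) (auto elim: smooth_fun.cases)
  then show "smooth_on UNIV \<phi>" by (simp add: smooth_on_def)
next
  assume "smooth_on UNIV \<phi>"
  then show "smooth_fun \<phi>"
  proof (coinduction arbitrary: \<phi>)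
    case smooth_fun
    then show ?case using smooth_on_differentiable smooth_on_partial_deriv by blast
  qed
qed

text \<open>Any formula D for the derivative may replace \<open>partial_deriv\<close>, since the two
  agree on the open set S. This is the inductive step of the closure lemmas whose derivative is
  given by a rule.\<close>

lemma Ck_on_SucI:
  assumes "open S" "\<And>x. x \<in> S \<Longrightarrow> (\<phi> has_derivative D x) (at x)"
    and "\<And>i. Ck_on n S (\<lambda>x. D x (axis i 1))"
  shows "Ck_on (Suc n) S \<phi>"
proof -
  have "Ck_on n S (partial_deriv i \<phi>)" for i
    using Ck_on_cong[OF \<open>open S\<close>, of "partial_deriv i \<phi>" "\<lambda>x. D x (axis i 1)"]
      partial_deriv_eqI[OF assms(2)] assms(3) by blast
  then show ?thesis using assms(2) by (auto simp: differentiable_def)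
qed

lemma Ck_on_const: "Ck_on n S (\<lambda>x. c)"
proof (induction n arbitrary: c)
  case (Suc n)
  have "partial_deriv i (\<lambda>x::real^'a. c) = (\<lambda>x. 0)" for i
    by (auto intro!: ext simp: partial_deriv_eqI[OF has_derivative_const])
  then show ?case using Suc by simp
qed simp

lemma Ck_on_add: "open S \<Longrightarrow> Ck_on n S \<phi> \<Longrightarrow> Ck_on n S \<psi> \<Longrightarrow> Ck_on n S (\<lambda>x. \<phi> x + \<psi> x)"
proof (induction n arbitrary: \<phi> \<psi>)
  case (Suc n)
  show ?case
  proof (rule Ck_on_SucI[OF \<open>open S\<close>])
    show "((\<lambda>x. \<phi> x + \<psi> x) has_derivative (\<lambda>h. grad \<phi> x \<bullet> h + grad \<psi> x \<bullet> h)) (at x)" if "x \<in> S" for x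
      by (intro has_derivative_add has_derivative_grad) (use Suc.prems that in auto)
    show "Ck_on n S (\<lambda>x. grad \<phi> x \<bullet> axis i 1 + grad \<psi> x \<bullet> axis i 1)" for i
      using Suc by (simp add: inner_axis)
  qed
qed auto

lemma Ck_on_mult: "open S \<Longrightarrow> Ck_on n S \<phi> \<Longrightarrow> Ck_on n S \<psi> \<Longrightarrow> Ck_on n S (\<lambda>x. \<phi> x * \<psi> x)"
proof (induction n arbitrary: \<phi> \<psi>)
  case (Suc n)
  show ?case
  proof (rule Ck_on_SucI[OF \<open>open S\<close>])
    show "((\<lambda>x. \<phi> x * \<psi> x) has_derivative (\<lambda>h. \<phi> x * (grad \<psi> x \<bullet> h) + (grad \<phi> x \<bullet> h) * \<psi> x)) (at x)" if "x \<in> S" for x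
      by (intro has_derivative_mult has_derivative_grad) (use Suc.prems that in auto)
    show "Ck_on n S (\<lambda>x. \<phi> x * (grad \<psi> x \<bullet> axis i 1) + (grad \<phi> x \<bullet> axis i 1) * \<psi> x)" for i
      using Suc Ck_on_SucD[OF Suc.prems(2)] Ck_on_SucD[OF Suc.prems(3)]
      by (auto simp: inner_axis intro!: Ck_on_add)
  qed
qed auto

lemma Ck_on_sum: "open S \<Longrightarrow> (\<And>i. i \<in> I \<Longrightarrow> Ck_on n S (f i)) \<Longrightarrow> Ck_on n S (\<lambda>x. \<Sum>i\<in>I. f i x)"
  by (induction I rule: infinite_finite_induct) (auto intro: Ck_on_add simp: Ck_on_const)

lemma Ck_on_inverse:
  "open S \<Longrightarrow> Ck_on n S \<phi> \<Longrightarrow> (\<And>x. x \<in> S \<Longrightarrow> \<phi> x \<noteq> 0) \<Longrightarrow> Ck_on n S (\<lambda>x. inverse (\<phi> x))"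
proof (induction n)
  case (Suc n)
  have m: "Ck_on n S (\<lambda>x. inverse (\<phi> x))" using Suc Ck_on_SucD by blast
  show ?case
  proof (rule Ck_on_SucI[OF \<open>open S\<close>])
    show "((\<lambda>x. inverse (\<phi> x)) has_derivative (\<lambda>h. - (inverse (\<phi> x) * (grad \<phi> x \<bullet> h) * inverse (\<phi> x)))) (at x)" if "x \<in> S" for x
      by (intro Deriv.has_derivative_inverse has_derivative_grad) (use Suc.prems that in auto)
    have "Ck_on n S (\<lambda>x. (- 1) * (inverse (\<phi> x) * partial_deriv i \<phi> x * inverse (\<phi> x)))" for i
      using Suc by (intro Ck_on_mult Ck_on_const m) auto
    then show "Ck_on n S (\<lambda>x. - (inverse (\<phi> x) * (grad \<phi> x \<bullet> axis i 1) * inverse (\<phi> x)))" for i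
      by (simp add: inner_axis)
  qed
qed auto

lemma Ck_on_nth: "Ck_on n S (\<lambda>x. x $ j)"
proof -
  have d: "((\<lambda>x. x $ j) has_derivative (\<lambda>h. h $ j)) (at x)" for x :: "real^'a"
    by (rule bounded_linear_imp_has_derivative) (rule bounded_linear_vec_nth)
  show ?thesis
  proof (cases n)
    case 0 then show ?thesis using d by (auto simp: differentiable_def)
  next
    case (Suc m)
    have "partial_deriv i (\<lambda>x. x $ j) = (\<lambda>x. axis i 1 $ j)" for i
      using partial_deriv_eqI[OF d] by blast
    then show ?thesis using Suc d Ck_on_const by (auto simp: differentiable_def)
  qed
qed

text \<open>The gradient x / |x| of the norm is built from the norm itself, so the induction
  hypothesis at order n yields order n + 1.\<close>

lemma Ck_on_norm: "Ck_on n (- {0}) norm"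
proof (induction n)
  case 0
  then show ?case by (auto simp: differentiable_norm_at)
next
  case (Suc n)
  show ?case
  proof (rule Ck_on_SucI)
    show "(norm has_derivative (\<lambda>h. sgn x \<bullet> h)) (at x)" if "x \<in> -{0}" for x :: "real^'a"
      using that has_derivative_norm[of x] by (simp add: inner_commute)
    have "Ck_on n (- {0}) (\<lambda>x. inverse (norm x) * x $ i)" for i :: 'a
      by (intro Ck_on_mult Ck_on_inverse Suc Ck_on_nth) auto
    then show "Ck_on n (- {0}) (\<lambda>x. sgn x \<bullet> axis i 1)" for i :: 'a
      by (simp add: inner_axis sgn_div_norm)
  qed auto
qed

lemma has_derivative_vecI:
  fixes F :: "'a::real_normed_vector \<Rightarrow> real^'m::finite"
  assumes "\<And>j. ((\<lambda>x. F x $ j) has_derivative (\<lambda>h. D h $ j)) (at x)"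
  shows "(F has_derivative D) (at x)"
proof (subst has_derivative_componentwise_within, rule ballI)
  fix b :: "real^'m" assume "b \<in> Basis"
  then obtain j where "b = axis j 1" by (auto simp: Basis_vec_def)
  then show "((\<lambda>x. F x \<bullet> b) has_derivative (\<lambda>x. D x \<bullet> b)) (at x)"
    using assms[of j] by (simp add: inner_axis)
qed

lemma has_derivative_vec_grad:
  fixes F :: "real^'n::finite \<Rightarrow> real^'m::finite"
  assumes "\<And>j. (\<lambda>x. F x $ j) differentiable (at x)"
  shows "(F has_derivative (\<lambda>h. \<chi> j. grad (\<lambda>x. F x $ j) x \<bullet> h)) (at x)"
  by (rule has_derivative_vecI) (simp add: has_derivative_grad assms)

text \<open>By the chain rule the partial derivatives of the composition are sums of products of
  \<open>partial_deriv j \<phi> (F x)\<close> with partial derivatives of the components of F. The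
  induction keeps \<phi> general to absorb the first factor.\<close>

lemma Ck_on_compose:
  fixes F :: "real^'n::finite \<Rightarrow> real^'m::finite"
  assumes "open S" "F ` S \<subseteq> T"
  shows "Ck_on n T \<phi> \<Longrightarrow> (\<And>j. Ck_on n S (\<lambda>x. F x $ j)) \<Longrightarrow> Ck_on n S (\<lambda>x. \<phi> (F x))"
proof (induction n arbitrary: \<phi>)
  case 0
  have "(\<lambda>x. \<phi> (F x)) differentiable (at x)" if "x \<in> S" for x
  proof -
    have "\<phi> differentiable (at (F x))" using 0(1) assms(2) that by auto
    moreover have "\<And>j. (\<lambda>x. F x $ j) differentiable (at x)" using 0(2) that by simp
    from has_derivative_vec_grad[OF this] have "F differentiable (at x)"
      by (rule differentiableI)
    ultimately show ?thesis using differentiable_chain_at[of F x \<phi>] by (simp add: o_def)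
  qed
  then show ?case by simp
next
  case (Suc n)
  show ?case
  proof (rule Ck_on_SucI[OF \<open>open S\<close>])
    fix x assume x: "x \<in> S"
    have "\<And>j. (\<lambda>x. F x $ j) differentiable (at x)"
      using Suc.prems(2) x Ck_on_differentiable by blast
    note has_derivative_vec_grad[OF this]
    moreover have "(\<phi> has_derivative (\<lambda>h. grad \<phi> (F x) \<bullet> h)) (at (F x))"
      using x assms(2) Suc.prems(1) by (intro has_derivative_grad) auto
    ultimately show "((\<lambda>x. \<phi> (F x)) has_derivative (\<lambda>h. grad \<phi> (F x) \<bullet> (\<chi> j. grad (\<lambda>x. F x $ j) x \<bullet> h))) (at x)"
      by (rule has_derivative_compose)
  next
    fix i
    have 1: "Ck_on n S (\<lambda>x. F x $ j)" for j using Suc.prems(2) Ck_on_SucD by blast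
    have "Ck_on n S (\<lambda>x. partial_deriv j \<phi> (F x))" for j
      by (rule Suc.IH) (use Suc.prems(1) 1 in auto)
    moreover have "Ck_on n S (partial_deriv i (\<lambda>x. F x $ j))" for j
      using Suc.prems(2)[of j] by simp
    ultimately have "Ck_on n S (\<lambda>x. \<Sum>j\<in>UNIV. partial_deriv j \<phi> (F x) * partial_deriv i (\<lambda>x. F x $ j) x)"
      by (intro Ck_on_sum Ck_on_mult \<open>open S\<close>) auto
    moreover have "grad \<phi> (F x) \<bullet> (\<chi> j. grad (\<lambda>x. F x $ j) x \<bullet> axis i 1)
        = (\<Sum>j\<in>UNIV. partial_deriv j \<phi> (F x) * partial_deriv i (\<lambda>x. F x $ j) x)" for x
      by (subst inner_vec_def) (simp add: inner_axis)
    ultimately show "Ck_on n S (\<lambda>x. grad \<phi> (F x) \<bullet> (\<chi> j. grad (\<lambda>x. F x $ j) x \<bullet> axis i 1))"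
      by presburger
  qed
qed

lemma smooth_on_const [intro]: "smooth_on S (\<lambda>x. c)"
  and smooth_on_nth [intro]: "smooth_on S (\<lambda>x. x $ j)"
  and smooth_on_norm: "smooth_on (- {0}) norm"
  by (auto simp: smooth_on_def Ck_on_const Ck_on_nth Ck_on_norm)

lemma smooth_on_add: "open S \<Longrightarrow> smooth_on S \<phi> \<Longrightarrow> smooth_on S \<psi> \<Longrightarrow> smooth_on S (\<lambda>x. \<phi> x + \<psi> x)"
  and smooth_on_mult: "open S \<Longrightarrow> smooth_on S \<phi> \<Longrightarrow> smooth_on S \<psi> \<Longrightarrow> smooth_on S (\<lambda>x. \<phi> x * \<psi> x)"
  and smooth_on_inverse: "open S \<Longrightarrow> smooth_on S \<phi> \<Longrightarrow> (\<And>x. x \<in> S \<Longrightarrow> \<phi> x \<noteq> 0) \<Longrightarrow> smooth_on S (\<lambda>x. inverse (\<phi> x))"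
  by (auto simp: smooth_on_def Ck_on_add Ck_on_mult Ck_on_inverse)

lemma smooth_on_sum: "open S \<Longrightarrow> (\<And>i. i \<in> I \<Longrightarrow> smooth_on S (f i)) \<Longrightarrow> smooth_on S (\<lambda>x. \<Sum>i\<in>I. f i x)"
  by (auto simp: smooth_on_def Ck_on_sum)

lemma smooth_on_compose:
  fixes F :: "real^'n::finite \<Rightarrow> real^'m::finite"
  assumes "open S" "F ` S \<subseteq> T" "smooth_on T \<phi>" "\<And>j. smooth_on S (\<lambda>x. F x $ j)"
  shows "smooth_on S (\<lambda>x. \<phi> (F x))"
  unfolding smooth_on_def
  using Ck_on_compose[OF assms(1,2)] assms(3,4)[unfolded smooth_on_def] by blast

lemma smooth_on_minus: "open S \<Longrightarrow> smooth_on S \<phi> \<Longrightarrow> smooth_on S (\<lambda>x. - \<phi> x)"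
  using smooth_on_mult[of S "\<lambda>x. - 1" \<phi>] by auto

lemma smooth_on_diff: "open S \<Longrightarrow> smooth_on S \<phi> \<Longrightarrow> smooth_on S \<psi> \<Longrightarrow> smooth_on S (\<lambda>x. \<phi> x - \<psi> x)"
  using smooth_on_add[of S \<phi> "\<lambda>x. - \<psi> x"] smooth_on_minus by auto

lemma smooth_on_power: "open S \<Longrightarrow> smooth_on S \<phi> \<Longrightarrow> smooth_on S (\<lambda>x. \<phi> x ^ k)"
  by (induction k) (auto intro: smooth_on_mult)

lemma smooth_on_norm_power2: "open S \<Longrightarrow> smooth_on S (\<lambda>x. (norm x)\<^sup>2)"
  unfolding power2_norm_eq_inner inner_vec_def inner_real_def
  by (intro smooth_on_sum smooth_on_mult smooth_on_nth) auto

lemmas smooth_intros = smooth_on_const smooth_on_nth smooth_on_add smooth_on_mult smooth_on_sum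
  smooth_on_minus smooth_on_diff smooth_on_power smooth_on_norm_power2

text \<open>The derivatives of exp (-1/t) are combinations of the functions t^(-k) exp (-1/t).\<close>

definition flat :: "nat \<Rightarrow> real \<Rightarrow> real" where
  "flat k t = (if t \<le> 0 then 0 else exp (- inverse t) * inverse t ^ k)"

text \<open>The exponential decay beats every power of 1/t. The quotient is the difference quotient
  of \<open>flat k\<close> at 0, so this is the reason why the two halves of the function join
  smoothly.\<close>

lemma flat_over_tendsto: "((\<lambda>t. flat k t / t) \<longlongrightarrow> 0) (at 0)"
proof -
  have "((\<lambda>t::real. exp (- inverse t) * inverse t ^ k / t) \<longlongrightarrow> 0) (at_right 0)"
    by real_asymp
  then have r: "((\<lambda>t. flat k t / t) \<longlongrightarrow> 0) (at_right 0)"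
    by (rule Lim_transform_eventually) (auto simp: eventually_at_filter flat_def)
  have l: "((\<lambda>t. flat k t / t) \<longlongrightarrow> 0) (at_left 0)"
    by (rule tendsto_eventually) (auto simp: eventually_at_filter flat_def)
  from l r show ?thesis by (rule filterlim_split_at)
qed

lemma DERIV_flat: "(flat k has_real_derivative (flat (k + 2) t - k * flat (Suc k) t)) (at t)"
proof (cases t "0::real" rule: linorder_cases)
  case less
  have "((\<lambda>t. 0) has_real_derivative 0) (at t)" by simp
  then have "(flat k has_real_derivative 0) (at t)"
    by (rule has_field_derivative_transform_within_open[where S="{..<0}"]) (use less in \<open>auto simp: flat_def\<close>)
  then show ?thesis using less by (simp add: flat_def)
next
  case equal
  have "(flat k has_real_derivative 0) (at 0)"
    using flat_over_tendsto[of k] by (simp add: has_field_derivative_iff flat_def[of k 0])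
  then show ?thesis using equal by (simp add: flat_def)
next
  case greater
  have "((\<lambda>t. exp (- inverse t) * inverse t ^ k) has_real_derivative
     exp (- inverse t) * (inverse t * inverse t) * inverse t ^ k + exp (- inverse t) * (k * inverse t ^ (k-1) * (-(inverse t * inverse t)))) (at t)"
    using greater by (auto intro!: derivative_eq_intros simp: algebra_simps)
  also have "exp (- inverse t) * (inverse t * inverse t) * inverse t ^ k + exp (- inverse t) * (k * inverse t ^ (k-1) * (-(inverse t * inverse t)))
      = flat (k + 2) t - k * flat (Suc k) t"
    \<comment> \<open>For k = 0 the exponent \<open>k - 1\<close> is truncated, but its term carries
      the factor k.\<close>
    using greater by (cases k) (auto simp: flat_def algebra_simps)
  finally have "((\<lambda>t. exp (- inverse t) * inverse t ^ k) has_real_derivative (flat (k + 2) t - k * flat (Suc k) t)) (at t)" .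
  then show ?thesis
    by (rule has_field_derivative_transform_within_open[where S="{0<..}"]) (use greater in \<open>auto simp: flat_def\<close>)
qed

text \<open>Differentiating raises the index k, hence the induction over the order with k
  arbitrary.\<close>

lemma Ck_on_flat: "open S \<Longrightarrow> Ck_on n S \<phi> \<Longrightarrow> Ck_on n S (\<lambda>x. flat k (\<phi> x))"
proof (induction n arbitrary: k)
  case 0
  have "flat k differentiable (at t)" for t
    using DERIV_flat real_differentiable_def by blast
  then show ?case using 0 differentiable_compose[of "flat k" \<phi>] by auto
next
  case (Suc n)
  show ?case
  proof (rule Ck_on_SucI[OF \<open>open S\<close>])
    show "((\<lambda>x. flat k (\<phi> x)) has_derivative
       (\<lambda>h. (grad \<phi> x \<bullet> h) * (flat (k+2) (\<phi> x) - k * flat (Suc k) (\<phi> x)))) (at x)" if "x \<in> S" for x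
      using has_derivative_compose[OF has_derivative_grad DERIV_flat[unfolded has_field_derivative_def]]
        Ck_on_differentiable[OF Suc.prems(2) that] by (simp add: mult.commute)
    have "Ck_on n S (\<lambda>x. partial_deriv i \<phi> x * (flat (k+2) (\<phi> x) + (- real k) * flat (Suc k) (\<phi> x)))" for i
      using Suc Ck_on_SucD by (intro Ck_on_mult Ck_on_add Ck_on_const) auto
    then show "Ck_on n S (\<lambda>x. (grad \<phi> x \<bullet> axis i 1) * (flat (k+2) (\<phi> x) - k * flat (Suc k) (\<phi> x)))" for i
      by (simp add: inner_axis)
  qed
qed

lemma smooth_on_flat: "open S \<Longrightarrow> smooth_on S \<phi> \<Longrightarrow> smooth_on S (\<lambda>x. flat k (\<phi> x))"
  by (simp add: smooth_on_def Ck_on_flat)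

section \<open>Test functions supported in an open set\<close>

definition cont_compact :: "('a::euclidean_space \<Rightarrow> real) \<Rightarrow> bool" where
  "cont_compact u \<longleftrightarrow> continuous_on UNIV u \<and> (\<exists>K. compact K \<and> (\<forall>x. x \<notin> K \<longrightarrow> u x = 0))"

text \<open>Smooth on the whole space but supported in a compact part of S: extension by zero is
  built in, so a function that is smooth on S alone may appear as a factor.\<close>

definition test_on :: "(real^'n::finite) set \<Rightarrow> (real^'n \<Rightarrow> real) \<Rightarrow> bool" where
  "test_on S \<phi> \<longleftrightarrow> smooth_on UNIV \<phi> \<and> (\<exists>K. compact K \<and> K \<subseteq> S \<and> (\<forall>x. x \<notin> K \<longrightarrow> \<phi> x = 0))"

lemma test_fun_iff: "test_fun \<phi> \<longleftrightarrow> test_on UNIV \<phi>"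
proof -
  have "compact (closure {x. \<phi> x \<noteq> 0}) \<longleftrightarrow> (\<exists>K. compact K \<and> (\<forall>x. x \<notin> K \<longrightarrow> \<phi> x = 0))"
  proof
    assume "compact (closure {x. \<phi> x \<noteq> 0})"
    then show "\<exists>K. compact K \<and> (\<forall>x. x \<notin> K \<longrightarrow> \<phi> x = 0)"
      using closure_subset[of "{x. \<phi> x \<noteq> 0}"] by (intro exI[of _ "closure {x. \<phi> x \<noteq> 0}"]) blast
  next
    assume "\<exists>K. compact K \<and> (\<forall>x. x \<notin> K \<longrightarrow> \<phi> x = 0)"
    then obtain K where K: "compact K" "\<forall>x. x \<notin> K \<longrightarrow> \<phi> x = 0" by blast
    then have "{x. \<phi> x \<noteq> 0} \<subseteq> K" by blast
    with K(1) show "compact (closure {x. \<phi> x \<noteq> 0})"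
      using bounded_subset compact_closure compact_imp_bounded by blast
  qed
  then show ?thesis by (simp add: test_fun_def test_on_def smooth_fun_iff)
qed

lemma test_on_mono: "test_on S \<phi> \<Longrightarrow> S \<subseteq> T \<Longrightarrow> test_on T \<phi>"
  unfolding test_on_def by blast

lemma test_on_smooth: "test_on S \<phi> \<Longrightarrow> smooth_on UNIV \<phi>"
  by (simp add: test_on_def)

lemma test_on_differentiable: "test_on S \<phi> \<Longrightarrow> \<phi> differentiable (at x)"
  using smooth_on_differentiable[OF test_on_smooth] by auto

text \<open>S and the complement of K are open and cover the space, and on the latter the function
  is zero; smoothness on the union follows.\<close>

lemma test_onI:
  assumes "open S" "smooth_on S \<phi>" "compact K" "K \<subseteq> S" "\<And>x. x \<notin> K \<Longrightarrow> \<phi> x = 0"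
  shows "test_on S \<phi>"
proof -
  have "open (- K)" using \<open>compact K\<close> by (simp add: compact_imp_closed open_Compl)
  then have "smooth_on (- K) \<phi>"
    using smooth_on_cong[of "- K" \<phi> "\<lambda>x. 0"] assms(5) smooth_on_const by auto
  with assms(2) have "smooth_on (S \<union> - K) \<phi>" by (rule smooth_on_Un)
  moreover have "S \<union> - K = UNIV" using assms(4) by auto
  ultimately show ?thesis using assms unfolding test_on_def by auto
qed

lemma test_on_partial_deriv:
  assumes "test_on S \<phi>"
  shows "test_on S (partial_deriv i \<phi>)"
proof -
  obtain K where K: "compact K" "K \<subseteq> S" "\<And>x. x \<notin> K \<Longrightarrow> \<phi> x = 0"
    using assms by (auto simp: test_on_def)
  have o: "open (- K)" using \<open>compact K\<close> by (simp add: compact_imp_closed open_Compl)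
  have "partial_deriv i \<phi> x = 0" if "x \<notin> K" for x
    using partial_deriv_cong_open(1)[OF o, of x \<phi> "\<lambda>x. 0" i] that K(3)
      partial_deriv_eqI[OF has_derivative_const, of i 0 x] by auto
  then show ?thesis using assms K smooth_on_partial_deriv by (auto simp: test_on_def)
qed

lemma test_on_mult:
  assumes "open S" "test_on S \<phi>" "smooth_on S \<psi>"
  shows "test_on S (\<lambda>x. \<psi> x * \<phi> x)"
proof -
  obtain K where K: "compact K" "K \<subseteq> S" "\<And>x. x \<notin> K \<Longrightarrow> \<phi> x = 0"
    using assms by (auto simp: test_on_def)
  have "smooth_on S \<phi>" using test_on_smooth[OF assms(2)] smooth_on_mono by blast
  then have "smooth_on S (\<lambda>x. \<psi> x * \<phi> x)" using assms by (auto intro: smooth_on_mult)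
  then show ?thesis by (rule test_onI[OF assms(1) _ K(1,2)]) (use K in auto)
qed

lemma test_on_add:
  assumes "test_on S \<phi>" "test_on S \<psi>"
  shows "test_on S (\<lambda>x. \<phi> x + \<psi> x)"
proof -
  obtain K where K: "compact K" "K \<subseteq> S" "\<And>x. x \<notin> K \<Longrightarrow> \<phi> x = 0"
    using assms by (auto simp: test_on_def)
  obtain L where L: "compact L" "L \<subseteq> S" "\<And>x. x \<notin> L \<Longrightarrow> \<psi> x = 0"
    using assms by (auto simp: test_on_def)
  have "compact (K \<union> L) \<and> K \<union> L \<subseteq> S \<and> (\<forall>x. x \<notin> K \<union> L \<longrightarrow> \<phi> x + \<psi> x = 0)"
    using K L by auto
  then show ?thesis using assms unfolding test_on_def by (blast intro: smooth_on_add)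
qed

lemma test_on_diff:
  assumes "test_on S \<phi>" "test_on S \<psi>"
  shows "test_on S (\<lambda>x. \<phi> x - \<psi> x)"
proof -
  have "test_on S (\<lambda>x. (- 1) * \<psi> x)"
    using assms(2) smooth_on_mult[OF open_UNIV smooth_on_const, of \<psi> "- 1"] unfolding test_on_def
    by (metis mult_zero_right)
  from test_on_add[OF assms(1) this] show ?thesis by simp
qed

lemma test_on_cont_compact: "test_on S \<phi> \<Longrightarrow> cont_compact \<phi>"
  unfolding test_on_def cont_compact_def using smooth_on_continuous by blast

lemma test_on_reflect:
  assumes "test_on UNIV \<psi>"
  shows "test_on UNIV (\<lambda>y. \<psi> (x - y))"
    and "partial_deriv i (\<lambda>y. \<psi> (x - y)) y = - partial_deriv i \<psi> (x - y)"
proof -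
  obtain K where K: "compact K" "\<And>x. x \<notin> K \<Longrightarrow> \<psi> x = 0"
    using assms by (auto simp: test_on_def)
  have "smooth_on UNIV (\<lambda>y. \<psi> (x - y))"
    by (rule smooth_on_compose[where T=UNIV]) (use assms in \<open>auto simp: test_on_smooth intro!: smooth_intros\<close>)
  moreover have "compact ((\<lambda>z. x - z) ` K)"
    by (intro compact_continuous_image K continuous_intros)
  moreover have "\<psi> (x - y) = 0" if "y \<notin> (\<lambda>z. x - z) ` K" for y
  proof (rule K(2))
    show "x - y \<notin> K" using that by (metis add_diff_cancel_left' diff_add_cancel image_eqI)
  qed
  ultimately show "test_on UNIV (\<lambda>y. \<psi> (x - y))" unfolding test_on_def by auto
  have "((\<lambda>y. \<psi> (x - y)) has_derivative (\<lambda>h. grad \<psi> (x - y) \<bullet> (- h))) (at y)"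
    by (rule has_derivative_compose[OF _ has_derivative_grad])
      (auto intro!: derivative_eq_intros test_on_differentiable[OF assms])
  from partial_deriv_eqI[OF this] show "partial_deriv i (\<lambda>y. \<psi> (x - y)) y = - partial_deriv i \<psi> (x - y)"
    by (simp add: inner_axis)
qed

lemma partial_deriv_diff:
  "\<phi> differentiable (at x) \<Longrightarrow> \<psi> differentiable (at x) \<Longrightarrow>
    partial_deriv i (\<lambda>x. \<phi> x - \<psi> x) x = partial_deriv i \<phi> x - partial_deriv i \<psi> x"
  using partial_deriv_eqI[OF has_derivative_diff[OF has_derivative_grad has_derivative_grad]]
  by (simp add: inner_axis)

lemma partial_deriv_mult:
  "\<phi> differentiable (at x) \<Longrightarrow> \<psi> differentiable (at x) \<Longrightarrow>
    partial_deriv i (\<lambda>x. \<phi> x * \<psi> x) x = \<phi> x * partial_deriv i \<psi> x + partial_deriv i \<phi> x * \<psi> x"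
  using partial_deriv_eqI[OF has_derivative_mult[OF has_derivative_grad has_derivative_grad]]
  by (simp add: inner_axis)

lemma grad_diff:
  "\<phi> differentiable (at x) \<Longrightarrow> \<psi> differentiable (at x) \<Longrightarrow> grad (\<lambda>x. \<phi> x - \<psi> x) x = grad \<phi> x - grad \<psi> x"
  by (simp add: vec_eq_iff partial_deriv_diff)

lemma grad_mult:
  "\<phi> differentiable (at x) \<Longrightarrow> \<psi> differentiable (at x) \<Longrightarrow>
    grad (\<lambda>x. \<phi> x * \<psi> x) x = \<phi> x *\<^sub>R grad \<psi> x + \<psi> x *\<^sub>R grad \<phi> x"
  by (simp add: vec_eq_iff partial_deriv_mult mult.commute)

lemma cont_compact_measurable [measurable_dest]: "cont_compact u \<Longrightarrow> u \<in> borel_measurable borel"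
  by (auto simp: cont_compact_def intro: borel_measurable_continuous_onI)

lemma cont_compact_bounded:
  assumes "cont_compact u"
  obtains B where "B > 0" "\<And>x. \<bar>u x\<bar> \<le> B"
proof -
  obtain K where K: "compact K" "\<And>x. x \<notin> K \<Longrightarrow> u x = 0" and c: "continuous_on UNIV u"
    using assms by (auto simp: cont_compact_def)
  have "compact (u ` K)" using K c by (meson compact_continuous_image continuous_on_subset subset_UNIV)
  then obtain B where "B > 0" and B: "\<And>y. y \<in> u ` K \<Longrightarrow> norm y \<le> B"
    using compact_imp_bounded bounded_pos by metis
  have "\<bar>u x\<bar> \<le> B" for x
    using B[of "u x"] K(2)[of x] \<open>B > 0\<close> by (cases "x \<in> K") auto
  with \<open>B > 0\<close> show ?thesis using that by blast
qed

lemma cont_compact_integrable: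
  assumes "cont_compact u"
  shows "integrable lborel u" "integrable lebesgue u"
proof -
  obtain K where K: "compact K" "\<And>x. x \<notin> K \<Longrightarrow> u x = 0" and c: "continuous_on UNIV u"
    using assms by (auto simp: cont_compact_def)
  have "integrable lborel (\<lambda>x. indicator K x *\<^sub>R u x)"
    by (rule borel_integrable_compact[OF K(1)]) (use c continuous_on_subset in auto)
  moreover have "(\<lambda>x. indicator K x *\<^sub>R u x) = u" using K(2) by (force simp: indicator_def)
  ultimately show "integrable lborel u" by simp
  then show "integrable lebesgue u"
    using integrable_completion[of u lborel] assms cont_compact_measurable by auto
qed

lemma cont_compact_mult: "cont_compact u \<Longrightarrow> continuous_on UNIV v \<Longrightarrow> cont_compact (\<lambda>x. v x * u x)"
  unfolding cont_compact_def by (metis continuous_on_mult mult_zero_right)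

lemma cont_compact_add:
  assumes "cont_compact u" "cont_compact v"
  shows "cont_compact (\<lambda>x. u x + v x)"
proof -
  obtain K L where K: "compact K" "\<And>x. x \<notin> K \<Longrightarrow> u x = 0" "compact L" "\<And>x. x \<notin> L \<Longrightarrow> v x = 0"
    using assms by (auto simp: cont_compact_def)
  have "compact (K \<union> L) \<and> (\<forall>x. x \<notin> K \<union> L \<longrightarrow> u x + v x = 0)"
    using K by auto
  then show ?thesis using assms unfolding cont_compact_def by (blast intro: continuous_on_add)
qed

lemma cont_compact_sum: "finite I \<Longrightarrow> I \<noteq> {} \<Longrightarrow> (\<And>i. i \<in> I \<Longrightarrow> cont_compact (f i)) \<Longrightarrow> cont_compact (\<lambda>x. \<Sum>i\<in>I. f i x)"
  by (induction I rule: finite_ne_induct) (auto intro: cont_compact_add)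

lemma cont_compact_norm_grad_power2:
  assumes "test_on S \<phi>"
  shows "cont_compact (\<lambda>x. (norm (grad \<phi> x))\<^sup>2)"
proof -
  have "cont_compact (\<lambda>x. \<Sum>i\<in>UNIV. partial_deriv i \<phi> x * partial_deriv i \<phi> x)"
    by (intro cont_compact_sum cont_compact_mult test_on_cont_compact[OF test_on_partial_deriv[OF assms]])
      (use test_on_partial_deriv[OF assms] test_on_cont_compact cont_compact_def in auto)
  then show ?thesis by (simp add: power2_norm_eq_inner inner_vec_def)
qed

lemma onorm_inner_le:
  fixes v :: "'a::euclidean_space"
  assumes "norm v \<le> B"
  shows "onorm ((\<bullet>) v) \<le> B"
proof (rule onorm_le)
  fix x :: 'a
  have "norm v * norm x \<le> B * norm x" using assms by (intro mult_right_mono) auto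
  then show "norm (v \<bullet> x) \<le> B * norm x" using Cauchy_Schwarz_ineq2[of v x] by simp
qed

text \<open>The gradient is continuous with compact support, hence bounded, and the mean value
  inequality applies.\<close>

lemma test_on_Lipschitz:
  assumes "test_on S \<phi>"
  obtains B where "B > 0" "\<And>x y. \<bar>\<phi> x - \<phi> y\<bar> \<le> B * norm (x - y)" "\<And>x. norm (grad \<phi> x) \<le> B"
proof -
  obtain C where C: "C > 0" "\<And>x. \<bar>(norm (grad \<phi> x))\<^sup>2\<bar> \<le> C"
    using cont_compact_bounded[OF cont_compact_norm_grad_power2[OF assms]] by blast
  have g: "norm (grad \<phi> x) \<le> sqrt C" for x
    using C(2)[of x] by (simp add: real_le_rsqrt)
  have "norm (\<phi> x - \<phi> y) \<le> sqrt C * norm (x - y)" for x y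
  proof (rule differentiable_bound[where S=UNIV and f'="\<lambda>x h. grad \<phi> x \<bullet> h"])
    show "(\<phi> has_derivative (\<bullet>) (grad \<phi> x)) (at x within UNIV)" for x
      using has_derivative_grad[OF test_on_differentiable[OF assms]] by simp
    show "onorm ((\<bullet>) (grad \<phi> x)) \<le> sqrt C" for x
      by (rule onorm_inner_le[OF g])
  qed auto
  then show ?thesis using that[of "sqrt C"] C(1) g by auto
qed

text \<open>The second order remainder is controlled uniformly in x because the partial derivatives
  are Lipschitz. This uniformity is what allows differentiation under the convolution
  integral.\<close>

lemma test_on_Taylor:
  assumes "test_on S \<phi>"
  obtains B where "B > 0" "\<And>x h. \<bar>\<phi> (x + h) - \<phi> x - grad \<phi> x \<bullet> h\<bar> \<le> B * (norm h)\<^sup>2"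
proof -
  have "\<forall>i. \<exists>B>0. \<forall>x y. \<bar>partial_deriv i \<phi> x - partial_deriv i \<phi> y\<bar> \<le> B * norm (x - y)"
    using test_on_Lipschitz[OF test_on_partial_deriv[OF assms]] by metis
  then obtain B where B: "\<And>i. B i > 0" "\<And>i x y. \<bar>partial_deriv i \<phi> x - partial_deriv i \<phi> y\<bar> \<le> B i * norm (x - y)"
    by metis
  define C where "C = (\<Sum>i\<in>UNIV. B i)"
  have C: "C > 0" unfolding C_def by (rule sum_pos) (use B in auto)
  have g: "norm (grad \<phi> x - grad \<phi> y) \<le> C * norm (x - y)" for x y
  proof -
    have "norm (grad \<phi> x - grad \<phi> y) \<le> (\<Sum>i\<in>UNIV. \<bar>(grad \<phi> x - grad \<phi> y) $ i\<bar>)"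
      by (rule norm_le_l1_cart)
    also have "\<dots> \<le> (\<Sum>i\<in>UNIV. B i * norm (x - y))"
      using B(2) by (intro sum_mono) simp
    finally show ?thesis by (simp add: C_def sum_distrib_right)
  qed
  have "\<bar>\<phi> (x + h) - \<phi> x - grad \<phi> x \<bullet> h\<bar> \<le> C * (norm h)\<^sup>2" for x h
  proof -
    have "norm (\<phi> (x + h) - \<phi> x - (grad \<phi> x) \<bullet> (x + h - x)) \<le> norm (x + h - x) * (C * norm h)"
    proof (rule differentiable_bound_linearization[where S="closed_segment x (x + h)" and f'="\<lambda>x h. grad \<phi> x \<bullet> h"])
      show "(\<phi> has_derivative (\<bullet>) (grad \<phi> y)) (at y within closed_segment x (x + h))" for y
        using has_derivative_grad[OF test_on_differentiable[OF assms]] has_derivative_at_withinI by blast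
      show "x + t *\<^sub>R (x + h - x) \<in> closed_segment x (x + h)" if "t \<in> {0..1}" for t
        using that by (auto simp: closed_segment_def algebra_simps intro!: exI[of _ t])
      show "onorm ((\<bullet>) (grad \<phi> y) - (\<bullet>) (grad \<phi> x)) \<le> C * norm h" if "y \<in> closed_segment x (x + h)" for y
      proof -
        have "norm (y - x) \<le> norm h" using segment_bound1[OF that] by simp
        then have "norm (grad \<phi> y - grad \<phi> x) \<le> C * norm h"
          using g[of y x] C by (meson mult_left_mono order_trans less_imp_le)
        moreover have "(\<bullet>) (grad \<phi> y) - (\<bullet>) (grad \<phi> x) = (\<bullet>) (grad \<phi> y - grad \<phi> x)"
          by (auto simp: inner_diff_left)
        ultimately show ?thesis by (simp add: onorm_inner_le)
      qed
    qed auto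
    then show ?thesis by (simp add: power2_eq_square mult.commute mult.left_commute)
  qed
  then show ?thesis using that C by blast
qed

lemma lborel_translation_reflection:
  fixes a :: "'a::euclidean_space"
  shows "distr lborel borel (\<lambda>x. a - x) = lborel" "distr lborel borel (\<lambda>x. a + x) = lborel"
  using lborel_affine[of "-1" a] lborel_affine[of 1 a] by (simp_all add: density_1)

text \<open>Difference quotients along a coordinate axis have integral 0 by translation invariance
  of Lebesgue measure, and they converge to the partial derivative under a common integrable
  bound.\<close>

lemma integral_partial_deriv_test:
  assumes "test_on S \<phi>"
  shows "(\<integral>x. partial_deriv i \<phi> x \<partial>lborel) = 0"
proof -
  obtain K where K: "compact K" "\<And>x. x \<notin> K \<Longrightarrow> \<phi> x = 0"
    using assms by (auto simp: test_on_def)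
  obtain B where B: "B > 0" "\<And>x y. \<bar>\<phi> x - \<phi> y\<bar> \<le> B * norm (x - y)"
    using test_on_Lipschitz[OF assms] by metis
  define e :: "real^'a" where "e = axis i 1"
  \<comment> \<open>The steps of the quotients have length at most 1, so L contains the supports of
    all \<open>d k\<close>.\<close>
  define L where "L = {x - y | x y. x \<in> K \<and> y \<in> cball 0 1}"
  have L: "compact L" unfolding L_def by (rule compact_differences[OF K(1) compact_cball])
  have cc: "cont_compact \<phi>" using assms test_on_cont_compact by blast
  have [measurable]: "\<phi> \<in> borel_measurable borel" "partial_deriv i \<phi> \<in> borel_measurable borel"
    using cc test_on_cont_compact[OF test_on_partial_deriv[OF assms]] cont_compact_measurable by auto
  define d where "d k x = real (Suc k) * (\<phi> (e /\<^sub>R real (Suc k) + x) - \<phi> x)" for k x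
  have d0: "(\<integral>x. d k x \<partial>lborel) = 0" for k
  proof -
    let ?a = "e /\<^sub>R real (Suc k)"
    have I: "integrable (distr lborel borel (\<lambda>x. ?a + x)) \<phi>"
      using cont_compact_integrable(1)[OF cc] by (simp only: lborel_translation_reflection)
    have "integrable lborel (\<lambda>x. \<phi> (?a + x))"
      using I by (subst (asm) integrable_distr_eq) auto
    moreover have "(\<integral>x. \<phi> (?a + x) \<partial>lborel) = (\<integral>x. \<phi> x \<partial>lborel)"
    proof -
      have "(\<integral>x. \<phi> x \<partial>lborel) = (\<integral>x. \<phi> x \<partial>distr lborel borel (\<lambda>x. ?a + x))"
        by (simp only: lborel_translation_reflection)
      also have "\<dots> = (\<integral>x. \<phi> (?a + x) \<partial>lborel)" by (rule integral_distr) auto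
      finally show ?thesis by simp
    qed
    ultimately show ?thesis using cont_compact_integrable(1)[OF cc] by (simp add: d_def)
  qed
  have "(\<lambda>k. \<integral>x. d k x \<partial>lborel) \<longlonglongrightarrow> (\<integral>x. partial_deriv i \<phi> x \<partial>lborel)"
  proof (rule integral_dominated_convergence[where w="\<lambda>x. B * indicator L x"])
    have "emeasure lborel L < \<infinity>" using L emeasure_compact_finite by blast
    then show "integrable lborel (\<lambda>x. B * indicator L x)"
      using L by (auto simp: compact_imp_closed intro!: integrable_real_indicator)
    show "AE x in lborel. (\<lambda>k. d k x) \<longlonglongrightarrow> partial_deriv i \<phi> x"
    proof (rule AE_I2)
      fix x
      have "((\<lambda>t. x + t *\<^sub>R e) has_derivative (\<lambda>t. t *\<^sub>R e)) (at 0)"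
        by (auto intro!: derivative_eq_intros)
      moreover have "(\<phi> has_derivative (\<lambda>h. grad \<phi> x \<bullet> h)) (at (x + 0 *\<^sub>R e))"
        using has_derivative_grad[OF test_on_differentiable[OF assms]] by simp
      ultimately have "((\<lambda>t. \<phi> (x + t *\<^sub>R e)) has_derivative (\<lambda>t. grad \<phi> x \<bullet> (t *\<^sub>R e))) (at 0)"
        by (rule has_derivative_compose)
      then have "((\<lambda>t. \<phi> (x + t *\<^sub>R e)) has_real_derivative partial_deriv i \<phi> x) (at 0)"
        by (rule has_derivative_imp_has_field_derivative) (simp add: e_def inner_axis)
      then have "((\<lambda>t. (\<phi> (x + t *\<^sub>R e) - \<phi> x) / t) \<longlongrightarrow> partial_deriv i \<phi> x) (at 0)"
        by (simp add: has_field_derivative_iff)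
      moreover have "filterlim (\<lambda>k. inverse (real (Suc k))) (at 0) sequentially"
        using LIMSEQ_inverse_real_of_nat by (simp add: filterlim_at)
      ultimately have "(\<lambda>k. (\<phi> (x + inverse (real (Suc k)) *\<^sub>R e) - \<phi> x) / inverse (real (Suc k))) \<longlonglongrightarrow> partial_deriv i \<phi> x"
        by (rule filterlim_compose)
      then show "(\<lambda>k. d k x) \<longlonglongrightarrow> partial_deriv i \<phi> x"
        unfolding d_def by (simp add: field_simps add.commute)
    qed
    show "AE x in lborel. norm (d k x) \<le> B * indicator L x" for k
    proof (rule AE_I2)
      fix x
      let ?a = "e /\<^sub>R real (Suc k)"
      have na: "norm ?a = inverse (real (Suc k))" by (simp add: e_def)
      show "norm (d k x) \<le> B * indicator L x"
      proof (cases "x \<in> L")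
        case True
        have "norm (d k x) = real (Suc k) * \<bar>\<phi> (?a + x) - \<phi> x\<bar>" by (simp add: d_def abs_mult)
        also have "\<dots> \<le> real (Suc k) * (B * norm ?a)"
          using B(2)[of "?a + x" x] by (intro mult_left_mono) auto
        also have "\<dots> = B" unfolding na by simp
        finally show ?thesis using True by simp
      next
        case False
        have "inverse (real (Suc k)) \<le> 1" by (simp add: field_simps)
        then have c: "?a \<in> cball 0 1" using na by (simp add: mem_cball_0)
        have "x \<notin> K" using False unfolding L_def by (force intro: exI[of _ x] exI[of _ 0])
        moreover have "?a + x \<notin> K"
        proof
          assume "?a + x \<in> K"
          then have "(?a + x) - ?a \<in> L" unfolding L_def using c by blast
          then show False using False by simp
        qed
        ultimately show ?thesis using False K(2) by (simp add: d_def)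
      qed
    qed
  qed (auto simp: d_def)
  then show ?thesis using d0 by (simp add: LIMSEQ_const_iff)
qed

lemma integral_partial_deriv_test_lebesgue:
  assumes "test_on S \<phi>"
  shows "(\<integral>x. partial_deriv i \<phi> x \<partial>lebesgue) = 0"
  using integral_partial_deriv_test[OF assms] integral_completion[of "partial_deriv i \<phi>" lborel]
    cont_compact_measurable[OF test_on_cont_compact[OF test_on_partial_deriv[OF assms]]] by simp

section \<open>Square-integrable functions\<close>

definition L2 :: "('a::euclidean_space \<Rightarrow> 'b::euclidean_space) \<Rightarrow> bool" where
  "L2 f \<longleftrightarrow> f \<in> borel_measurable lebesgue \<and> integrable lebesgue (\<lambda>x. (norm (f x))\<^sup>2)"

text \<open>A total function: where the square is not integrable the Bochner integral returns 0.
  Bounds on \<open>nsq\<close> are therefore meaningful only together with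
  \<open>L2\<close>.\<close>

definition nsq :: "('a::euclidean_space \<Rightarrow> 'b::euclidean_space) \<Rightarrow> real" where
  "nsq f = (\<integral>x. (norm (f x))\<^sup>2 \<partial>lebesgue)"

lemma nsq_nonneg [simp]: "0 \<le> nsq f"
  by (simp add: nsq_def)

lemma L2_measurable [measurable_dest]: "L2 f \<Longrightarrow> f \<in> borel_measurable lebesgue"
  by (simp add: L2_def)

lemma L2_integrable: "L2 f \<Longrightarrow> integrable lebesgue (\<lambda>x. (norm (f x))\<^sup>2)"
  by (simp add: L2_def)

lemma L2_real_iff: "L2 f \<longleftrightarrow> f \<in> borel_measurable lebesgue \<and> integrable lebesgue (\<lambda>x. (f x)\<^sup>2)"
  for f :: "'a::euclidean_space \<Rightarrow> real"
  by (simp add: L2_def)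

lemma nsq_real: "nsq f = (\<integral>x. (f x)\<^sup>2 \<partial>lebesgue)" for f :: "'a::euclidean_space \<Rightarrow> real"
  by (simp add: nsq_def)

lemma L2_bound:
  assumes "f \<in> borel_measurable lebesgue" "L2 g" "\<And>x. norm (f x) \<le> C * norm (g x)"
  shows "L2 f" "nsq f \<le> C\<^sup>2 * nsq g"
proof -
  have b: "(norm (f x))\<^sup>2 \<le> C\<^sup>2 * (norm (g x))\<^sup>2" for x
    using power_mono[OF assms(3)[of x] norm_ge_zero, of 2] by (simp add: power_mult_distrib)
  have i: "integrable lebesgue (\<lambda>x. C\<^sup>2 * (norm (g x))\<^sup>2)"
    using assms(2) by (simp add: L2_def)
  have "integrable lebesgue (\<lambda>x. (norm (f x))\<^sup>2)"
    by (rule Bochner_Integration.integrable_bound[OF i]) (use assms(1) b in auto)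
  then show "L2 f" using assms(1) by (simp add: L2_def)
  have "nsq f \<le> (\<integral>x. C\<^sup>2 * (norm (g x))\<^sup>2 \<partial>lebesgue)"
    unfolding nsq_def by (rule integral_mono) (use \<open>L2 f\<close> i b in \<open>auto simp: L2_def\<close>)
  then show "nsq f \<le> C\<^sup>2 * nsq g" by (simp add: nsq_def)
qed

lemma L2_scaleR: "L2 f \<Longrightarrow> L2 (\<lambda>x. c *\<^sub>R f x)"
  by (rule L2_bound(1)[where C="\<bar>c\<bar>" and g=f]) auto

lemma nsq_scaleR: "nsq (\<lambda>x. c *\<^sub>R f x) = c\<^sup>2 * nsq f"
  by (simp add: nsq_def power_mult_distrib)

lemma L2_minus: "L2 f \<Longrightarrow> L2 (\<lambda>x. - f x)"
  by (rule L2_bound(1)[where C=1 and g=f]) auto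

lemma nsq_minus_commute: "nsq (\<lambda>x. f x - g x) = nsq (\<lambda>x. g x - f x)"
  by (simp add: nsq_def norm_minus_commute)

text \<open>The free parameter t is the point of this form of Young's inequality: t = 1 gives the
  crude factor 2, and the best t gives the triangle inequality for the square root of
  \<open>nsq\<close>.\<close>

lemma norm_add_power2_le:
  fixes a b :: "'a::real_inner"
  assumes "t > 0"
  shows "(norm (a + b))\<^sup>2 \<le> (1 + t) * (norm a)\<^sup>2 + (1 + 1/t) * (norm b)\<^sup>2"
proof -
  obtain s where s: "s > 0" "t = s\<^sup>2" using assms real_sqrt_gt_zero[of t] by (metis less_imp_le real_sqrt_pow2)
  \<comment> \<open>With t = s^2 the square of s a - b / s absorbs the mixed term.\<close>
  have "0 \<le> (norm (s *\<^sub>R a - (1 / s) *\<^sub>R b))\<^sup>2" by simp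
  also have "\<dots> = s\<^sup>2 * (a \<bullet> a) - 2 * (a \<bullet> b) + (1/s\<^sup>2) * (b \<bullet> b)"
    using s unfolding power2_norm_eq_inner
    by (simp add: inner_diff inner_commute[of b a] field_simps power2_eq_square)
  finally show ?thesis using s
    unfolding power2_norm_eq_inner by (simp add: inner_add inner_commute[of b a] algebra_simps)
qed

lemma L2_add:
  assumes "L2 f" "L2 g"
  shows "L2 (\<lambda>x. f x + g x)"
    and "t > 0 \<Longrightarrow> nsq (\<lambda>x. f x + g x) \<le> (1 + t) * nsq f + (1 + 1/t) * nsq g"
proof -
  have i: "integrable lebesgue (\<lambda>x. (1 + t) * (norm (f x))\<^sup>2 + (1 + 1/t) * (norm (g x))\<^sup>2)" for t :: real
    using assms by (simp add: L2_def)
  have [measurable]: "f \<in> borel_measurable lebesgue" "g \<in> borel_measurable lebesgue"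
    using assms by (auto simp: L2_def)
  have m: "(\<lambda>x. f x + g x) \<in> borel_measurable lebesgue" by measurable
  have "integrable lebesgue (\<lambda>x. (norm (f x + g x))\<^sup>2)"
    by (rule Bochner_Integration.integrable_bound[OF i[of 1]])
      (use m norm_add_power2_le[of 1] in auto)
  with m show L: "L2 (\<lambda>x. f x + g x)" by (simp add: L2_def)
  assume t: "t > 0"
  have "nsq (\<lambda>x. f x + g x) \<le> (\<integral>x. (1 + t) * (norm (f x))\<^sup>2 + (1 + 1/t) * (norm (g x))\<^sup>2 \<partial>lebesgue)"
    unfolding nsq_def by (rule integral_mono) (use L i norm_add_power2_le[OF t] in \<open>auto simp: L2_def\<close>)
  also have "\<dots> = (1 + t) * nsq f + (1 + 1/t) * nsq g"
    using assms by (simp add: nsq_def L2_def)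
  finally show "nsq (\<lambda>x. f x + g x) \<le> (1 + t) * nsq f + (1 + 1/t) * nsq g" .
qed

lemma L2_diff: "L2 f \<Longrightarrow> L2 g \<Longrightarrow> L2 (\<lambda>x. f x - g x)"
  using L2_add(1)[of f "\<lambda>x. - g x"] L2_minus[of g] by simp

lemma nsq_add_le: "L2 f \<Longrightarrow> L2 g \<Longrightarrow> nsq (\<lambda>x. f x + g x) \<le> 2 * nsq f + 2 * nsq g"
  using L2_add(2)[of f g 1] by simp

lemma nsq_triangle: 
  assumes "L2 (\<lambda>x. f x - g x)" "L2 (\<lambda>x. g x - h x)"
  shows "L2 (\<lambda>x. f x - h x)" "nsq (\<lambda>x. f x - h x) \<le> 2 * nsq (\<lambda>x. f x - g x) + 2 * nsq (\<lambda>x. g x - h x)"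
  using L2_add(1)[OF assms] nsq_add_le[OF assms] by simp_all

lemma L2_inner_integrable:
  assumes "L2 f" "L2 g"
  shows "integrable lebesgue (\<lambda>x. f x \<bullet> g x)"
proof (rule Bochner_Integration.integrable_bound)
  show "integrable lebesgue (\<lambda>x. (norm (f x))\<^sup>2 + (norm (g x))\<^sup>2)"
    using assms by (simp add: L2_def)
  have [measurable]: "f \<in> borel_measurable lebesgue" "g \<in> borel_measurable lebesgue"
    using assms by (auto simp: L2_def)
  show "(\<lambda>x. f x \<bullet> g x) \<in> borel_measurable lebesgue" by measurable
  show "AE x in lebesgue. norm (f x \<bullet> g x) \<le> norm ((norm (f x))\<^sup>2 + (norm (g x))\<^sup>2)"
  proof (rule AE_I2)
    fix x
    have "\<bar>f x \<bullet> g x\<bar> \<le> norm (f x) * norm (g x)" by (rule Cauchy_Schwarz_ineq2)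
    also have "\<dots> \<le> (norm (f x))\<^sup>2 + (norm (g x))\<^sup>2"
    proof -
      have "2 * (norm (f x) * norm (g x)) \<le> (norm (f x))\<^sup>2 + (norm (g x))\<^sup>2"
        using sum_squares_bound[of "norm (f x)" "norm (g x)"] by (simp add: mult.assoc)
      moreover have "0 \<le> norm (f x) * norm (g x)" by simp
      ultimately show ?thesis by linarith
    qed
    finally show "norm (f x \<bullet> g x) \<le> norm ((norm (f x))\<^sup>2 + (norm (g x))\<^sup>2)" by simp
  qed
qed

lemma L2_mult_integrable: "L2 f \<Longrightarrow> L2 g \<Longrightarrow> integrable lebesgue (\<lambda>x. f x * g x :: real)"
  using L2_inner_integrable[of f g] by simp

lemma nsq_zero_AE:
  assumes "L2 f" "nsq f = 0"
  shows "AE x in lebesgue. f x = 0"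
proof -
  have "AE x in lebesgue. (norm (f x))\<^sup>2 = 0"
    using integral_nonneg_eq_0_iff_AE[OF L2_integrable[OF assms(1)]] assms(2) by (simp add: nsq_def)
  then show ?thesis by simp
qed

lemma nsq_cong_AE:
  assumes "AE x in lebesgue. f x = g x" "f \<in> borel_measurable lebesgue" "g \<in> borel_measurable lebesgue"
  shows "nsq f = nsq g" "L2 f \<longleftrightarrow> L2 g"
proof -
  have e: "AE x in lebesgue. (norm (f x))\<^sup>2 = (norm (g x))\<^sup>2" using assms(1) by auto
  show "nsq f = nsq g" unfolding nsq_def by (rule integral_cong_AE) (use e assms in auto)
  show "L2 f \<longleftrightarrow> L2 g" unfolding L2_def using integrable_cong_AE[OF _ _ e] assms by auto
qed

lemma L2_AE_eq:
  assumes "L2 f" "L2 g" "nsq (\<lambda>x. f x - g x) = 0"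
  shows "AE x in lebesgue. f x = g x" "nsq f = nsq g"
proof -
  show "AE x in lebesgue. f x = g x" using nsq_zero_AE[OF L2_diff[OF assms(1,2)] assms(3)] by simp
  then show "nsq f = nsq g" by (rule nsq_cong_AE) (use assms in \<open>auto simp: L2_def\<close>)
qed

lemma cont_compact_L2: "cont_compact u \<Longrightarrow> L2 u"
proof -
  assume u: "cont_compact u"
  then have "cont_compact (\<lambda>x. u x * u x)" by (intro cont_compact_mult) (auto simp: cont_compact_def)
  then show "L2 u" using cont_compact_integrable(2) cont_compact_measurable[OF u]
    by (auto simp: L2_real_iff power2_eq_square measurable_completion)
qed

lemma L2_nth:
  fixes g :: "'a::euclidean_space \<Rightarrow> real^'n::finite"
  shows "L2 g \<Longrightarrow> L2 (\<lambda>x. g x $ i)"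
proof (rule L2_bound(1)[where C=1 and g=g])
  assume "L2 g"
  then have [measurable]: "g \<in> borel_measurable lebesgue" by (simp add: L2_def)
  have "(\<lambda>x. g x \<bullet> axis i 1) \<in> borel_measurable lebesgue" by measurable
  then show "(\<lambda>x. g x $ i) \<in> borel_measurable lebesgue" by (simp add: inner_axis)
  show "norm (g x $ i) \<le> 1 * norm (g x)" for x using component_le_norm_cart[of "g x" i] by simp
qed

lemma L2_vecI:
  fixes g :: "'a::euclidean_space \<Rightarrow> real^'n::finite"
  assumes "\<And>i. L2 (\<lambda>x. g x $ i)"
  shows "L2 g" "nsq g = (\<Sum>i\<in>UNIV. nsq (\<lambda>x. g x $ i))"
proof -
  have eq: "(norm (g x))\<^sup>2 = (\<Sum>i\<in>UNIV. (g x $ i)\<^sup>2)" for x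
    by (simp add: power2_norm_eq_inner inner_vec_def flip: power2_eq_square)
  have i: "integrable lebesgue (\<lambda>x. (g x $ i)\<^sup>2)" for i
    using assms by (simp add: L2_real_iff)
  have "g \<in> borel_measurable lebesgue"
  proof (subst borel_measurable_euclidean_space, rule ballI)
    fix b :: "real^'n" assume "b \<in> Basis"
    then obtain j where "b = axis j 1" by (auto simp: Basis_vec_def)
    then show "(\<lambda>x. g x \<bullet> b) \<in> borel_measurable lebesgue"
      using assms[of j] by (simp add: inner_axis L2_def)
  qed
  then show "L2 g" unfolding L2_def eq using i by auto
  show "nsq g = (\<Sum>i\<in>UNIV. nsq (\<lambda>x. g x $ i))"
    unfolding nsq_def eq using i by simp
qed

lemma L2_dominated_convergence:
  assumes "\<And>k. f k \<in> borel_measurable lebesgue" "L2 w"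
    and "\<And>k x. norm (f k x) \<le> norm (w x)"
    and "AE x in lebesgue. (\<lambda>k. f k x) \<longlonglongrightarrow> 0"
  shows "(\<lambda>k. nsq (f k)) \<longlonglongrightarrow> 0"
proof -
  have "(\<lambda>k. \<integral>x. (norm (f k x))\<^sup>2 \<partial>lebesgue) \<longlonglongrightarrow> integral\<^sup>L lebesgue (\<lambda>x::'a. 0)"
  proof (rule integral_dominated_convergence[where w="\<lambda>x. (norm (w x))\<^sup>2"])
    show "AE x in lebesgue. (\<lambda>k. (norm (f k x))\<^sup>2) \<longlonglongrightarrow> 0"
      using assms(4) by eventually_elim (auto intro!: tendsto_eq_intros)
    show "AE x in lebesgue. norm ((norm (f k x))\<^sup>2) \<le> (norm (w x))\<^sup>2" for k
      using assms(3)[of k] by (auto simp: power_mono)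
  qed (use assms in \<open>auto simp: L2_def\<close>)
  then show ?thesis by (simp add: nsq_def)
qed

section \<open>Density of compactly supported continuous functions in L2\<close>

definition cutoff :: "real \<Rightarrow> 'a::euclidean_space \<Rightarrow> real" where
  "cutoff R x = max 0 (min 1 (R + 1 - norm x))"

lemma cutoff_bounds: "0 \<le> cutoff R x" "cutoff R x \<le> 1"
  by (auto simp: cutoff_def)

lemma cont_compact_cutoff: "cont_compact (cutoff R)"
  unfolding cont_compact_def
proof (intro conjI exI[of _ "cball 0 (R+1)"] allI impI)
  show "continuous_on UNIV (cutoff R)" unfolding cutoff_def[abs_def] by (intro continuous_intros)
qed (auto simp: cutoff_def)

definition clamp :: "real \<Rightarrow> real \<Rightarrow> real" where "clamp M y = max (- M) (min M y)"

text \<open>Truncation in value and in space costs little by dominated convergence. The truncated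
  function is then approximated by continuous functions converging almost everywhere, which undergo
  the same truncation so that they stay dominated.\<close>

lemma L2_approx_cont_compact:
  fixes f :: "'a::euclidean_space \<Rightarrow> real"
  assumes f: "L2 f" and e: "e > 0"
  obtains u where "cont_compact u" "nsq (\<lambda>x. f x - u x) < e"
proof -
  have [measurable]: "f \<in> borel_measurable lebesgue" using f by (simp add: L2_def)
  have cm [measurable]: "(cutoff R :: 'a \<Rightarrow> real) \<in> borel_measurable lebesgue" for R
    by (rule L2_measurable[OF cont_compact_L2[OF cont_compact_cutoff]])
  define F where "F k x = clamp (real k) (f x) * cutoff (real k) x" for k x
  have Fm [measurable]: "F k \<in> borel_measurable lebesgue" for k unfolding F_def clamp_def by measurable
  have "(\<lambda>k. nsq (\<lambda>x. f x - F k x)) \<longlonglongrightarrow> 0"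
  proof (rule L2_dominated_convergence[OF _ f])
    show "norm (f x - F k x) \<le> norm (f x)" for k x
    proof -
      let ?c = "clamp (real k) (f x)" and ?t = "cutoff (real k) x"
      have "0 \<le> ?t" "?t \<le> 1" by (rule cutoff_bounds)+
      \<comment> \<open>Truncation moves the value towards 0 without crossing it, so the error never
        exceeds |f x|.\<close>
      consider "0 \<le> ?c" "?c \<le> f x" | "?c \<le> 0" "f x \<le> ?c" unfolding clamp_def by fastforce
      then show ?thesis
      proof cases
        case 1
        then have "0 \<le> ?c * ?t" "?c * ?t \<le> ?c" using \<open>0 \<le> ?t\<close> \<open>?t \<le> 1\<close> by (auto simp: mult_left_le)
        then show ?thesis using 1 by (simp add: F_def)
      next
        case 2
        then have "?c * ?t \<le> 0" "?c \<le> ?c * ?t" using \<open>0 \<le> ?t\<close> \<open>?t \<le> 1\<close>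
          by (auto simp: mult_nonpos_nonneg) (metis minus_mult_left mult_left_le neg_0_le_iff_le neg_le_iff_le)
        then show ?thesis using 2 by (simp add: F_def)
      qed
    qed
    show "AE x in lebesgue. (\<lambda>k. f x - F k x) \<longlonglongrightarrow> 0"
    proof (rule AE_I2)
      fix x
      obtain N :: nat where N: "\<bar>f x\<bar> + norm x \<le> real N" using real_arch_simple by blast
      have "f x - F k x = 0" if "k \<ge> N" for k
      proof -
        have "real k \<ge> real N" using that by simp
        with N have a: "\<bar>f x\<bar> \<le> real k" "norm x \<le> real k"
          using norm_ge_zero[of x] abs_ge_zero[of "f x"] by linarith+
        have "clamp (real k) (f x) = f x" "cutoff (real k) x = 1"
          using a by (auto simp: clamp_def cutoff_def)
        then show ?thesis by (simp add: F_def)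
      qed
      then show "(\<lambda>k. f x - F k x) \<longlonglongrightarrow> 0"
        by (intro tendsto_eventually eventually_sequentiallyI)
    qed
  qed measurable
  then have "\<forall>\<^sub>F k in sequentially. nsq (\<lambda>x. f x - F k x) < e/4"
    using e by (intro order_tendstoD) auto
  then obtain M where M: "nsq (\<lambda>x. f x - F M x) < e/4" by (auto simp: eventually_sequentially)
  \<comment> \<open>Lebesgue measurability provides continuous functions that converge to f off a
    negligible set.\<close>
  obtain N g where N: "negligible N" and g: "\<And>k. continuous_on UNIV (g k)"
    and lim: "\<And>x. x \<notin> N \<Longrightarrow> (\<lambda>k. g k x) \<longlonglongrightarrow> f x"
    using lebesgue_measurable_imp_measurable_on_real[of f UNIV] by (auto simp: measurable_on_def)
  define u where "u k x = clamp (real M) (g k x) * cutoff (real M) x" for k x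
  have uc: "cont_compact (u k)" for k
    unfolding u_def clamp_def by (intro cont_compact_mult cont_compact_cutoff continuous_intros g)
  have um [measurable]: "u k \<in> borel_measurable lebesgue" for k
    using cont_compact_L2[OF uc] by (simp add: L2_def)
  have "(\<lambda>k. nsq (\<lambda>x. F M x - u k x)) \<longlonglongrightarrow> 0"
  proof (rule L2_dominated_convergence[where w="\<lambda>x. (2 * real M) *\<^sub>R cutoff (real M) x"])
    show "L2 (\<lambda>x::'a. (2 * real M) *\<^sub>R cutoff (real M) x)" by (intro L2_scaleR cont_compact_L2 cont_compact_cutoff)
    show "norm (F M x - u k x) \<le> norm ((2 * real M) *\<^sub>R cutoff (real M) x)" for k x
    proof -
      have "\<bar>clamp (real M) (f x) - clamp (real M) (g k x)\<bar> \<le> 2 * real M" by (auto simp: clamp_def)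
      then have "\<bar>clamp (real M) (f x) - clamp (real M) (g k x)\<bar> * cutoff (real M) x \<le> 2 * real M * cutoff (real M) x"
        using cutoff_bounds(1)[of M x] by (rule mult_right_mono)
      moreover have "F M x - u k x = (clamp (real M) (f x) - clamp (real M) (g k x)) * cutoff (real M) x"
        by (simp add: F_def u_def algebra_simps)
      ultimately show ?thesis using cutoff_bounds(1)[of M x] by (simp add: abs_mult)
    qed
    have "AE x in lebesgue. x \<notin> N" using N by (simp add: negligible_iff_null_sets AE_not_in)
    then show "AE x in lebesgue. (\<lambda>k. F M x - u k x) \<longlonglongrightarrow> 0"
    proof eventually_elim
      case (elim x)
      have "(\<lambda>k. F M x - u k x) \<longlonglongrightarrow> F M x - clamp (real M) (f x) * cutoff (real M) x"
        unfolding u_def clamp_def by (intro tendsto_intros lim elim)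
      then show ?case by (simp add: F_def)
    qed
  qed measurable
  then have "\<forall>\<^sub>F k in sequentially. nsq (\<lambda>x. F M x - u k x) < e/4"
    using e by (intro order_tendstoD) auto
  then obtain k where k: "nsq (\<lambda>x. F M x - u k x) < e/4" by (auto simp: eventually_sequentially)
  have LF: "L2 (F M)"
  proof (rule L2_bound(1)[where C=1, OF Fm f])
    show "norm (F M x) \<le> 1 * norm (f x)" for x
    proof -
      have "\<bar>clamp (real M) (f x)\<bar> \<le> \<bar>f x\<bar>" by (auto simp: clamp_def)
      then have "\<bar>clamp (real M) (f x)\<bar> * cutoff (real M) x \<le> \<bar>f x\<bar> * 1"
        using cutoff_bounds[of M x] by (intro mult_mono) auto
      then show ?thesis using cutoff_bounds[of M x] by (simp add: F_def abs_mult)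
    qed
  qed
  have "nsq (\<lambda>x. f x - u k x) \<le> 2 * nsq (\<lambda>x. f x - F M x) + 2 * nsq (\<lambda>x. F M x - u k x)"
    by (rule nsq_triangle) (use L2_diff f LF cont_compact_L2[OF uc] in auto)
  then have "nsq (\<lambda>x. f x - u k x) < e" using M k by linarith
  then show ?thesis using that uc by blast
qed

section \<open>Mollification\<close>

definition conv :: "(real^'n::finite \<Rightarrow> real) \<Rightarrow> (real^'n \<Rightarrow> real) \<Rightarrow> real^'n \<Rightarrow> real" where
  "conv f \<psi> x = (\<integral>y. f y * \<psi> (x - y) \<partial>lebesgue)"

lemma conv_integrable:
  assumes "L2 f" "test_on UNIV \<psi>"
  shows "integrable lebesgue (\<lambda>y. f y * \<psi> (x - y))"
  by (rule L2_mult_integrable[OF assms(1) cont_compact_L2[OF test_on_cont_compact[OF test_on_reflect(1)[OF assms(2)]]]])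

lemma partial_deriv_zero_off:
  assumes "closed K" "\<And>x. x \<notin> K \<Longrightarrow> \<phi> x = 0" "x \<notin> K"
  shows "partial_deriv i \<phi> x = 0"
  using partial_deriv_cong_open(1)[of "- K" x \<phi> "\<lambda>x. 0" i] assms
    partial_deriv_eqI[OF has_derivative_const, of i 0 x] by (auto simp: open_Compl)

text \<open>The Taylor remainder of the kernel is at most B |h|^2 for all y, and for |h| <= 1 it
  vanishes unless y lies in a fixed bounded set. Integrating it against f leaves an error of order
  |h|^2.\<close>

lemma conv_has_derivative:
  assumes f: "L2 f" and \<psi>: "test_on UNIV \<psi>"
  shows "(conv f \<psi> has_derivative (\<lambda>h. \<Sum>i\<in>UNIV. h $ i * conv f (partial_deriv i \<psi>) x)) (at x)"
proof -
  obtain K where K: "compact K" "\<And>x. x \<notin> K \<Longrightarrow> \<psi> x = 0"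
    using \<psi> by (auto simp: test_on_def)
  obtain B where B: "B > 0" "\<And>x h. \<bar>\<psi> (x + h) - \<psi> x - grad \<psi> x \<bullet> h\<bar> \<le> B * (norm h)\<^sup>2"
    using test_on_Taylor[OF \<psi>] by metis
  \<comment> \<open>M collects every y at which the kernel, evaluated at x + h - y for some |h| <=
    1, may be nonzero.\<close>
  define M where "M = {a - b | a b. a \<in> cball x 1 \<and> b \<in> K}"
  have "compact M" unfolding M_def by (rule compact_differences[OF compact_cball K(1)])
  then obtain R where R: "\<And>y. y \<in> M \<Longrightarrow> norm y \<le> R"
    using compact_imp_bounded bounded_iff by metis
  define w where "w y = \<bar>f y\<bar> * cutoff R y" for y
  have "L2 (\<lambda>y. \<bar>f y\<bar>)" using f L2_bound(1)[of "\<lambda>y. \<bar>f y\<bar>" f 1] by (auto simp: L2_def)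
  then have w: "integrable lebesgue w" unfolding w_def
    by (rule L2_mult_integrable[OF _ cont_compact_L2[OF cont_compact_cutoff]])
  define C where "C = (\<integral>y. w y \<partial>lebesgue)"
  have tp: "test_on UNIV (partial_deriv i \<psi>)" for i using test_on_partial_deriv[OF \<psi>] .
  have main: "\<bar>conv f \<psi> (x + h) - conv f \<psi> x - (\<Sum>i\<in>UNIV. h $ i * conv f (partial_deriv i \<psi>) x)\<bar> \<le> B * (norm h)\<^sup>2 * C"
    if h: "norm h \<le> 1" for h
  proof -
    define r where "r y = f y * (\<psi> (x + h - y) - \<psi> (x - y) - grad \<psi> (x - y) \<bullet> h)" for y
    have r_eq: "r y = f y * \<psi> (x + h - y) - f y * \<psi> (x - y) - (\<Sum>i\<in>UNIV. h $ i * (f y * partial_deriv i \<psi> (x - y)))" for y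
      by (simp add: r_def inner_vec_def algebra_simps sum_distrib_left)
    have ri: "integrable lebesgue r" unfolding r_eq[abs_def]
      by (intro Bochner_Integration.integrable_diff Bochner_Integration.integrable_sum
          integrable_mult_right conv_integrable f \<psi> tp)
    have "conv f \<psi> (x + h) - conv f \<psi> x - (\<Sum>i\<in>UNIV. h $ i * conv f (partial_deriv i \<psi>) x) = (\<integral>y. r y \<partial>lebesgue)"
      unfolding r_eq[abs_def] conv_def
      using conv_integrable[OF f \<psi>] conv_integrable[OF f tp] by simp
    moreover have "\<bar>\<integral>y. r y \<partial>lebesgue\<bar> \<le> (\<integral>y. \<bar>r y\<bar> \<partial>lebesgue)"
      by (rule integral_abs_bound)
    moreover have "(\<integral>y. \<bar>r y\<bar> \<partial>lebesgue) \<le> (\<integral>y. B * (norm h)\<^sup>2 * w y \<partial>lebesgue)"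
    proof (rule integral_mono)
      fix y
      show "\<bar>r y\<bar> \<le> B * (norm h)\<^sup>2 * w y"
      proof (cases "y \<in> M")
        case True
        then have "cutoff R y = 1" using R by (simp add: cutoff_def)
        moreover have "\<bar>\<psi> (x + h - y) - \<psi> (x - y) - grad \<psi> (x - y) \<bullet> h\<bar> \<le> B * (norm h)\<^sup>2"
          using B(2)[of "x - y" h] by (simp add: algebra_simps)
        ultimately show ?thesis unfolding r_def w_def abs_mult
          by (simp add: mult.commute mult_left_mono)
      next
        case False
        have n1: "x + h - y \<notin> K"
        proof
          assume "x + h - y \<in> K"
          moreover have "x + h \<in> cball x 1" using h by (simp add: dist_norm)
          ultimately have "(x + h) - (x + h - y) \<in> M" unfolding M_def by blast
          then show False using False by simp
        qed
        have n2: "x - y \<notin> K"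
        proof
          assume "x - y \<in> K"
          moreover have "x \<in> cball x 1" by simp
          ultimately have "x - (x - y) \<in> M" unfolding M_def by blast
          then show False using False by simp
        qed
        have "partial_deriv i \<psi> (x - y) = 0" for i
          by (rule partial_deriv_zero_off[OF compact_imp_closed[OF K(1)] K(2) n2])
        then have "r y = 0" using K(2) n1 n2 by (simp add: r_def inner_vec_def)
        then show ?thesis using B(1) cutoff_bounds(1)[of R y] by (simp add: w_def)
      qed
    qed (use ri w in auto)
    moreover have "(\<integral>y. B * (norm h)\<^sup>2 * w y \<partial>lebesgue) = B * (norm h)\<^sup>2 * C" by (simp add: C_def)
    ultimately show ?thesis by linarith
  qed
  show ?thesis
  proof (rule has_derivativeI_sandwich[where e=1 and H="\<lambda>y. B * C * norm (y - x)"])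
    show "bounded_linear (\<lambda>h. \<Sum>i\<in>UNIV. h $ i * conv f (partial_deriv i \<psi>) x)"
      by (intro bounded_linear_sum bounded_linear_mult_const bounded_linear_vec_nth)
    show "((\<lambda>y. B * C * norm (y - x)) \<longlongrightarrow> 0) (at x)"
      by (auto intro!: tendsto_eq_intros)
    fix y assume y: "y \<noteq> x" "dist y x < 1"
    then have "norm (y - x) \<le> 1" by (simp add: dist_norm)
    from main[OF this] have "norm (conv f \<psi> y - conv f \<psi> x - (\<Sum>i\<in>UNIV. (y - x) $ i * conv f (partial_deriv i \<psi>) x)) \<le> B * C * norm (y - x) * norm (y - x)"
      by (simp add: power2_eq_square mult_ac)
    then show "norm (conv f \<psi> y - conv f \<psi> x - (\<Sum>i\<in>UNIV. (y - x) $ i * conv f (partial_deriv i \<psi>) x)) / norm (y - x) \<le> B * C * norm (y - x)"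
      using y(1) by (simp add: divide_le_eq)
  qed auto
qed

lemma conv_partial_deriv:
  assumes "L2 f" "test_on UNIV \<psi>"
  shows "partial_deriv i (conv f \<psi>) x = conv f (partial_deriv i \<psi>) x"
  using partial_deriv_eqI[OF conv_has_derivative[OF assms], of i x]
  by (simp add: axis_def if_distrib[where f="\<lambda>x. x * _"] cong: if_cong)

text \<open>Derivatives fall on the kernel, so the induction runs over all kernels at once.\<close>

lemma smooth_on_conv:
  assumes "L2 f" "test_on UNIV \<psi>"
  shows "smooth_on UNIV (conv f \<psi>)"
proof -
  have "Ck_on n UNIV (conv f \<psi>)" if "test_on UNIV \<psi>" for n \<psi>
    using that
  proof (induction n arbitrary: \<psi>)
    case 0
    then show ?case using conv_has_derivative[OF assms(1)] by (auto simp: differentiable_def)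
  next
    case (Suc n)
    have "partial_deriv i (conv f \<psi>) = conv f (partial_deriv i \<psi>)" for i
      using conv_partial_deriv[OF assms(1) Suc.prems] by blast
    moreover have "\<forall>x. conv f \<psi> differentiable (at x)"
      using conv_has_derivative[OF assms(1) Suc.prems] by (auto simp: differentiable_def)
    ultimately show ?case using Suc.IH[OF test_on_partial_deriv[OF Suc.prems]] by simp
  qed
  then show ?thesis using assms(2) by (simp add: smooth_on_def)
qed

text \<open>The reflected kernel is itself a test function, and the minus sign from the reflection
  cancels the one in \<open>weak_gradient\<close>.\<close>

lemma conv_weak_gradient:
  assumes "weak_gradient b g" "test_on UNIV \<psi>"
  shows "conv b (partial_deriv i \<psi>) x = conv (\<lambda>y. g y $ i) \<psi> x"
proof -
  have "test_fun (\<lambda>y. \<psi> (x - y))" using test_on_reflect(1)[OF assms(2)] by (simp add: test_fun_iff)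
  then have "(\<integral>y. b y * partial_deriv i (\<lambda>y. \<psi> (x - y)) y \<partial>lebesgue) = - (\<integral>y. g y $ i * \<psi> (x - y) \<partial>lebesgue)"
    using assms(1) unfolding weak_gradient_def by blast
  then show ?thesis unfolding conv_def by (simp add: test_on_reflect(2)[OF assms(2)])
qed

section \<open>Continuity of translations in L2\<close>

lemma L2_lborel:
  fixes f :: "'a::euclidean_space \<Rightarrow> real"
  assumes "f \<in> borel_measurable borel"
  shows "L2 f \<longleftrightarrow> integrable lborel (\<lambda>x. (f x)\<^sup>2)" "nsq f = (\<integral>x. (f x)\<^sup>2 \<partial>lborel)"
  using assms integrable_completion[of "\<lambda>x. (f x)\<^sup>2" lborel] integral_completion[of "\<lambda>x. (f x)\<^sup>2" lborel]
  by (auto simp: L2_real_iff nsq_real measurable_completion)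

lemma lborel_integral_translation:
  fixes F :: "'a::euclidean_space \<Rightarrow> real"
  assumes "F \<in> borel_measurable borel"
  shows "integrable lborel (\<lambda>x. F (x - z)) \<longleftrightarrow> integrable lborel F" "(\<integral>x. F (x - z) \<partial>lborel) = (\<integral>x. F x \<partial>lborel)"
    and "integrable lborel (\<lambda>x. F (z - x)) \<longleftrightarrow> integrable lborel F" "(\<integral>x. F (z - x) \<partial>lborel) = (\<integral>x. F x \<partial>lborel)"
proof -
  have m: "(\<lambda>x. - z + x) \<in> lborel \<rightarrow>\<^sub>M borel" "(\<lambda>x. z - x) \<in> lborel \<rightarrow>\<^sub>M borel" by auto
  show "integrable lborel (\<lambda>x. F (x - z)) \<longleftrightarrow> integrable lborel F" "(\<integral>x. F (x - z) \<partial>lborel) = (\<integral>x. F x \<partial>lborel)"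
    using integrable_distr_eq[OF m(1) assms] integral_distr[OF m(1) assms]
    unfolding lborel_translation_reflection by auto
  show "integrable lborel (\<lambda>x. F (z - x)) \<longleftrightarrow> integrable lborel F" "(\<integral>x. F (z - x) \<partial>lborel) = (\<integral>x. F x \<partial>lborel)"
    using integrable_distr_eq[OF m(2) assms] integral_distr[OF m(2) assms]
    unfolding lborel_translation_reflection by auto
qed

lemma nsq_translation:
  fixes f :: "'a::euclidean_space \<Rightarrow> real"
  assumes [measurable]: "f \<in> borel_measurable borel"
  shows "nsq (\<lambda>x. f (x - z)) = nsq f" "L2 (\<lambda>x. f (x - z)) \<longleftrightarrow> L2 f"
proof -
  have m: "(\<lambda>x. f (x - z)) \<in> borel_measurable borel" "(\<lambda>x. (f x)\<^sup>2) \<in> borel_measurable borel" by measurable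
  show "nsq (\<lambda>x. f (x - z)) = nsq f" "L2 (\<lambda>x. f (x - z)) \<longleftrightarrow> L2 f"
    unfolding L2_lborel[OF assms] L2_lborel[OF m(1)]
    using lborel_integral_translation(1,2)[OF m(2), of z] by simp_all
qed

text \<open>For |z| < 1 the difference lives in a fixed ball, on which uniform continuity makes it
  small.\<close>

lemma cont_compact_translation_continuous:
  fixes u :: "'a::euclidean_space \<Rightarrow> real"
  assumes "cont_compact u" "e > 0"
  shows "\<exists>\<delta>>0. \<forall>z. norm z < \<delta> \<longrightarrow> nsq (\<lambda>x. u (x - z) - u x) < e"
proof -
  obtain K where K: "compact K" "\<And>x. x \<notin> K \<Longrightarrow> u x = 0" and c: "continuous_on UNIV u"
    using assms by (auto simp: cont_compact_def)
  obtain R where R: "\<And>y. y \<in> K \<Longrightarrow> norm y \<le> R"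
    using compact_imp_bounded[OF K(1)] bounded_iff by metis
  let ?w = "cutoff (R + 1) :: 'a \<Rightarrow> real"
  have w: "L2 ?w" by (intro cont_compact_L2 cont_compact_cutoff)
  \<comment> \<open>The added 1 keeps A positive whatever the value of R.\<close>
  define A where "A = nsq ?w + 1"
  have A: "A > 0" by (simp add: A_def add_nonneg_pos)
  define r where "r = sqrt (e / A) / 2"
  have r: "r > 0" "r\<^sup>2 * nsq ?w < e"
  proof -
    have "r\<^sup>2 = e / A / 4" using assms(2) A by (simp add: r_def power_divide)
    moreover have "e / A / 4 * nsq ?w \<le> e / A / 4 * A"
      using assms(2) A by (intro mult_left_mono) (auto simp: A_def)
    ultimately have "r\<^sup>2 * nsq ?w \<le> e / 4" using assms(2) A by simp
    then show "r\<^sup>2 * nsq ?w < e" using assms(2) by linarith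
  qed (use assms(2) A in \<open>simp add: r_def\<close>)
  have "uniformly_continuous_on (cball 0 (R + 2)) u"
    by (intro compact_uniformly_continuous continuous_on_subset[OF c]) auto
  then obtain d where d: "d > 0" "\<And>x x'. x \<in> cball 0 (R+2) \<Longrightarrow> x' \<in> cball 0 (R+2) \<Longrightarrow> dist x' x < d \<Longrightarrow> dist (u x') (u x) < r"
    unfolding uniformly_continuous_on_def using r(1) by metis
  have "nsq (\<lambda>x. u (x - z) - u x) < e" if z: "norm z < min d 1" for z
  proof -
    have b: "norm (u (x - z) - u x) \<le> r * norm (?w x)" for x
    proof (cases "norm x \<le> R + 1")
      case True
      then have "?w x = 1" by (simp add: cutoff_def)
      moreover have "dist (u (x - z)) (u x) < r"
      proof (rule d(2))
        show "x - z \<in> cball 0 (R + 2)" using True z norm_triangle_ineq4[of x z] by simp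
      qed (use True z in \<open>auto simp: dist_norm\<close>)
      ultimately show ?thesis by (simp add: dist_norm)
    next
      case False
      have "norm x \<le> norm (x - z) + norm z" using norm_triangle_ineq[of "x - z" z] by simp
      then have "x - z \<notin> K" "x \<notin> K" using False z R[of x] R[of "x - z"] by auto
      then show ?thesis using K(2) r(1) by simp
    qed
    have [measurable]: "u \<in> borel_measurable borel" using cont_compact_measurable[OF assms(1)] .
    have "(\<lambda>x. u (x - z) - u x) \<in> borel_measurable borel" by measurable
    then have "(\<lambda>x. u (x - z) - u x) \<in> borel_measurable lebesgue" by (simp add: measurable_completion)
    from L2_bound(2)[OF this w b] r(2) show ?thesis by simp
  qed
  then show ?thesis using d(1) by (intro exI[of _ "min d 1"]) auto
qed

text \<open>With a compactly supported continuous u close to f, compare f(x - z), u(x - z), u(x) and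
  f(x) in turn. The first and last errors agree by translation invariance; the constants e/24 and
  e/12 add up to 7e/12.\<close>

lemma L2_translation_continuous:
  fixes f :: "'a::euclidean_space \<Rightarrow> real"
  assumes fm [measurable]: "f \<in> borel_measurable borel" and f: "L2 f" and e: "e > 0"
  shows "\<exists>\<delta>>0. \<forall>z. norm z < \<delta> \<longrightarrow> nsq (\<lambda>x. f (x - z) - f x) < e"
proof -
  obtain u where u: "cont_compact u" "nsq (\<lambda>x. f x - u x) < e/24"
    using L2_approx_cont_compact[OF f, of "e/24"] e by auto
  obtain \<delta> where \<delta>: "\<delta> > 0" "\<And>z. norm z < \<delta> \<Longrightarrow> nsq (\<lambda>x. u (x - z) - u x) < e/12"
    using cont_compact_translation_continuous[OF u(1), of "e/12"] e by auto
  have um [measurable]: "u \<in> borel_measurable borel" using cont_compact_measurable[OF u(1)] .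
  have fu: "(\<lambda>x. f x - u x) \<in> borel_measurable borel" by measurable
  have l: "L2 (\<lambda>x. f (x - z))" "L2 (\<lambda>x. u (x - z))" "L2 u" for z
    using nsq_translation(2)[OF fm] nsq_translation(2)[OF um] f cont_compact_L2[OF u(1)] by auto
  have "nsq (\<lambda>x. f (x - z) - f x) < e" if "norm z < \<delta>" for z
  proof -
    have "nsq (\<lambda>x. f (x - z) - u (x - z)) < e/24"
      using nsq_translation(1)[OF fu, of z] u(2) by simp
    moreover have "nsq (\<lambda>x. u (x - z) - f x) \<le> 2 * nsq (\<lambda>x. u (x - z) - u x) + 2 * nsq (\<lambda>x. u x - f x)"
      by (rule nsq_triangle) (intro L2_diff l f)+
    moreover have "nsq (\<lambda>x. f (x - z) - f x) \<le> 2 * nsq (\<lambda>x. f (x - z) - u (x - z)) + 2 * nsq (\<lambda>x. u (x - z) - f x)"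
      by (rule nsq_triangle) (intro L2_diff l f)+
    ultimately show ?thesis using \<delta>(2)[OF that] u(2) nsq_minus_commute[of u f] e by linarith
  qed
  then show ?thesis using \<delta>(1) by blast
qed

section \<open>Approximate identities\<close>

lemma weighted_Jensen:
  fixes d \<rho> :: "'a \<Rightarrow> real"
  assumes "integrable M \<rho>" "integrable M (\<lambda>z. d z * \<rho> z)" "integrable M (\<lambda>z. (d z)\<^sup>2 * \<rho> z)"
    and "\<And>z. \<rho> z \<ge> 0" "(\<integral>z. \<rho> z \<partial>M) = 1"
  shows "(\<integral>z. d z * \<rho> z \<partial>M)\<^sup>2 \<le> (\<integral>z. (d z)\<^sup>2 * \<rho> z \<partial>M)"
proof -
  define c where "c = (\<integral>z. d z * \<rho> z \<partial>M)"
  \<comment> \<open>The variance of d under the probability density \<rho>, expanded around the mean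
    c.\<close>
  have "0 \<le> (\<integral>z. (d z - c)\<^sup>2 * \<rho> z \<partial>M)"
    using assms(4) by (intro integral_nonneg_AE AE_I2 mult_nonneg_nonneg) auto
  also have "(\<lambda>z. (d z - c)\<^sup>2 * \<rho> z) = (\<lambda>z. (d z)\<^sup>2 * \<rho> z - 2 * c * (d z * \<rho> z) + c\<^sup>2 * \<rho> z)"
    by (auto simp: power2_diff algebra_simps)
  also have "(\<integral>z. (d z)\<^sup>2 * \<rho> z - 2 * c * (d z * \<rho> z) + c\<^sup>2 * \<rho> z \<partial>M) = (\<integral>z. (d z)\<^sup>2 * \<rho> z \<partial>M) - 2 * c * c + c\<^sup>2"
    using assms by (simp add: c_def)
  finally show ?thesis by (simp add: c_def power2_eq_square)
qed

text \<open>The error is the average of f(x - z) - f(x) over z with density \<rho>. Jensen's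
  inequality bounds its square by the averaged square, and exchanging the integrals leaves
  translation errors with |z| < \<delta>. A Borel function f makes the integrand jointly
  measurable.\<close>

lemma conv_close:
  fixes f :: "real^'n::finite \<Rightarrow> real"
  assumes fm [measurable]: "f \<in> borel_measurable borel" and f: "L2 f"
    and \<rho>: "test_on UNIV \<rho>" "\<And>z. \<rho> z \<ge> 0" "(\<integral>z. \<rho> z \<partial>lborel) = 1" "\<And>z. norm z \<ge> \<delta> \<Longrightarrow> \<rho> z = 0"
    and close: "\<And>z. norm z < \<delta> \<Longrightarrow> nsq (\<lambda>x. f (x - z) - f x) \<le> e" and e: "e \<ge> 0"
  shows "L2 (\<lambda>x. conv f \<rho> x - f x)" "nsq (\<lambda>x. conv f \<rho> x - f x) \<le> e"
proof -
  have cc: "cont_compact \<rho>" using \<rho>(1) by (rule test_on_cont_compact)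
  have [measurable]: "\<rho> \<in> borel_measurable borel" using cont_compact_measurable[OF cc] .
  obtain B where B: "B > 0" "\<And>x. \<bar>\<rho> x\<bar> \<le> B" using cont_compact_bounded[OF cc] by metis
  have \<rho>i: "integrable lborel \<rho>" using cont_compact_integrable(1)[OF cc] .
  have f2: "integrable lborel (\<lambda>x. (f x)\<^sup>2)" using f L2_lborel(1)[OF fm] by blast
  have i1: "integrable lborel (\<lambda>z. f (x - z) * \<rho> z)" 
    and c1: "conv f \<rho> x = (\<integral>z. f (x - z) * \<rho> z \<partial>lborel)" for x
  proof -
    have m: "(\<lambda>y. f y * \<rho> (x - y)) \<in> borel_measurable borel" by measurable
    have "integrable lborel (\<lambda>y. f y * \<rho> (x - y))"
      using conv_integrable[OF f \<rho>(1)] integrable_completion[of "\<lambda>y. f y * \<rho> (x - y)" lborel] by simp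
    then show "integrable lborel (\<lambda>z. f (x - z) * \<rho> z)"
      using lborel_integral_translation(3)[OF m, of x] by simp
    show "conv f \<rho> x = (\<integral>z. f (x - z) * \<rho> z \<partial>lborel)"
      using lborel_integral_translation(4)[OF m, of x]
        integral_completion[of "\<lambda>y. f y * \<rho> (x - y)" lborel] by (simp add: conv_def)
  qed
  define d where "d x z = f (x - z) - f x" for x z
  define P where "P x = conv f \<rho> x - f x" for x
  have d1: "integrable lborel (\<lambda>z. d x z * \<rho> z)" for x
    unfolding d_def left_diff_distrib by (intro Bochner_Integration.integrable_diff i1 integrable_mult_right \<rho>i)
  \<comment> \<open>The square stays integrable against the kernel because the kernel is
    bounded.\<close>
  have d2: "integrable lborel (\<lambda>z. (d x z)\<^sup>2 * \<rho> z)" for x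
  proof -
    have "(\<lambda>z. (f (x - z))\<^sup>2) = (\<lambda>z. (\<lambda>y. (f y)\<^sup>2) (x - z))" by simp
    have "integrable lborel (\<lambda>z. (f (x - z))\<^sup>2)"
      using lborel_integral_translation(3)[of "\<lambda>y. (f y)\<^sup>2" x] f2 by simp
    then have "integrable lborel (\<lambda>z. B * (f (x - z))\<^sup>2)" by simp
    then have "integrable lborel (\<lambda>z. (f (x - z))\<^sup>2 * \<rho> z)"
      by (rule Bochner_Integration.integrable_bound)
        (use B \<rho>(2) in \<open>auto simp: abs_mult mult.commute intro!: mult_right_mono\<close>)
    then have "integrable lborel (\<lambda>z. (f (x - z))\<^sup>2 * \<rho> z - 2 * f x * (f (x - z) * \<rho> z) + (f x)\<^sup>2 * \<rho> z)"
      by (intro Bochner_Integration.integrable_add Bochner_Integration.integrable_diff integrable_mult_right i1 \<rho>i)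
    also have "(\<lambda>z. (f (x - z))\<^sup>2 * \<rho> z - 2 * f x * (f (x - z) * \<rho> z) + (f x)\<^sup>2 * \<rho> z) = (\<lambda>z. (d x z)\<^sup>2 * \<rho> z)"
      by (auto simp: d_def power2_diff algebra_simps)
    finally show ?thesis .
  qed
  have Pd: "P x = (\<integral>z. d x z * \<rho> z \<partial>lborel)" for x
    using i1[of x] \<rho>i \<rho>(3) by (simp add: P_def c1 d_def left_diff_distrib)
  have J: "(P x)\<^sup>2 \<le> (\<integral>z. (d x z)\<^sup>2 * \<rho> z \<partial>lborel)" for x
    unfolding Pd by (rule weighted_Jensen) (use d1 d2 \<rho>i \<rho>(2,3) in auto)
  have "continuous_on UNIV (conv f \<rho>)" using smooth_on_continuous[OF smooth_on_conv[OF f \<rho>(1)]] .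
  then have [measurable]: "conv f \<rho> \<in> borel_measurable borel" by (rule borel_measurable_continuous_onI)
  have Pm: "P \<in> borel_measurable borel" unfolding P_def by measurable
  have dm: "(\<lambda>(x, z). ennreal ((d x z)\<^sup>2 * \<rho> z)) \<in> borel_measurable (lborel \<Otimes>\<^sub>M lborel)"
    unfolding d_def by measurable
  have in1: "(\<integral>\<^sup>+x. ennreal ((d x z)\<^sup>2 * \<rho> z) \<partial>lborel) \<le> ennreal (e * \<rho> z)" for z
  proof (cases "norm z < \<delta>")
    case True
    have m: "(\<lambda>x. d x z) \<in> borel_measurable borel" unfolding d_def by measurable
    have "L2 (\<lambda>x. d x z)" unfolding d_def using nsq_translation(2)[OF fm] f by (intro L2_diff) auto
    then have i: "integrable lborel (\<lambda>x. (d x z)\<^sup>2)" using L2_lborel(1)[OF m] by blast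
    have "(\<integral>\<^sup>+x. ennreal ((d x z)\<^sup>2 * \<rho> z) \<partial>lborel) = ennreal (\<integral>x. (d x z)\<^sup>2 * \<rho> z \<partial>lborel)"
      using i \<rho>(2) by (intro nn_integral_eq_integral) auto
    also have "(\<integral>x. (d x z)\<^sup>2 * \<rho> z \<partial>lborel) = nsq (\<lambda>x. d x z) * \<rho> z"
      using i L2_lborel(2)[OF m] by simp
    also have "\<dots> \<le> e * \<rho> z" using close[OF True] \<rho>(2) by (auto simp: d_def intro: mult_right_mono)
    finally show ?thesis by (simp add: ennreal_leI)
  qed (use \<rho>(4) in auto)
  have "(\<integral>\<^sup>+x. ennreal ((P x)\<^sup>2) \<partial>lborel) \<le> (\<integral>\<^sup>+x. (\<integral>\<^sup>+z. ennreal ((d x z)\<^sup>2 * \<rho> z) \<partial>lborel) \<partial>lborel)"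
  proof (rule nn_integral_mono)
    fix x
    have "(\<integral>\<^sup>+z. ennreal ((d x z)\<^sup>2 * \<rho> z) \<partial>lborel) = ennreal (\<integral>z. (d x z)\<^sup>2 * \<rho> z \<partial>lborel)"
      using d2 \<rho>(2) by (intro nn_integral_eq_integral) auto
    then show "ennreal ((P x)\<^sup>2) \<le> (\<integral>\<^sup>+z. ennreal ((d x z)\<^sup>2 * \<rho> z) \<partial>lborel)"
      using J[of x] by (simp add: ennreal_leI)
  qed
  also have "\<dots> = (\<integral>\<^sup>+z. (\<integral>\<^sup>+x. ennreal ((d x z)\<^sup>2 * \<rho> z) \<partial>lborel) \<partial>lborel)"
    by (rule lborel_pair.Fubini'[symmetric, OF dm])
  also have "\<dots> \<le> (\<integral>\<^sup>+z. ennreal (e * \<rho> z) \<partial>lborel)"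
    by (intro nn_integral_mono in1)
  also have "\<dots> = ennreal e"
    using \<rho>i \<rho>(2,3) e by (subst nn_integral_eq_integral) auto
  finally have le: "(\<integral>\<^sup>+x. ennreal ((P x)\<^sup>2) \<partial>lborel) \<le> ennreal e" .
  have Pi: "integrable lborel (\<lambda>x. (P x)\<^sup>2)"
    by (rule integrableI_nonneg) (use le Pm in \<open>auto intro: le_less_trans\<close>)
  then show "L2 (\<lambda>x. conv f \<rho> x - f x)" using L2_lborel(1)[OF Pm] by (simp add: P_def[abs_def])
  have "ennreal (\<integral>x. (P x)\<^sup>2 \<partial>lborel) \<le> ennreal e"
    using le Pi by (subst (asm) nn_integral_eq_integral) auto
  then show "nsq (\<lambda>x. conv f \<rho> x - f x) \<le> e"
    using L2_lborel(2)[OF Pm] e by (simp add: P_def[abs_def] ennreal_le_iff)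
qed

lemma mollifier_exists:
  assumes "\<delta> > 0"
  obtains \<rho> :: "real^'n::finite \<Rightarrow> real" where "test_on UNIV \<rho>" "\<And>z. \<rho> z \<ge> 0" "(\<integral>z. \<rho> z \<partial>lborel) = 1"
    "\<And>z. norm z \<ge> \<delta> \<Longrightarrow> \<rho> z = 0"
proof -
  define \<sigma> :: "real^'n \<Rightarrow> real" where "\<sigma> x = flat 0 (\<delta>\<^sup>2 - (norm x)\<^sup>2)" for x
  have nn: "\<sigma> x \<ge> 0" for x by (simp add: \<sigma>_def flat_def)
  have z: "\<sigma> x = 0" if "norm x \<ge> \<delta>" for x
    using power_mono[OF that, of 2] assms by (simp add: \<sigma>_def flat_def)
  have t: "test_on UNIV \<sigma>"
  proof (rule test_onI[where K="cball 0 \<delta>"])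
    show "smooth_on UNIV \<sigma>" unfolding \<sigma>_def by (intro smooth_on_flat smooth_intros open_UNIV)
  qed (use z in auto)
  have i: "integrable lborel \<sigma>" using cont_compact_integrable(1)[OF test_on_cont_compact[OF t]] .
  define c where "c = (\<integral>z. \<sigma> z \<partial>lborel)"
  \<comment> \<open>A continuous function that vanishes almost everywhere vanishes everywhere, but
    the value at 0 is positive.\<close>
  have "c \<noteq> 0"
  proof
    assume "c = 0"
    then have "AE x in lborel. \<sigma> x = 0"
      using integral_nonneg_eq_0_iff_AE[OF i] nn by (simp add: c_def)
    then have "AE x in lebesgue. x \<in> {x. \<sigma> x = 0}" by (simp add: AE_completion)
    moreover have "closed {x. \<sigma> x = 0}"
      using test_on_cont_compact[OF t] by (auto simp: cont_compact_def intro!: closed_Collect_eq)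
    ultimately have "0 \<in> {x. \<sigma> x = 0}" using mem_closed_if_AE_lebesgue by blast
    then show False using assms by (simp add: \<sigma>_def flat_def)
  qed
  moreover have "c \<ge> 0" unfolding c_def using nn by simp
  ultimately have c: "c > 0" by simp
  show ?thesis
  proof (rule that[of "\<lambda>x. inverse c * \<sigma> x"])
    show "test_on UNIV (\<lambda>x. inverse c * \<sigma> x)" by (intro test_on_mult t smooth_on_const open_UNIV)
    show "(\<integral>z. inverse c * \<sigma> z \<partial>lborel) = 1" using i c by (simp add: c_def)
  qed (use nn z c in auto)
qed

lemma conv_cong_AE:
  assumes "L2 f" "L2 f'" "AE x in lebesgue. f x = f' x" "test_on UNIV \<psi>"
  shows "conv f \<psi> x = conv f' \<psi> x"
  unfolding conv_def
  by (rule integral_cong_AE) (use conv_integrable assms in auto)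

text \<open>A single kernel serves the entire family, because a function and the components of its
  weak gradient must be smoothed alike for the smoothed components to form the gradient of the
  smoothed function. Borel representatives are used in between and do not change the
  convolution.\<close>

lemma simultaneous_mollification:
  fixes f :: "'i \<Rightarrow> real^'n::finite \<Rightarrow> real"
  assumes "finite I" "\<And>i. i \<in> I \<Longrightarrow> L2 (f i)" "e > 0"
  obtains \<rho> where "test_on UNIV \<rho>" "\<And>i. i \<in> I \<Longrightarrow> L2 (\<lambda>x. conv (f i) \<rho> x - f i x)"
    "\<And>i. i \<in> I \<Longrightarrow> nsq (\<lambda>x. conv (f i) \<rho> x - f i x) \<le> e"
proof -
  have "\<forall>i\<in>I. \<exists>f'. f' \<in> borel_measurable lborel \<and> (AE x in lebesgue. f i x = f' x)"
  proof
    fix i assume "i \<in> I"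
    then have "f i \<in> borel_measurable (completion lborel)" using assms(2) by (auto simp: L2_def)
    from completion_ex_borel_measurable_real[OF this]
    show "\<exists>f'. f' \<in> borel_measurable lborel \<and> (AE x in lebesgue. f i x = f' x)"
      by (auto intro: AE_completion)
  qed
  then obtain f' where f': "\<And>i. i \<in> I \<Longrightarrow> f' i \<in> borel_measurable lborel"
    "\<And>i. i \<in> I \<Longrightarrow> AE x in lebesgue. f i x = f' i x" by metis
  have fb: "f' i \<in> borel_measurable borel" "f' i \<in> borel_measurable lebesgue" if "i \<in> I" for i
    using f'(1)[OF that] by (auto simp: measurable_completion)
  have L': "L2 (f' i)" if "i \<in> I" for i
    using nsq_cong_AE(2)[OF f'(2)[OF that] _ fb(2)[OF that]] assms(2)[OF that] by (auto simp: L2_def)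
  have "\<forall>i\<in>I. \<exists>\<delta>>0. \<forall>z. norm z < \<delta> \<longrightarrow> nsq (\<lambda>x. f' i (x - z) - f' i x) < e"
    using L2_translation_continuous[OF fb(1) L' assms(3)] by blast
  then obtain \<delta> where \<delta>: "\<And>i. i \<in> I \<Longrightarrow> \<delta> i > 0"
    "\<And>i z. i \<in> I \<Longrightarrow> norm z < \<delta> i \<Longrightarrow> nsq (\<lambda>x. f' i (x - z) - f' i x) < e" by metis
  \<comment> \<open>Inserting 1 keeps the minimum meaningful for empty I.\<close>
  define m where "m = Min (insert 1 (\<delta> ` I))"
  have m: "m > 0" "\<And>i. i \<in> I \<Longrightarrow> m \<le> \<delta> i" using \<delta>(1) assms(1) by (auto simp: m_def)
  obtain \<rho> :: "real^'n \<Rightarrow> real" where \<rho>: "test_on UNIV \<rho>" "\<And>z. \<rho> z \<ge> 0" "(\<integral>z. \<rho> z \<partial>lborel) = 1"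
    "\<And>z. norm z \<ge> m \<Longrightarrow> \<rho> z = 0" using mollifier_exists[OF m(1)] by metis
  show ?thesis
  proof (rule that[OF \<rho>(1)])
    fix i assume i: "i \<in> I"
    have c: "L2 (\<lambda>x. conv (f' i) \<rho> x - f' i x)" "nsq (\<lambda>x. conv (f' i) \<rho> x - f' i x) \<le> e"
      using conv_close[OF fb(1)[OF i] L'[OF i] \<rho>, where e=e] \<delta>(2)[OF i] m(2)[OF i] assms(3)
      by (auto simp: less_imp_le)
    have eq: "conv (f i) \<rho> = conv (f' i) \<rho>"
      using conv_cong_AE[OF assms(2)[OF i] L'[OF i] f'(2)[OF i] \<rho>(1)] by blast
    have cm: "conv (f' i) \<rho> \<in> borel_measurable lebesgue"
      using smooth_on_continuous[OF smooth_on_conv[OF L'[OF i] \<rho>(1)]]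
      by (auto intro!: measurable_completion borel_measurable_continuous_onI)
    have ae: "AE x in lebesgue. conv (f i) \<rho> x - f i x = conv (f' i) \<rho> x - f' i x"
      unfolding eq using f'(2)[OF i] by auto
    have M: "(\<lambda>x. conv (f i) \<rho> x - f i x) \<in> borel_measurable lebesgue"
      "(\<lambda>x. conv (f' i) \<rho> x - f' i x) \<in> borel_measurable lebesgue"
      unfolding eq using cm fb(2)[OF i] assms(2)[OF i]
      by (auto simp: L2_def intro!: borel_measurable_diff)
    show "L2 (\<lambda>x. conv (f i) \<rho> x - f i x)" "nsq (\<lambda>x. conv (f i) \<rho> x - f i x) \<le> e"
      using nsq_cong_AE[OF ae M] c by auto
  qed
qed

text \<open>Each value of a convolution with h is an integral of h against a reflected test
  function, hence 0. Yet convolutions come arbitrarily close to h.\<close>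

lemma fundamental_lemma:
  fixes h :: "real^'n::finite \<Rightarrow> real"
  assumes h: "L2 h" and z: "\<And>\<phi>. test_on UNIV \<phi> \<Longrightarrow> (\<integral>x. h x * \<phi> x \<partial>lebesgue) = 0"
  shows "nsq h = 0"
proof (rule ccontr)
  assume "nsq h \<noteq> 0"
  then have "nsq h / 2 > 0" using nsq_nonneg[of h] by linarith
  then obtain \<rho> where \<rho>: "test_on UNIV \<rho>" "nsq (\<lambda>x. conv h \<rho> x - h x) \<le> nsq h / 2"
    using simultaneous_mollification[of "{()}" "\<lambda>_. h" "nsq h / 2"] h by auto
  have "conv h \<rho> x = 0" for x
    unfolding conv_def by (rule z[OF test_on_reflect(1)[OF \<rho>(1)]])
  then have "nsq h \<le> nsq h / 2" using \<rho>(2) nsq_minus_commute[of h "\<lambda>x. 0"] by simp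
  then show False using \<open>nsq h / 2 > 0\<close> by simp
qed

section \<open>The Dirichlet form on H12\<close>

lemma H12_iff: "b \<in> H12 \<longleftrightarrow> L2 b \<and> (\<exists>g. L2 g \<and> weak_gradient b g)"
  by (auto simp: H12_def L2_def)

lemma test_on_L2: "test_on S \<phi> \<Longrightarrow> L2 \<phi>"
  by (intro cont_compact_L2 test_on_cont_compact)

text \<open>The fundamental lemma is applied to each component; the result frees \<open>Dir\<close>
  from the choice made in \<open>weak_grad\<close>.\<close>

lemma weak_gradient_unique:
  assumes "L2 g" "L2 g'" "weak_gradient b g" "weak_gradient b g'"
  shows "nsq (\<lambda>x. g x - g' x) = 0"
proof -
  have L: "L2 (\<lambda>x. (g x - g' x) $ i)" for i by (intro L2_nth L2_diff assms)
  have "nsq (\<lambda>x. (g x - g' x) $ i) = 0" for i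
  proof (rule fundamental_lemma[OF L])
    fix \<phi> :: "real^'a \<Rightarrow> real" assume t: "test_on UNIV \<phi>"
    have "(\<integral>x. b x * partial_deriv i \<phi> x \<partial>lebesgue) = - (\<integral>x. g x $ i * \<phi> x \<partial>lebesgue)"
      "(\<integral>x. b x * partial_deriv i \<phi> x \<partial>lebesgue) = - (\<integral>x. g' x $ i * \<phi> x \<partial>lebesgue)"
      using assms(3,4) t unfolding weak_gradient_def test_fun_iff by blast+
    then have "(\<integral>x. g x $ i * \<phi> x \<partial>lebesgue) = (\<integral>x. g' x $ i * \<phi> x \<partial>lebesgue)" by linarith
    moreover have "integrable lebesgue (\<lambda>x. g x $ i * \<phi> x)" "integrable lebesgue (\<lambda>x. g' x $ i * \<phi> x)"
      by (rule L2_mult_integrable[OF L2_nth[OF assms(1)] test_on_L2[OF t]])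
        (rule L2_mult_integrable[OF L2_nth[OF assms(2)] test_on_L2[OF t]])
    ultimately show "(\<integral>x. (g x - g' x) $ i * \<phi> x \<partial>lebesgue) = 0" by (simp add: left_diff_distrib)
  qed
  then show ?thesis using L2_vecI(2)[OF L] by simp
qed

lemma weak_grad_spec:
  assumes "L2 g" "weak_gradient b g"
  shows "L2 (weak_grad b)" "weak_gradient b (weak_grad b)"
proof -
  have "weak_grad b = (SOME g. L2 g \<and> weak_gradient b g)" by (simp add: weak_grad_def L2_def)
  then show "L2 (weak_grad b)" "weak_gradient b (weak_grad b)"
    using someI[of "\<lambda>g. L2 g \<and> weak_gradient b g" g] assms by auto
qed

lemma Dir_eq_nsq:
  assumes "L2 g" "weak_gradient b g"
  shows "Dir b = nsq g"
proof -
  have "Dir b = nsq (weak_grad b)" by (simp add: Dir_def nsq_def)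
  also have "\<dots> = nsq g"
    using L2_AE_eq(2) weak_grad_spec[OF assms] assms weak_gradient_unique by blast
  finally show ?thesis .
qed

lemma H12E:
  assumes "b \<in> H12"
  obtains g where "L2 b" "L2 g" "weak_gradient b g" "Dir b = nsq g"
  using assms Dir_eq_nsq by (auto simp: H12_iff)

lemma weak_gradient_diff:
  assumes "L2 b" "L2 c" "L2 g" "L2 h" "weak_gradient b g" "weak_gradient c h"
  shows "weak_gradient (\<lambda>x. b x - c x) (\<lambda>x. g x - h x)"
  unfolding weak_gradient_def
proof (intro allI impI)
  fix \<phi> :: "real^'a \<Rightarrow> real" and i
  assume t: "test_fun \<phi>"
  then have "test_on UNIV \<phi>" by (simp add: test_fun_iff)
  then have "L2 \<phi>" "L2 (partial_deriv i \<phi>)"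
    by (auto intro!: test_on_L2 test_on_partial_deriv)
  then have "integrable lebesgue (\<lambda>x. g x $ i * \<phi> x)" "integrable lebesgue (\<lambda>x. h x $ i * \<phi> x)"
    "integrable lebesgue (\<lambda>x. b x * partial_deriv i \<phi> x)" "integrable lebesgue (\<lambda>x. c x * partial_deriv i \<phi> x)"
    using L2_mult_integrable[OF L2_nth[OF assms(3)]] L2_mult_integrable[OF L2_nth[OF assms(4)]]
      L2_mult_integrable[OF assms(1)] L2_mult_integrable[OF assms(2)] by blast+
  moreover have "(\<integral>x. b x * partial_deriv i \<phi> x \<partial>lebesgue) = - (\<integral>x. g x $ i * \<phi> x \<partial>lebesgue)"
    "(\<integral>x. c x * partial_deriv i \<phi> x \<partial>lebesgue) = - (\<integral>x. h x $ i * \<phi> x \<partial>lebesgue)"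
    using assms(5,6) t unfolding weak_gradient_def by blast+
  ultimately show "(\<integral>x. (b x - c x) * partial_deriv i \<phi> x \<partial>lebesgue) = - (\<integral>x. (g x - h x) $ i * \<phi> x \<partial>lebesgue)"
    by (simp add: left_diff_distrib)
qed

lemma H12_diff:
  assumes "b \<in> H12" "c \<in> H12"
  shows "(\<lambda>x. b x - c x) \<in> H12"
  using assms unfolding H12_iff by (blast intro: weak_gradient_diff L2_diff)

text \<open>The optimal parameter is t = sqrt z / sqrt y. Shifting both y and z by d > 0 keeps it
  defined and positive, and d then tends to 0.\<close>

lemma sqrt_triangle:
  fixes x y z :: real
  assumes "\<And>t. t > 0 \<Longrightarrow> x \<le> (1 + t) * y + (1 + 1/t) * z" "y \<ge> 0" "z \<ge> 0"
  shows "sqrt x \<le> sqrt y + sqrt z"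
proof -
  have "sqrt x \<le> sqrt (y + d) + sqrt (z + d)" if d: "d > 0" for d
  proof -
    let ?a = "sqrt (y + d)" and ?b = "sqrt (z + d)"
    have p: "?a > 0" "?b > 0" using assms(2,3) d by auto
    have "x \<le> (1 + ?b / ?a) * y + (1 + 1/(?b / ?a)) * z" using p by (intro assms(1)) simp
    also have "\<dots> \<le> (1 + ?b / ?a) * (y + d) + (1 + 1/(?b / ?a)) * (z + d)"
      using p d by (intro add_mono mult_left_mono) (auto intro: add_nonneg_nonneg)
    also have "\<dots> = (1 + ?b / ?a) * (?a * ?a) + (1 + 1/(?b / ?a)) * (?b * ?b)"
      using assms(2,3) d by simp
    also have "\<dots> = (?a + ?b)\<^sup>2"
      using p by (simp add: field_simps power2_eq_square del: real_sqrt_mult_self)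
    finally show ?thesis using p by (intro real_le_lsqrt) auto
  qed
  then have "sqrt x \<le> sqrt (y + 1 / real (Suc k)) + sqrt (z + 1 / real (Suc k))" for k by simp
  moreover have "(\<lambda>k. sqrt (y + 1 / real (Suc k)) + sqrt (z + 1 / real (Suc k))) \<longlonglongrightarrow> sqrt (y + 0) + sqrt (z + 0)"
    by (intro tendsto_intros LIMSEQ_Suc[OF lim_1_over_n])
  ultimately show ?thesis by (simp add: LIMSEQ_le_const)
qed

lemma sqrt_nsq_triangle: "L2 f \<Longrightarrow> L2 g \<Longrightarrow> sqrt (nsq (\<lambda>x. f x + g x)) \<le> sqrt (nsq f) + sqrt (nsq g)"
  by (rule sqrt_triangle) (use L2_add(2) in auto)

text \<open>Phrased with differences because only those occur in Cauchy sequences.\<close>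

lemma sqrt_Dir_triangle:
  assumes "b \<in> H12" "c \<in> H12"
  shows "sqrt (Dir b) \<le> sqrt (Dir (\<lambda>x. b x - c x)) + sqrt (Dir c)"
    and "sqrt (Dir (\<lambda>x. b x - c x)) \<le> sqrt (Dir b) + sqrt (Dir c)"
proof -
  obtain g where g: "L2 b" "L2 g" "weak_gradient b g" "Dir b = nsq g" using assms H12E by metis
  obtain h where h: "L2 c" "L2 h" "weak_gradient c h" "Dir c = nsq h" using assms H12E by metis
  have d: "Dir (\<lambda>x. b x - c x) = nsq (\<lambda>x. g x - h x)"
    by (intro Dir_eq_nsq L2_diff weak_gradient_diff g h)
  show "sqrt (Dir b) \<le> sqrt (Dir (\<lambda>x. b x - c x)) + sqrt (Dir c)"
    using sqrt_nsq_triangle[of "\<lambda>x. g x - h x" h] g h by (simp add: d L2_diff)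
  have "nsq (\<lambda>x. - h x) = nsq h" using nsq_scaleR[of "-1" h] by simp
  then show "sqrt (Dir (\<lambda>x. b x - c x)) \<le> sqrt (Dir b) + sqrt (Dir c)"
    using sqrt_nsq_triangle[of g "\<lambda>x. - h x"] g h by (simp add: d L2_minus)
qed

lemma Dir_nonneg: "Dir b \<ge> 0"
  by (simp add: Dir_def)

lemma Dir_diff_commute: "b \<in> H12 \<Longrightarrow> c \<in> H12 \<Longrightarrow> Dir (\<lambda>x. b x - c x) = Dir (\<lambda>x. c x - b x)"
  by (elim H12E) (simp add: Dir_eq_nsq[OF L2_diff weak_gradient_diff], rule nsq_minus_commute)

text \<open>The product with a test function is a test function, so its partial derivatives have
  integral 0; the product rule turns this into integration by parts.\<close>

lemma smooth_weak_gradient: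
  assumes "smooth_on UNIV \<phi>"
  shows "weak_gradient \<phi> (grad \<phi>)"
  unfolding weak_gradient_def
proof (intro allI impI)
  fix \<psi> :: "real^'a \<Rightarrow> real" and i
  assume "test_fun \<psi>"
  then have t: "test_on UNIV \<psi>" by (simp add: test_fun_iff)
  have tm: "test_on UNIV (\<lambda>x. \<phi> x * \<psi> x)" by (intro test_on_mult t assms open_UNIV)
  have "test_on UNIV (\<lambda>x. \<phi> x * partial_deriv i \<psi> x)" "test_on UNIV (\<lambda>x. partial_deriv i \<phi> x * \<psi> x)"
    by (intro test_on_mult t test_on_partial_deriv assms smooth_on_partial_deriv open_UNIV)+
  then have i: "integrable lebesgue (\<lambda>x. \<phi> x * partial_deriv i \<psi> x)" "integrable lebesgue (\<lambda>x. partial_deriv i \<phi> x * \<psi> x)"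
    by (auto intro: cont_compact_integrable(2) test_on_cont_compact)
  have "0 = (\<integral>x. partial_deriv i (\<lambda>x. \<phi> x * \<psi> x) x \<partial>lebesgue)"
    using integral_partial_deriv_test_lebesgue[OF tm] by simp
  also have "\<dots> = (\<integral>x. \<phi> x * partial_deriv i \<psi> x + partial_deriv i \<phi> x * \<psi> x \<partial>lebesgue)"
    using smooth_on_differentiable[OF assms] test_on_differentiable[OF t]
    by (simp add: partial_deriv_mult)
  also have "\<dots> = (\<integral>x. \<phi> x * partial_deriv i \<psi> x \<partial>lebesgue) + (\<integral>x. partial_deriv i \<phi> x * \<psi> x \<partial>lebesgue)"
    using i by simp
  finally show "(\<integral>x. \<phi> x * partial_deriv i \<psi> x \<partial>lebesgue) = - (\<integral>x. grad \<phi> x $ i * \<psi> x \<partial>lebesgue)"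
    by simp
qed

lemma test_on_L2_grad: "test_on S \<phi> \<Longrightarrow> L2 (grad \<phi>)"
  by (rule L2_vecI) (auto intro: test_on_L2 test_on_partial_deriv)

lemma test_on_H12:
  assumes "test_on S \<phi>"
  shows "\<phi> \<in> H12" "Dir \<phi> = nsq (grad \<phi>)"
  using test_on_L2[OF assms] test_on_L2_grad[OF assms] smooth_weak_gradient[OF test_on_smooth[OF assms]]
  by (auto simp: H12_iff intro: Dir_eq_nsq)

section \<open>Cutoffs and density of test functions supported off the origin\<close>

lemma grad_compose_scale:
  assumes "\<phi> differentiable (at (c *\<^sub>R x))"
  shows "grad (\<lambda>x. \<phi> (c *\<^sub>R x)) x = c *\<^sub>R grad \<phi> (c *\<^sub>R x)"
    and "(\<lambda>x. \<phi> (c *\<^sub>R x)) differentiable (at x)"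
proof -
  have "((\<lambda>x. c *\<^sub>R x) has_derivative (\<lambda>h. c *\<^sub>R h)) (at x)" by (auto intro!: derivative_eq_intros)
  from has_derivative_compose[OF this has_derivative_grad[OF assms]]
  have "((\<lambda>x. \<phi> (c *\<^sub>R x)) has_derivative (\<lambda>h. (c *\<^sub>R grad \<phi> (c *\<^sub>R x)) \<bullet> h)) (at x)" by simp
  from grad_eqI[OF this] differentiableI[OF this]
  show "grad (\<lambda>x. \<phi> (c *\<^sub>R x)) x = c *\<^sub>R grad \<phi> (c *\<^sub>R x)" "(\<lambda>x. \<phi> (c *\<^sub>R x)) differentiable (at x)"
    by auto
qed

text \<open>The usual quotient of flat functions: 1 on the unit ball and 0 beyond radius 2. The
  denominator never vanishes because |x|^2 > 1 or |x|^2 < 4 always holds.\<close>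

definition bump :: "real^'n::finite \<Rightarrow> real" where
  "bump x = flat 0 (4 - (norm x)\<^sup>2) * inverse (flat 0 ((norm x)\<^sup>2 - 1) + flat 0 (4 - (norm x)\<^sup>2))"

lemma flat_0: "flat 0 t \<ge> 0" "flat 0 t > 0 \<longleftrightarrow> t > 0" "flat 0 t = 0 \<longleftrightarrow> t \<le> 0"
  by (auto simp: flat_def)

lemma bump_props:
  fixes x :: "real^'n::finite"
  shows "0 \<le> bump x" "bump x \<le> 1" "norm x \<le> 1 \<Longrightarrow> bump x = 1" "norm x \<ge> 2 \<Longrightarrow> bump x = 0"
    "test_on UNIV (bump :: real^'n \<Rightarrow> real)"
proof -
  have pos: "flat 0 ((norm x)\<^sup>2 - 1) + flat 0 (4 - (norm x)\<^sup>2) > 0" for x :: "real^'n"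
    using flat_0(1)[of "(norm x)\<^sup>2 - 1"] flat_0(1)[of "4 - (norm x)\<^sup>2"]
      flat_0(2)[of "(norm x)\<^sup>2 - 1"] flat_0(2)[of "4 - (norm x)\<^sup>2"] by linarith
  show "0 \<le> bump x" using pos[of x] by (simp add: bump_def flat_0)
  show "bump x \<le> 1" using pos[of x] flat_0(1)[of "(norm x)\<^sup>2 - 1"]
    by (simp add: bump_def divide_le_eq flip: divide_inverse)
  show "bump x = 1" if "norm x \<le> 1"
  proof -
    have "(norm x)\<^sup>2 \<le> 1" using that by (simp add: power_le_one)
    then have "flat 0 ((norm x)\<^sup>2 - 1) = 0" by (simp add: flat_0)
    then show ?thesis using pos[of x] by (simp add: bump_def)
  qed
  show z: "bump x = 0" if "norm x \<ge> 2" for x :: "real^'n"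
    using power_mono[OF that, of 2] by (simp add: bump_def flat_0)
  show "test_on UNIV (bump :: real^'n \<Rightarrow> real)"
  proof (rule test_onI[where K="cball 0 2"])
    show "smooth_on UNIV (bump :: real^'n \<Rightarrow> real)" unfolding bump_def[abs_def]
    proof (intro smooth_on_mult smooth_on_inverse smooth_on_add smooth_on_flat open_UNIV
        smooth_on_diff[OF open_UNIV smooth_on_norm_power2[OF open_UNIV] smooth_on_const]
        smooth_on_diff[OF open_UNIV smooth_on_const smooth_on_norm_power2[OF open_UNIV]])
      show "flat 0 ((norm x)\<^sup>2 - 1) + flat 0 (4 - (norm x)\<^sup>2) \<noteq> 0" for x :: "real^'n"
        using pos[of x] by simp
    qed
  qed (use z in auto)
qed

lemma smooth_on_scale: "smooth_on UNIV \<phi> \<Longrightarrow> smooth_on UNIV (\<lambda>x. \<phi> (c *\<^sub>R x))"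
  by (rule smooth_on_compose[where T=UNIV]) (auto intro!: smooth_intros)

lemma continuous_on_grad: "smooth_on UNIV \<phi> \<Longrightarrow> continuous_on UNIV (grad \<phi>)"
  unfolding grad_def[abs_def]
  by (intro continuous_on_vec_lambda smooth_on_continuous smooth_on_partial_deriv)

text \<open>A cube is taken for its explicit volume; all that matters later is the order
  r^n.\<close>

lemma nsq_le_cube:
  fixes F :: "real^'n::finite \<Rightarrow> 'b::euclidean_space"
  assumes m: "F \<in> borel_measurable lebesgue" and r: "r > 0"
    and z: "\<And>x. norm x > r \<Longrightarrow> F x = 0" and b: "\<And>x. norm x \<le> r \<Longrightarrow> norm (F x) \<le> C"
  shows "L2 F" "nsq F \<le> C\<^sup>2 * (2 * r) ^ CARD('n)"
proof -
  define Q :: "(real^'n) set" where "Q = cbox (\<chi> i. - r) (\<chi> i. r)"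
  define I :: "real^'n \<Rightarrow> real" where "I = indicator Q"
  have i2: "(norm (I x))\<^sup>2 = indicator Q x" for x by (simp add: I_def indicator_def)
  have fin: "emeasure lebesgue Q < \<infinity>" using emeasure_compact_finite[OF compact_cbox] by (simp add: Q_def)
  have I: "L2 I" unfolding L2_def i2 by (auto simp: I_def Q_def intro!: integrable_real_indicator borel_measurable_indicator fin[unfolded Q_def])
  have "measure lborel Q = (\<Prod>i\<in>(UNIV::'n set). 2 * r)"
    unfolding Q_def using r content_cbox_cart[of "\<chi> i. - r" "\<chi> i. r"] by (simp add: interval_ne_empty_cart)
  then have nI: "nsq I = (2 * r) ^ CARD('n)"
    unfolding nsq_def i2 by (simp add: Q_def)
  have "norm (F x) \<le> C * norm (I x)" for x
  proof (cases "norm x \<le> r")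
    case True
    have "\<bar>x $ i\<bar> \<le> r" for i using component_le_norm_cart[of x i] True by linarith
    then have "x \<in> Q" by (auto simp: Q_def mem_box_cart abs_le_iff minus_le_iff)
    then show ?thesis using b[OF True] by (simp add: I_def)
  next
    case False
    have "norm (F 0) \<le> C" using b[of 0] r by simp
    then have "C \<ge> 0" using norm_ge_zero[of "F 0"] by linarith
    then show ?thesis using z[of x] False by simp
  qed
  from L2_bound[OF m I this] show "L2 F" "nsq F \<le> C\<^sup>2 * (2 * r) ^ CARD('n)" by (simp_all add: nI)
qed

lemma AE_nonzero: "AE x in lebesgue. x \<noteq> (0 :: 'a::euclidean_space)"
  by (rule AE_I'[of "{0}"]) (auto simp: negligible_iff_null_sets[symmetric])

lemma nsq_multiplier_tendsto_0:
  fixes F :: "'a::euclidean_space \<Rightarrow> 'b::euclidean_space"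
  assumes F: "L2 F" and m [measurable]: "\<And>k. \<eta> k \<in> borel_measurable lebesgue"
    and b: "\<And>k x. 0 \<le> \<eta> k x" "\<And>k x. \<eta> k x \<le> (1::real)"
    and lim: "AE x in lebesgue. (\<lambda>k. 1 - \<eta> k x) \<longlonglongrightarrow> 0"
  shows "(\<lambda>k. nsq (\<lambda>x. (1 - \<eta> k x) *\<^sub>R F x)) \<longlonglongrightarrow> 0"
proof (rule L2_dominated_convergence[OF _ F])
  have [measurable]: "F \<in> borel_measurable lebesgue" using F by (simp add: L2_def)
  show "(\<lambda>x. (1 - \<eta> k x) *\<^sub>R F x) \<in> borel_measurable lebesgue" for k by measurable
  show "norm ((1 - \<eta> k x) *\<^sub>R F x) \<le> norm (F x)" for k x
    using b[of k x] by (simp add: mult_left_le_one_le)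
  show "AE x in lebesgue. (\<lambda>k. (1 - \<eta> k x) *\<^sub>R F x) \<longlonglongrightarrow> 0"
    using lim
  proof eventually_elim
    case (elim x)
    from tendsto_scaleR[OF elim tendsto_const[of "F x"]] show ?case by simp
  qed
qed

text \<open>A point has zero capacity in dimension at least three, so functions can be cut off near 0.\<close>

lemma smooth_cutoff_approx:
  fixes \<psi> :: "real^'n::finite \<Rightarrow> real"
  assumes n: "CARD('n) \<ge> 3" and s: "smooth_on UNIV \<psi>" and L: "L2 \<psi>" "L2 (grad \<psi>)" and e: "e > 0"
  obtains \<phi> where "test_on (- {0}) \<phi>" "nsq (\<lambda>x. \<psi> x - \<phi> x) < e" "nsq (\<lambda>x. grad \<psi> x - grad \<phi> x) < e"
proof -
  have bt: "test_on UNIV (bump :: real^'n \<Rightarrow> real)" by (rule bump_props)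
  have bs: "smooth_on UNIV (bump :: real^'n \<Rightarrow> real)" using bt by (rule test_on_smooth)
  obtain B where B: "B > 0" "\<And>x :: real^'n. norm (grad bump x) \<le> B" using test_on_Lipschitz[OF bt] by metis
  have "compact (\<psi> ` cball 0 2)"
    by (intro compact_continuous_image continuous_on_subset[OF smooth_on_continuous[OF s]]) auto
  then obtain M where M: "M > 0" "\<And>x. norm x \<le> 2 \<Longrightarrow> \<bar>\<psi> x\<bar> \<le> M"
    using compact_imp_bounded[of "\<psi> ` cball 0 2"] unfolding bounded_pos by (auto simp: image_iff)
  define p :: "nat \<Rightarrow> real" where "p k = real (Suc k)" for k
  have p: "p k \<ge> 1" "p k > 0" for k by (auto simp: p_def)
  \<comment> \<open>Zero for |x| <= 1/p and for |x| >= 2p, one for 2/p <= |x| <= p: the factor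
    removes a neighbourhood of 0 and one of infinity.\<close>
  define \<eta> where "\<eta> k x = (1 - bump (p k *\<^sub>R x)) * bump (inverse (p k) *\<^sub>R x)" for k and x :: "real^'n"
  define \<phi> where "\<phi> k x = \<eta> k x * \<psi> x" for k x
  have \<eta>s: "smooth_on UNIV (\<eta> k)" for k unfolding \<eta>_def
    by (intro smooth_intros smooth_on_scale bs open_UNIV)
  have \<eta>b: "0 \<le> \<eta> k x" "\<eta> k x \<le> 1" for k x
    using bump_props(1,2)[of "p k *\<^sub>R x"] bump_props(1,2)[of "inverse (p k) *\<^sub>R x"]
    by (auto simp: \<eta>_def mult_le_one)
  have t: "test_on (- {0}) (\<phi> k)" for k
  proof (rule test_onI[where K="cball 0 (2 * p k) - ball 0 (inverse (p k))"])
    show "smooth_on (- {0}) (\<phi> k)" unfolding \<phi>_def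
      by (rule smooth_on_mono[OF smooth_on_mult[OF open_UNIV \<eta>s s]]) auto
    show "cball 0 (2 * p k) - ball 0 (inverse (p k)) \<subseteq> - {0::real^'n}" using p[of k] by auto
    fix x assume "x \<notin> cball 0 (2 * p k) - ball (0::real^'n) (inverse (p k))"
    then consider "norm x > 2 * p k" | "norm x < inverse (p k)" by fastforce
    then show "\<phi> k x = 0"
    proof cases
      case 1
      then have "bump (inverse (p k) *\<^sub>R x) = 0"
        using p[of k] by (intro bump_props(4)) (simp add: field_simps)
      then show ?thesis by (simp add: \<phi>_def \<eta>_def)
    next
      case 2
      then have "bump (p k *\<^sub>R x) = 1"
        using p[of k] by (intro bump_props(3)) (simp add: field_simps)
      then show ?thesis by (simp add: \<phi>_def \<eta>_def)
    qed
  qed (auto intro: compact_diff)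
  have \<eta>lim: "(\<lambda>k. 1 - \<eta> k x) \<longlonglongrightarrow> 0" if "x \<noteq> 0" for x
  proof -
    obtain N :: nat where N: "norm x + 2 / norm x \<le> real N" using real_arch_simple by blast
    have "1 - \<eta> k x = 0" if "k \<ge> N" for k
    proof -
      have "real N \<le> p k" using that by (simp add: p_def)
      moreover have "2 / norm x \<ge> 0" by simp
      ultimately have "norm x \<le> p k" "2 / norm x \<le> p k" using N norm_ge_zero[of x] by linarith+
      then have "bump (inverse (p k) *\<^sub>R x) = 1" "bump (p k *\<^sub>R x) = 0"
        using p[of k] \<open>x \<noteq> 0\<close> by (auto intro!: bump_props(3,4) simp: field_simps)
      then show ?thesis by (simp add: \<eta>_def)
    qed
    then show ?thesis by (intro tendsto_eventually eventually_sequentiallyI)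
  qed
  have \<eta>m [measurable]: "\<eta> k \<in> borel_measurable lebesgue" for k
    using smooth_on_continuous[OF \<eta>s] by (auto intro!: measurable_completion borel_measurable_continuous_onI)
  have "AE x in lebesgue. (\<lambda>k. 1 - \<eta> k x) \<longlonglongrightarrow> 0"
    using AE_nonzero by eventually_elim (rule \<eta>lim)
  note conv0 = nsq_multiplier_tendsto_0[OF _ \<eta>m \<eta>b this]
  \<comment> \<open>\<open>G1\<close> comes from the cutoff at infinity and is of size |\<psi>| / p.
    \<open>G2\<close> comes from the cutoff at 0: it is of size p, but only on the ball of radius
    2/p.\<close>
  define G1 where "G1 k x = (\<psi> x * (1 - bump (p k *\<^sub>R x)) * inverse (p k)) *\<^sub>R grad bump (inverse (p k) *\<^sub>R x)" for k x
  define G2 where "G2 k x = (\<psi> x * bump (inverse (p k) *\<^sub>R x) * p k) *\<^sub>R grad bump (p k *\<^sub>R x)" for k x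
  have grad\<phi>: "grad \<psi> x - grad (\<phi> k) x = (1 - \<eta> k x) *\<^sub>R grad \<psi> x + (G2 k x - G1 k x)" for k x
  proof -
    note d = test_on_differentiable[OF bt]
    have g1: "grad (\<lambda>x. 1 - bump (p k *\<^sub>R x)) x = - (p k *\<^sub>R grad bump (p k *\<^sub>R x))"
      and d1: "(\<lambda>x. 1 - bump (p k *\<^sub>R x)) differentiable (at x)"
      using grad_diff[of "\<lambda>x. 1" x "\<lambda>x. bump (p k *\<^sub>R x)"] grad_compose_scale[OF d]
        grad_eqI[of "\<lambda>x. 1" 0 x] by auto
    have d2: "(\<lambda>x. bump (inverse (p k) *\<^sub>R x)) differentiable (at x)"
      using grad_compose_scale[OF d] by blast
    have e1: "grad (\<eta> k) x = (1 - bump (p k *\<^sub>R x)) *\<^sub>R (inverse (p k) *\<^sub>R grad bump (inverse (p k) *\<^sub>R x))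
        - bump (inverse (p k) *\<^sub>R x) *\<^sub>R (p k *\<^sub>R grad bump (p k *\<^sub>R x))"
      unfolding \<eta>_def grad_mult[OF d1 d2] g1 grad_compose_scale(1)[OF d] by simp
    have e2: "grad (\<phi> k) x = \<eta> k x *\<^sub>R grad \<psi> x + \<psi> x *\<^sub>R grad (\<eta> k) x"
      unfolding \<phi>_def by (rule grad_mult) (use smooth_on_differentiable[OF s] smooth_on_differentiable[OF \<eta>s] in auto)
    show ?thesis unfolding e2 e1
      by (simp add: G1_def G2_def algebra_simps)
  qed
  have cont: "continuous_on UNIV (\<lambda>x::real^'n. bump (c *\<^sub>R x))" for c
    by (rule continuous_on_compose2[OF smooth_on_continuous[OF bs]]) (auto intro!: continuous_intros)
  have cont_grad: "continuous_on UNIV (\<lambda>x::real^'n. grad bump (c *\<^sub>R x))" for c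
    by (rule continuous_on_compose2[OF continuous_on_grad[OF bs]]) (auto intro!: continuous_intros)
  have Gm: "G1 k \<in> borel_measurable lebesgue" "G2 k \<in> borel_measurable lebesgue" for k
    unfolding G1_def[abs_def] G2_def[abs_def]
    by (auto intro!: measurable_completion borel_measurable_continuous_onI continuous_intros cont cont_grad smooth_on_continuous[OF s])
  have G1: "L2 (G1 k)" "nsq (G1 k) \<le> (B * inverse (p k))\<^sup>2 * nsq \<psi>" for k
  proof -
    have "norm (G1 k x) \<le> B * inverse (p k) * norm (\<psi> x)" for x
    proof -
      have "norm (G1 k x) = \<bar>\<psi> x\<bar> * inverse (p k) * ((1 - bump (p k *\<^sub>R x)) * norm (grad bump (inverse (p k) *\<^sub>R x)))"
        using p[of k] bump_props(2)[of "p k *\<^sub>R x"] by (simp add: G1_def abs_mult)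
      also have "\<dots> \<le> \<bar>\<psi> x\<bar> * inverse (p k) * (1 * B)"
        using p[of k] bump_props(1,2)[of "p k *\<^sub>R x"] B by (intro mult_left_mono mult_mono) auto
      finally show ?thesis by (simp add: mult_ac)
    qed
    from L2_bound[OF Gm(1) L(1) this] show "L2 (G1 k)" "nsq (G1 k) \<le> (B * inverse (p k))\<^sup>2 * nsq \<psi>" by auto
  qed
  have G2: "L2 (G2 k)" "nsq (G2 k) \<le> (M * B)\<^sup>2 * 4 ^ CARD('n) * inverse (p k)" for k
  proof -
    have z: "G2 k x = 0" if "norm x > 2 / p k" for x
    proof -
      have "p k *\<^sub>R x \<notin> cball 0 2" using that p[of k] by (simp add: field_simps)
      then have "partial_deriv i bump (p k *\<^sub>R x) = 0" for i
        by (intro partial_deriv_zero_off[where K="cball 0 2"]) (auto intro: bump_props(4))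
      then have "grad bump (p k *\<^sub>R x) = 0" by (simp add: vec_eq_iff)
      then show ?thesis by (simp add: G2_def)
    qed
    have b: "norm (G2 k x) \<le> M * B * p k" if "norm x \<le> 2 / p k" for x
    proof -
      have "2 / p k \<le> 2" using p[of k] by (simp add: field_simps)
      then have x: "\<bar>\<psi> x\<bar> \<le> M" using M(2) that by simp
      have "norm (G2 k x) = (\<bar>\<psi> x\<bar> * bump (inverse (p k) *\<^sub>R x)) * p k * norm (grad bump (p k *\<^sub>R x))"
        using p[of k] bump_props(1)[of "inverse (p k) *\<^sub>R x"] by (simp add: G2_def abs_mult)
      also have "\<dots> \<le> (M * 1) * p k * B"
        using p[of k] M(1) x B bump_props(1,2)[of "inverse (p k) *\<^sub>R x"] by (intro mult_mono) auto
      finally show ?thesis by (simp add: mult_ac)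
    qed
    have r0: "2 / p k > 0" using p[of k] by simp
    have G2_le: "nsq (G2 k) \<le> (M * B * p k)\<^sup>2 * (2 * (2 / p k)) ^ CARD('n)"
      by (rule nsq_le_cube(2)[OF Gm(2) r0 z b])
    show "L2 (G2 k)" by (rule nsq_le_cube(1)[OF Gm(2) r0 z b])
    \<comment> \<open>Here the dimension enters: p^2 from the squared gradient against a volume of
      order p^(-n) leaves at most 1/p once n >= 3.\<close>
    have "(p k)\<^sup>2 * (1 / p k) ^ CARD('n) \<le> (p k)\<^sup>2 * (1 / p k) ^ 3"
      using n p[of k] by (intro mult_left_mono power_decreasing) auto
    also have "\<dots> = inverse (p k)" using p[of k] by (simp add: field_simps power2_eq_square power3_eq_cube)
    finally have q: "(p k)\<^sup>2 * (1 / p k) ^ CARD('n) \<le> inverse (p k)" .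
    have "(M * B * p k)\<^sup>2 * (2 * (2 / p k)) ^ CARD('n) = (M * B)\<^sup>2 * 4 ^ CARD('n) * ((p k)\<^sup>2 * (1 / p k) ^ CARD('n))"
      by (simp add: power_mult_distrib power_divide)
    also have "\<dots> \<le> (M * B)\<^sup>2 * 4 ^ CARD('n) * inverse (p k)" by (intro mult_left_mono q) auto
    finally show "nsq (G2 k) \<le> (M * B)\<^sup>2 * 4 ^ CARD('n) * inverse (p k)"
      using G2_le by linarith
  qed
  have pl: "(\<lambda>k. inverse (p k)) \<longlonglongrightarrow> 0" unfolding p_def by (rule LIMSEQ_inverse_real_of_nat)
  have l1: "(\<lambda>k. 2 * nsq (\<lambda>x. (1 - \<eta> k x) *\<^sub>R grad \<psi> x) + 2 * (2 * ((M * B)\<^sup>2 * 4 ^ CARD('n) * inverse (p k)) + 2 * ((B * inverse (p k))\<^sup>2 * nsq \<psi>))) \<longlonglongrightarrow> 0"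
  proof -
    have la: "(\<lambda>k. nsq (\<lambda>x. (1 - \<eta> k x) *\<^sub>R grad \<psi> x)) \<longlonglongrightarrow> 0" by (rule conv0[OF L(2)])
    have "(\<lambda>k. 2 * nsq (\<lambda>x. (1 - \<eta> k x) *\<^sub>R grad \<psi> x) + 2 * (2 * ((M * B)\<^sup>2 * 4 ^ CARD('n) * inverse (p k)) + 2 * ((B * inverse (p k))\<^sup>2 * nsq \<psi>)))
      \<longlonglongrightarrow> 2 * 0 + 2 * (2 * ((M * B)\<^sup>2 * 4 ^ CARD('n) * 0) + 2 * ((B * 0)\<^sup>2 * nsq \<psi>))"
      by (intro tendsto_add tendsto_mult tendsto_power tendsto_const pl la)
    then show ?thesis by simp
  qed
  have le: "nsq (\<lambda>x. grad \<psi> x - grad (\<phi> k) x) \<le> 2 * nsq (\<lambda>x. (1 - \<eta> k x) *\<^sub>R grad \<psi> x) + 2 * (2 * ((M * B)\<^sup>2 * 4 ^ CARD('n) * inverse (p k)) + 2 * ((B * inverse (p k))\<^sup>2 * nsq \<psi>))" for k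
  proof -
    have "L2 (\<lambda>x. (1 - \<eta> k x) *\<^sub>R grad \<psi> x)"
    proof (rule L2_bound(1)[where C=1, OF _ L(2)])
      have [measurable]: "grad \<psi> \<in> borel_measurable lebesgue" using L by (simp add: L2_def)
      show "(\<lambda>x. (1 - \<eta> k x) *\<^sub>R grad \<psi> x) \<in> borel_measurable lebesgue" by measurable
      show "norm ((1 - \<eta> k x) *\<^sub>R grad \<psi> x) \<le> 1 * norm (grad \<psi> x)" for x
        using \<eta>b[of k x] by (simp add: mult_left_le_one_le)
    qed
    from nsq_add_le[OF this L2_diff[OF G2(1)[of k] G1(1)[of k]]]
    have a: "nsq (\<lambda>x. grad \<psi> x - grad (\<phi> k) x) \<le> 2 * nsq (\<lambda>x. (1 - \<eta> k x) *\<^sub>R grad \<psi> x) + 2 * nsq (\<lambda>x. G2 k x - G1 k x)"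
      unfolding grad\<phi> .
    have "nsq (\<lambda>x. - G1 k x) = nsq (G1 k)" by (simp add: nsq_def)
    then have b: "nsq (\<lambda>x. G2 k x - G1 k x) \<le> 2 * nsq (G2 k) + 2 * nsq (G1 k)"
      using nsq_add_le[OF G2(1)[of k] L2_minus[OF G1(1)[of k]]] by simp
    have "a \<le> 2 * u + 2 * (2 * v + 2 * w)" if "a \<le> 2 * u + 2 * b" "b \<le> 2 * c + 2 * d" "d \<le> w" "c \<le> v"
      for a b c d u v w :: real using that by argo
    from this[OF a b G1(2) G2(2)] show ?thesis .
  qed
  have "(\<lambda>k. nsq (\<lambda>x. \<psi> x - \<phi> k x)) \<longlonglongrightarrow> 0"
    using conv0[OF L(1)] by (simp add: \<phi>_def algebra_simps)
  then have "\<forall>\<^sub>F k in sequentially. nsq (\<lambda>x. \<psi> x - \<phi> k x) < e" using e by (intro order_tendstoD) auto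
  moreover have "\<forall>\<^sub>F k in sequentially. 2 * nsq (\<lambda>x. (1 - \<eta> k x) *\<^sub>R grad \<psi> x) + 2 * (2 * ((M * B)\<^sup>2 * 4 ^ CARD('n) * inverse (p k)) + 2 * ((B * inverse (p k))\<^sup>2 * nsq \<psi>)) < e"
    using l1 e by (rule order_tendstoD(2))
  ultimately have "\<forall>\<^sub>F k in sequentially. nsq (\<lambda>x. \<psi> x - \<phi> k x) < e \<and> nsq (\<lambda>x. grad \<psi> x - grad (\<phi> k) x) < e"
    by eventually_elim (use le in \<open>auto intro: le_less_trans\<close>)
  then obtain k where "nsq (\<lambda>x. \<psi> x - \<phi> k x) < e \<and> nsq (\<lambda>x. grad \<psi> x - grad (\<phi> k) x) < e"
    by (auto simp: eventually_sequentially)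
  then show ?thesis using that t by blast
qed

lemma H12_approx_test:
  fixes f :: "real^'n::finite \<Rightarrow> real"
  assumes n: "CARD('n) \<ge> 3" and f: "f \<in> H12" and e: "e > 0"
  obtains \<phi> where "test_on (- {0}) \<phi>" "nsq (\<lambda>x. f x - \<phi> x) < e" "Dir (\<lambda>x. f x - \<phi> x) < e"
proof -
  obtain g where g: "L2 f" "L2 g" "weak_gradient f g" using H12E[OF f] by metis
  \<comment> \<open>The index \<open>None\<close> stands for the function and \<open>Some i\<close>
    for the i-th component of its weak gradient, so that one kernel smooths them all.\<close>
  define F where "F = case_option f (\<lambda>i x. g x $ i)"
  \<comment> \<open>The n gradient components together contribute at most e/5, and twice the sum of
    two such errors stays below e.\<close>
  define c where "c = e / (5 * real CARD('n))"
  have c: "c > 0" "c \<le> e / 5" "real CARD('n) * c = e / 5" using e n by (auto simp: c_def field_simps)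
  have "L2 (F i)" for i by (auto simp: F_def g L2_nth split: option.split)
  then obtain \<rho> where \<rho>: "test_on UNIV \<rho>" "\<And>i. L2 (\<lambda>x. conv (F i) \<rho> x - F i x)"
    "\<And>i. nsq (\<lambda>x. conv (F i) \<rho> x - F i x) \<le> c"
    using simultaneous_mollification[of "UNIV :: 'n option set" F c] c(1) by auto
  define \<psi> where "\<psi> = conv f \<rho>"
  have gr: "grad \<psi> x $ i = conv (F (Some i)) \<rho> x" for x i
    using conv_partial_deriv[OF g(1) \<rho>(1)] conv_weak_gradient[OF g(3) \<rho>(1)] by (simp add: \<psi>_def F_def)
  have a1: "L2 (\<lambda>x. \<psi> x - f x)" "nsq (\<lambda>x. \<psi> x - f x) \<le> c"
    using \<rho>(2,3)[of None] by (auto simp: \<psi>_def F_def)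
  have comp: "(\<lambda>x. (grad \<psi> x - g x) $ i) = (\<lambda>x. conv (F (Some i)) \<rho> x - F (Some i) x)" for i
    using gr by (simp add: F_def del: grad_nth)
  have a2: "L2 (\<lambda>x. grad \<psi> x - g x)" "nsq (\<lambda>x. grad \<psi> x - g x) \<le> e / 5"
  proof -
    have l: "L2 (\<lambda>x. (grad \<psi> x - g x) $ i)" for i unfolding comp by (rule \<rho>)
    then show "L2 (\<lambda>x. grad \<psi> x - g x)" by (rule L2_vecI)
    have "nsq (\<lambda>x. grad \<psi> x - g x) = (\<Sum>i\<in>UNIV. nsq (\<lambda>x. (grad \<psi> x - g x) $ i))" by (rule L2_vecI(2)[OF l])
    also have "\<dots> \<le> (\<Sum>i\<in>(UNIV::'n set). c)" unfolding comp by (intro sum_mono \<rho>)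
    finally show "nsq (\<lambda>x. grad \<psi> x - g x) \<le> e / 5" using c by simp
  qed
  have "L2 \<psi>" "L2 (grad \<psi>)"
    using L2_add(1)[OF a1(1) g(1)] L2_add(1)[OF a2(1) g(2)] by simp_all
  then obtain \<phi> where \<phi>: "test_on (- {0}) \<phi>" "nsq (\<lambda>x. \<psi> x - \<phi> x) < e/5" "nsq (\<lambda>x. grad \<psi> x - grad \<phi> x) < e/5"
    using smooth_cutoff_approx[OF n smooth_on_conv[OF g(1) \<rho>(1)], of "e/5"] e unfolding \<psi>_def by auto
  have "nsq (\<lambda>x. f x - \<phi> x) \<le> 2 * nsq (\<lambda>x. f x - \<psi> x) + 2 * nsq (\<lambda>x. \<psi> x - \<phi> x)"
    by (rule nsq_triangle) (intro L2_diff g \<open>L2 \<psi>\<close> test_on_L2[OF \<phi>(1)])+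
  then have 1: "nsq (\<lambda>x. f x - \<phi> x) < e"
    using \<phi>(2) a1(2) c e nsq_minus_commute[of f \<psi>] by linarith
  have "nsq (\<lambda>x. g x - grad \<phi> x) \<le> 2 * nsq (\<lambda>x. g x - grad \<psi> x) + 2 * nsq (\<lambda>x. grad \<psi> x - grad \<phi> x)"
    by (rule nsq_triangle) (intro L2_diff g \<open>L2 (grad \<psi>)\<close> test_on_L2_grad[OF \<phi>(1)])+
  then have 2: "nsq (\<lambda>x. g x - grad \<phi> x) < e"
    using \<phi>(3) a2(2) e nsq_minus_commute[of g "grad \<psi>"] by linarith
  have "Dir (\<lambda>x. f x - \<phi> x) = nsq (\<lambda>x. g x - grad \<phi> x)"
    by (intro Dir_eq_nsq L2_diff weak_gradient_diff g test_on_L2[OF \<phi>(1)] test_on_L2_grad[OF \<phi>(1)]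
        smooth_weak_gradient test_on_smooth[OF \<phi>(1)])
  then show ?thesis using that \<phi>(1) 1 2 by simp
qed

section \<open>Hardy's inequality and the extended Dirichlet form\<close>

text \<open>The weight |x|^(-2) of Hardy's inequality, and at the same time the conformal factor of
  the inversion. At 0 it takes the value 0.\<close>

definition hweight :: "real^'n::finite \<Rightarrow> real" where
  "hweight x = inverse ((norm x)\<^sup>2)"

lemma smooth_on_hweight: "smooth_on (- {0}) hweight"
  unfolding hweight_def[abs_def]
  by (intro smooth_on_inverse smooth_on_mono[OF smooth_on_norm_power2[OF open_UNIV]]) auto

lemma hweight_nonneg: "hweight x \<ge> 0"
  by (simp add: hweight_def)

lemma hweight_inner:
  assumes "x \<noteq> 0"
  shows "(hweight x)\<^sup>2 * (x \<bullet> x) = hweight x"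
proof -
  have "hweight x * (x \<bullet> x) = 1" using assms by (simp add: hweight_def power2_norm_eq_inner)
  then show ?thesis by (simp add: power2_eq_square mult.assoc)
qed

lemma grad_hweight:
  assumes "x \<noteq> 0"
  shows "grad hweight x = (- 2 * (hweight x)\<^sup>2) *\<^sub>R x"
proof (rule grad_eqI)
  have "((\<lambda>x. x \<bullet> x) has_derivative (\<lambda>h. x \<bullet> h + h \<bullet> x)) (at x)"
    by (intro has_derivative_inner has_derivative_ident)
  then have "((\<lambda>x. inverse (x \<bullet> x)) has_derivative (\<lambda>h. - (inverse (x \<bullet> x) * (x \<bullet> h + h \<bullet> x) * inverse (x \<bullet> x)))) (at x)"
    using assms by (intro Deriv.has_derivative_inverse) auto
  moreover have "(\<lambda>h. - (inverse (x \<bullet> x) * (x \<bullet> h + h \<bullet> x) * inverse (x \<bullet> x))) = (\<lambda>h. ((- 2 * (hweight x)\<^sup>2) *\<^sub>R x) \<bullet> h)"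
    unfolding hweight_def power2_norm_eq_inner
  proof (rule ext)
    fix h
    have "h \<bullet> x = x \<bullet> h" by (rule inner_commute)
    then show "- (inverse (x \<bullet> x) * (x \<bullet> h + h \<bullet> x) * inverse (x \<bullet> x)) = ((- 2 * (inverse (x \<bullet> x))\<^sup>2) *\<^sub>R x) \<bullet> h"
      by (simp add: power2_eq_square)
  qed
  ultimately show "(hweight has_derivative (\<lambda>h. ((- 2 * (hweight x)\<^sup>2) *\<^sub>R x) \<bullet> h)) (at x)"
    by (simp add: hweight_def[abs_def] power2_norm_eq_inner)
qed

text \<open>Integrating the divergence of the field psi^2 x / |x|^2 gives Hardy's inequality after completing a square.\<close>

lemma Hardy_inequality:
  fixes \<psi> :: "real^'n::finite \<Rightarrow> real"
  assumes t: "test_on (- {0}) \<psi>"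
  shows "((real CARD('n) - 2) / 2)\<^sup>2 * (\<integral>x. hweight x * (\<psi> x)\<^sup>2 \<partial>lebesgue) \<le> nsq (grad \<psi>)"
    and "integrable lebesgue (\<lambda>x. hweight x * (\<psi> x)\<^sup>2)"
proof -
  \<comment> \<open>The field x / |x|^2 has divergence (n-2) / |x|^2, that is 2c times the weight;
    c^2 is the constant of Hardy's inequality.\<close>
  define c where "c = (real CARD('n) - 2) / 2"
  have o: "open (- {0 :: real^'n})" by (intro open_Compl closed_singleton)
  have \<psi>s: "smooth_on (- {0}) \<psi>" using test_on_smooth[OF t] smooth_on_mono by blast
  define v where "v i x = (x $ i * hweight x * \<psi> x) * \<psi> x" for i x
  have vt: "test_on (- {0}) (v i)" for i unfolding v_def
    by (intro test_on_mult o t smooth_on_mult smooth_on_nth smooth_on_hweight \<psi>s)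
  have "test_on (- {0}) (\<lambda>x. (hweight x * \<psi> x) * \<psi> x)"
    by (intro test_on_mult o t smooth_on_mult smooth_on_hweight \<psi>s)
  then have qi: "integrable lebesgue (\<lambda>x. (hweight x * \<psi> x) * \<psi> x)"
    by (intro cont_compact_integrable test_on_cont_compact)
  then show hi: "integrable lebesgue (\<lambda>x. hweight x * (\<psi> x)\<^sup>2)" by (simp add: power2_eq_square mult.assoc)
  have div: "(\<Sum>i\<in>UNIV. partial_deriv i (v i) x) = 2 * c * (hweight x * (\<psi> x)\<^sup>2) + 2 * \<psi> x * hweight x * (x \<bullet> grad \<psi> x)"
    if x: "x \<noteq> 0" for x
  proof -
    have dq: "hweight differentiable (at x)" using smooth_on_differentiable[OF smooth_on_hweight] x by auto
    have dn: "(\<lambda>x. x $ i) differentiable (at x)" for i using smooth_on_differentiable[OF smooth_on_nth] by blast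
    have dp: "\<psi> differentiable (at x)" by (rule test_on_differentiable[OF t])
    have pn: "partial_deriv i (\<lambda>x. x $ i) x = 1" for i
      using partial_deriv_eqI[OF bounded_linear_imp_has_derivative[OF bounded_linear_vec_nth[of i]], of i x] by simp
    have pq: "partial_deriv i hweight x = - 2 * (hweight x)\<^sup>2 * x $ i" for i
      using grad_hweight[OF x] by (metis grad_nth vector_scaleR_component real_scaleR_def)
    have "partial_deriv i (v i) x = hweight x * (\<psi> x)\<^sup>2 - 2 * (hweight x)\<^sup>2 * (x $ i * x $ i) * (\<psi> x)\<^sup>2
        + 2 * \<psi> x * hweight x * (x $ i * partial_deriv i \<psi> x)" for i
      unfolding v_def[abs_def]
      by (simp add: partial_deriv_mult differentiable_mult dq dn dp pn pq algebra_simps power2_eq_square)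
    then have s: "(\<Sum>i\<in>UNIV. partial_deriv i (v i) x) = real CARD('n) * (hweight x * (\<psi> x)\<^sup>2)
        - 2 * ((hweight x)\<^sup>2 * (x \<bullet> x)) * (\<psi> x)\<^sup>2 + 2 * \<psi> x * hweight x * (x \<bullet> grad \<psi> x)"
      by (simp add: sum.distrib sum_subtractf inner_vec_def sum_distrib_left sum_distrib_right mult_ac)
    have "real CARD('n) = 2 * c + 2" by (simp add: c_def field_simps)
    then show ?thesis unfolding s hweight_inner[OF x] by (simp add: algebra_simps)
  qed
  have pt: "c\<^sup>2 * (hweight x * (\<psi> x)\<^sup>2) \<le> (norm (grad \<psi> x))\<^sup>2 + c * (\<Sum>i\<in>UNIV. partial_deriv i (v i) x)"
    if x: "x \<noteq> 0" for x
  proof -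
    \<comment> \<open>Expanding this square and comparing with c times the divergence gives the
      pointwise inequality.\<close>
    have "0 \<le> (norm (grad \<psi> x + (c * \<psi> x * hweight x) *\<^sub>R x))\<^sup>2" by simp
    also have "\<dots> = (norm (grad \<psi> x))\<^sup>2 + c * (2 * \<psi> x * hweight x * (x \<bullet> grad \<psi> x)) + c\<^sup>2 * (\<psi> x)\<^sup>2 * ((hweight x)\<^sup>2 * (x \<bullet> x))"
      unfolding power2_norm_eq_inner
      using inner_commute[of x "grad \<psi> x"] by (simp add: inner_add power2_eq_square algebra_simps)
    also have "(hweight x)\<^sup>2 * (x \<bullet> x) = hweight x"
      by (rule hweight_inner[OF x])
    finally show ?thesis unfolding div[OF x] by (simp add: power2_eq_square algebra_simps)
  qed
  have vi: "integrable lebesgue (partial_deriv i (v i))" for i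
    by (rule cont_compact_integrable(2)[OF test_on_cont_compact[OF test_on_partial_deriv[OF vt]]])
  have gi: "integrable lebesgue (\<lambda>x. (norm (grad \<psi> x))\<^sup>2)"
    using test_on_L2_grad[OF t] by (rule L2_integrable)
  have "(\<integral>x. c\<^sup>2 * (hweight x * (\<psi> x)\<^sup>2) \<partial>lebesgue) \<le> (\<integral>x. (norm (grad \<psi> x))\<^sup>2 + c * (\<Sum>i\<in>UNIV. partial_deriv i (v i) x) \<partial>lebesgue)"
  proof (rule integral_mono_AE)
    show "AE x in lebesgue. c\<^sup>2 * (hweight x * (\<psi> x)\<^sup>2) \<le> (norm (grad \<psi> x))\<^sup>2 + c * (\<Sum>i\<in>UNIV. partial_deriv i (v i) x)"
      using AE_nonzero by eventually_elim (rule pt)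
  qed (use hi gi vi in auto)
  also have "\<dots> = nsq (grad \<psi>)"
    using gi vi by (simp add: nsq_def integral_partial_deriv_test_lebesgue[OF vt])
  finally show "((real CARD('n) - 2) / 2)\<^sup>2 * (\<integral>x. hweight x * (\<psi> x)\<^sup>2 \<partial>lebesgue) \<le> nsq (grad \<psi>)"
    by (simp add: c_def)
qed

section \<open>Closability of the Dirichlet form\<close>

lemma hweight_measurable: "hweight \<in> borel_measurable lebesgue"
proof -
  have "(hweight :: real^'n::finite \<Rightarrow> real) \<in> borel_measurable borel" unfolding hweight_def[abs_def] by measurable
  then show "(hweight :: real^'n \<Rightarrow> real) \<in> borel_measurable lebesgue" by (auto intro!: measurable_completion)
qed

text \<open>Closability: Hardy's inequality and Fatou's lemma turn almost everywhere convergence to 0 of a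
  D-Cauchy sequence into convergence of D to 0.\<close>

lemma Cauchy_null_hweight:
  fixes \<psi> :: "nat \<Rightarrow> real^'n::finite \<Rightarrow> real"
  assumes n: "CARD('n) \<ge> 3" and t: "\<And>k. test_on (- {0}) (\<psi> k)"
    and cauchy: "\<And>e. e > 0 \<Longrightarrow> \<exists>N. \<forall>m\<ge>N. \<forall>k\<ge>N. Dir (\<lambda>x. \<psi> m x - \<psi> k x) < e"
    and lim: "AE x in lebesgue. (\<lambda>k. \<psi> k x) \<longlonglongrightarrow> 0" and e: "e > 0"
  shows "\<exists>N. \<forall>m\<ge>N. (\<integral>x. hweight x * (\<psi> m x)\<^sup>2 \<partial>lebesgue) \<le> e"
proof -
  define c where "c = ((real CARD('n) - 2) / 2)\<^sup>2"
  \<comment> \<open>The constant in Hardy's inequality is positive because n >= 3; in dimension 2 it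
    would vanish.\<close>
  have c: "c > 0" using n by (simp add: c_def)
  obtain N where N: "\<And>m k. m \<ge> N \<Longrightarrow> k \<ge> N \<Longrightarrow> Dir (\<lambda>x. \<psi> m x - \<psi> k x) < c * e"
    using cauchy[of "c * e"] c e by auto
  have hm [measurable]: "(hweight :: real^'n \<Rightarrow> real) \<in> borel_measurable lebesgue" by (rule hweight_measurable)
  have \<psi>m [measurable]: "\<psi> k \<in> borel_measurable lebesgue" for k using test_on_L2[OF t] by (simp add: L2_def)
  have "(\<integral>x. hweight x * (\<psi> m x)\<^sup>2 \<partial>lebesgue) \<le> e" if m: "m \<ge> N" for m
  proof -
    have td: "test_on (- {0}) (\<lambda>x. \<psi> m x - \<psi> k x)" for k by (intro test_on_diff t)
    define F where "F k x = hweight x * (\<psi> m x - \<psi> k x)\<^sup>2" for k x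
    have Fi: "integrable lebesgue (F k)" for k unfolding F_def by (rule Hardy_inequality(2)[OF td])
    have Fn: "F k x \<ge> 0" for k x by (simp add: F_def hweight_nonneg)
    have Fle: "(\<integral>x. F k x \<partial>lebesgue) \<le> e" if "k \<ge> N" for k
    proof -
      have "c * (\<integral>x. F k x \<partial>lebesgue) \<le> c * e"
        using Hardy_inequality(1)[OF td, of k] N[OF m that] test_on_H12(2)[OF td, of k]
        by (simp add: F_def c_def)
      then show ?thesis using c by simp
    qed
    \<comment> \<open>With m fixed, Fatou's lemma is applied as k grows: \<open>F k\<close> tends to
      the weighted square of \<open>\<psi> m\<close> almost everywhere.\<close>
    have "(\<integral>\<^sup>+x. ennreal (hweight x * (\<psi> m x)\<^sup>2) \<partial>lebesgue) = (\<integral>\<^sup>+x. liminf (\<lambda>k. ennreal (F k x)) \<partial>lebesgue)"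
    proof (rule nn_integral_cong_AE)
      show "AE x in lebesgue. ennreal (hweight x * (\<psi> m x)\<^sup>2) = liminf (\<lambda>k. ennreal (F k x))"
        using lim
      proof eventually_elim
        case (elim x)
        have "(\<lambda>k. F k x) \<longlonglongrightarrow> hweight x * (\<psi> m x - 0)\<^sup>2"
          unfolding F_def by (intro tendsto_intros elim)
        then have "(\<lambda>k. ennreal (F k x)) \<longlonglongrightarrow> ennreal (hweight x * (\<psi> m x)\<^sup>2)"
          by (intro tendsto_ennrealI) simp
        then show ?case by (simp add: lim_imp_Liminf)
      qed
    qed
    also have "\<dots> \<le> liminf (\<lambda>k. \<integral>\<^sup>+x. ennreal (F k x) \<partial>lebesgue)"
      by (rule nn_integral_liminf) (simp add: F_def)
    also have "\<dots> \<le> ennreal e"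
    proof -
      have "\<forall>\<^sub>F k in sequentially. (\<integral>\<^sup>+x. ennreal (F k x) \<partial>lebesgue) \<le> ennreal e"
      proof (rule eventually_sequentiallyI[of N])
        fix k assume "N \<le> k"
        then show "(\<integral>\<^sup>+x. ennreal (F k x) \<partial>lebesgue) \<le> ennreal e"
          using nn_integral_eq_integral[OF Fi[of k]] Fn Fle[of k] by (simp add: ennreal_leI)
      qed
      then have "liminf (\<lambda>k. \<integral>\<^sup>+x. ennreal (F k x) \<partial>lebesgue) \<le> liminf (\<lambda>k::nat. ennreal e)"
        by (rule Liminf_mono)
      then show ?thesis by (simp add: Liminf_const)
    qed
    finally have le: "(\<integral>\<^sup>+x. ennreal (hweight x * (\<psi> m x)\<^sup>2) \<partial>lebesgue) \<le> ennreal e" .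
    have "(\<integral>\<^sup>+x. ennreal (hweight x * (\<psi> m x)\<^sup>2) \<partial>lebesgue) = ennreal (\<integral>x. hweight x * (\<psi> m x)\<^sup>2 \<partial>lebesgue)"
      by (rule nn_integral_eq_integral[OF Hardy_inequality(2)[OF t]]) (simp add: hweight_nonneg)
    with le show ?thesis using e by (simp add: ennreal_le_iff)
  qed
  then show ?thesis by blast
qed

text \<open>Since |a|^2 <= |a - b|^2 + 2 (a . b), it suffices to make the mixed term of the
  gradients of \<open>\<psi> k\<close> and \<open>\<psi> m\<close> small. By parts it is minus the
  integral of the Laplacian of \<open>\<psi> k\<close> times \<open>\<psi> m\<close>, and for fixed
  k it tends to 0 because \<open>\<psi> m\<close> tends to 0 in the Hardy-weighted norm.\<close>

lemma Cauchy_null_test: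
  fixes \<psi> :: "nat \<Rightarrow> real^'n::finite \<Rightarrow> real"
  assumes n: "CARD('n) \<ge> 3" and t: "\<And>k. test_on (- {0}) (\<psi> k)"
    and cauchy: "\<And>e. e > 0 \<Longrightarrow> \<exists>N. \<forall>m\<ge>N. \<forall>k\<ge>N. Dir (\<lambda>x. \<psi> m x - \<psi> k x) < e"
    and lim: "AE x in lebesgue. (\<lambda>k. \<psi> k x) \<longlonglongrightarrow> 0"
  shows "(\<lambda>k. Dir (\<psi> k)) \<longlonglongrightarrow> 0"
proof (rule LIMSEQ_I)
  fix e :: real assume e: "e > 0"
  obtain N where N: "\<And>m k. m \<ge> N \<Longrightarrow> k \<ge> N \<Longrightarrow> Dir (\<lambda>x. \<psi> m x - \<psi> k x) < e/3"
    using cauchy[of "e/3"] e by auto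
  have "Dir (\<psi> k) < e" if k: "k \<ge> N" for k
  proof -
    \<comment> \<open>L is the Laplacian of \<open>\<psi> k\<close>.\<close>
    define L where "L x = (\<Sum>i\<in>UNIV. partial_deriv i (partial_deriv i (\<psi> k)) x)" for x
    have tk: "test_on (- {0}) (partial_deriv i (\<psi> k))" for i by (intro test_on_partial_deriv t)
    have tkk: "test_on (- {0}) (partial_deriv i (partial_deriv i (\<psi> k)))" for i by (intro test_on_partial_deriv t)
    have Lc: "cont_compact L" unfolding L_def
      by (intro cont_compact_sum test_on_cont_compact[OF tkk]) auto
    \<comment> \<open>The weight |x|^2 is dual to the Hardy weight in the Cauchy-Schwarz
      sense.\<close>
    define A where "A = (\<integral>x. (L x)\<^sup>2 * (norm x)\<^sup>2 \<partial>lebesgue)"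
    have Ai: "integrable lebesgue (\<lambda>x. (L x)\<^sup>2 * (norm x)\<^sup>2)"
    proof -
      have "cont_compact (\<lambda>x. (L x * (norm x)\<^sup>2) * L x)"
        using Lc unfolding cont_compact_def
        by (intro cont_compact_mult[unfolded cont_compact_def]) (auto intro!: continuous_intros)
      from cont_compact_integrable(2)[OF this] show ?thesis by (simp add: power2_eq_square mult_ac)
    qed
    have A0: "A \<ge> 0" by (simp add: A_def)
    \<comment> \<open>The parameter for Young's inequality depends on k through A; therefore m is
      chosen only afterwards. The denominator A + 1 avoids division by 0.\<close>
    define s where "s = (e/3) / (A + 1)"
    have s: "s > 0" "s * A \<le> e/3" using e A0 by (auto simp: s_def field_simps)
    obtain M where M: "\<And>m. m \<ge> M \<Longrightarrow> (\<integral>x. hweight x * (\<psi> m x)\<^sup>2 \<partial>lebesgue) \<le> s * (e/3)"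
      using Cauchy_null_hweight[OF n t cauchy lim, of "s * (e/3)"] s e by auto
    define m where "m = max M N"
    have mN: "m \<ge> M" "m \<ge> N" by (auto simp: m_def)
    have gL: "L2 (grad (\<psi> j))" for j by (rule test_on_L2_grad[OF t])
    have ip: "integrable lebesgue (\<lambda>x. \<psi> m x * partial_deriv i (partial_deriv i (\<psi> k)) x)" for i
      by (intro L2_mult_integrable test_on_L2[OF t] test_on_L2[OF tkk])
    have ip2: "integrable lebesgue (\<lambda>x. partial_deriv i (\<psi> m) x * partial_deriv i (\<psi> k) x)" for i
      by (intro L2_mult_integrable test_on_L2[OF tk] test_on_L2[OF test_on_partial_deriv[OF t]])
    have parts: "(\<integral>x. grad (\<psi> k) x \<bullet> grad (\<psi> m) x \<partial>lebesgue) = - (\<integral>x. L x * \<psi> m x \<partial>lebesgue)"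
    proof -
      have "(\<integral>x. \<psi> m x * partial_deriv i (partial_deriv i (\<psi> k)) x \<partial>lebesgue) = - (\<integral>x. partial_deriv i (\<psi> m) x * partial_deriv i (\<psi> k) x \<partial>lebesgue)" for i
        using smooth_weak_gradient[OF test_on_smooth[OF t[of m]]] test_on_mono[OF tk[of i], of UNIV]
        unfolding weak_gradient_def test_fun_iff by simp
      moreover have "(\<integral>x. L x * \<psi> m x \<partial>lebesgue) = (\<Sum>i\<in>UNIV. \<integral>x. \<psi> m x * partial_deriv i (partial_deriv i (\<psi> k)) x \<partial>lebesgue)"
      proof -
        have "L x * \<psi> m x = (\<Sum>i\<in>UNIV. \<psi> m x * partial_deriv i (partial_deriv i (\<psi> k)) x)" for x
          by (simp add: L_def sum_distrib_left mult.commute[of _ "\<psi> m x"])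
        then show ?thesis using ip by simp
      qed
      moreover have "(\<integral>x. grad (\<psi> k) x \<bullet> grad (\<psi> m) x \<partial>lebesgue) = (\<Sum>i\<in>UNIV. \<integral>x. partial_deriv i (\<psi> m) x * partial_deriv i (\<psi> k) x \<partial>lebesgue)"
      proof -
        have "grad (\<psi> k) x \<bullet> grad (\<psi> m) x = (\<Sum>i\<in>UNIV. partial_deriv i (\<psi> m) x * partial_deriv i (\<psi> k) x)" for x
          by (simp add: inner_vec_def mult.commute)
        then show ?thesis using ip2 by simp
      qed
      ultimately show ?thesis by (simp add: sum_negf)
    qed
    have iLp: "integrable lebesgue (\<lambda>x. L x * \<psi> m x)"
      by (intro L2_mult_integrable test_on_L2[OF t] cont_compact_L2 Lc)
    have hi: "integrable lebesgue (\<lambda>x. hweight x * (\<psi> m x)\<^sup>2)" by (rule Hardy_inequality(2)[OF t])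
    have "- 2 * (\<integral>x. L x * \<psi> m x \<partial>lebesgue) = (\<integral>x. - 2 * (L x * \<psi> m x) \<partial>lebesgue)" using iLp by simp
    also have "\<dots> \<le> (\<integral>x. s * ((L x)\<^sup>2 * (norm x)\<^sup>2) + (1/s) * (hweight x * (\<psi> m x)\<^sup>2) \<partial>lebesgue)"
    proof (rule integral_mono)
      fix x
      show "- 2 * (L x * \<psi> m x) \<le> s * ((L x)\<^sup>2 * (norm x)\<^sup>2) + (1/s) * (hweight x * (\<psi> m x)\<^sup>2)"
      proof (cases "x = 0")
        case True
        have "\<psi> m x = 0" using t[of m] True unfolding test_on_def by blast
        then show ?thesis using True by simp
      next
        case False
        \<comment> \<open>Young's inequality for the factors \<open>L x * norm x\<close> and
          \<open>\<psi> m x / norm x\<close>, whose product is free of the weight.\<close>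
        have "0 \<le> (1/s) * (s * (L x * norm x) + \<psi> m x / norm x)\<^sup>2" using s by simp
        also have "\<dots> = s * ((L x)\<^sup>2 * (norm x)\<^sup>2) + 2 * (L x * \<psi> m x) + (1/s) * (hweight x * (\<psi> m x)\<^sup>2)"
          using s False by (simp add: hweight_def power2_eq_square field_simps)
        finally show ?thesis by linarith
      qed
    qed (use iLp hi Ai in auto)
    also have "\<dots> = s * A + (1/s) * (\<integral>x. hweight x * (\<psi> m x)\<^sup>2 \<partial>lebesgue)"
      using hi Ai by (simp add: A_def)
    also have "\<dots> \<le> e/3 + (1/s) * (s * (e/3))"
      using s M[OF mN(1)] by (intro add_mono mult_left_mono) auto
    finally have cross: "- 2 * (\<integral>x. L x * \<psi> m x \<partial>lebesgue) \<le> 2 * (e/3)" using s by simp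
    have "nsq (grad (\<psi> k)) \<le> (\<integral>x. (norm (grad (\<psi> k) x - grad (\<psi> m) x))\<^sup>2 + 2 * (grad (\<psi> k) x \<bullet> grad (\<psi> m) x) \<partial>lebesgue)"
      unfolding nsq_def
    proof (rule integral_mono)
      show "(norm (grad (\<psi> k) x))\<^sup>2 \<le> (norm (grad (\<psi> k) x - grad (\<psi> m) x))\<^sup>2 + 2 * (grad (\<psi> k) x \<bullet> grad (\<psi> m) x)" for x
        unfolding power2_norm_eq_inner by (simp add: inner_diff inner_commute)
    qed (use L2_inner_integrable[OF gL gL] L2_diff[OF gL gL] gL in \<open>auto simp: L2_def\<close>)
    also have "\<dots> = nsq (\<lambda>x. grad (\<psi> k) x - grad (\<psi> m) x) + 2 * (\<integral>x. grad (\<psi> k) x \<bullet> grad (\<psi> m) x \<partial>lebesgue)"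
      unfolding nsq_def using L2_inner_integrable[OF gL gL] L2_integrable[OF L2_diff[OF gL gL]] by simp
    also have "nsq (\<lambda>x. grad (\<psi> k) x - grad (\<psi> m) x) = Dir (\<lambda>x. \<psi> k x - \<psi> m x)"
      by (intro Dir_eq_nsq[symmetric] L2_diff gL weak_gradient_diff test_on_L2[OF t] smooth_weak_gradient[OF test_on_smooth[OF t]])
    finally have "Dir (\<psi> k) \<le> Dir (\<lambda>x. \<psi> k x - \<psi> m x) + 2 * (\<integral>x. grad (\<psi> k) x \<bullet> grad (\<psi> m) x \<partial>lebesgue)"
      using test_on_H12(2)[OF t] by simp
    then show ?thesis using cross N[OF k mN(2)] unfolding parts by linarith
  qed
  then show "\<exists>no. \<forall>k\<ge>no. norm (Dir (\<psi> k) - 0) < e"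
  proof (intro exI allI impI)
    fix k assume "N \<le> k"
    then show "norm (Dir (\<psi> k) - 0) < e"
      using Dir_nonneg[of "\<psi> k"] \<open>\<And>k. N \<le> k \<Longrightarrow> Dir (\<psi> k) < e\<close> by simp
  qed
qed

text \<open>The squares have summable integrals, so their sum is finite almost everywhere and its
  terms tend to 0. With geometric decay no subsequence has to be extracted.\<close>

lemma AE_tendsto_0_of_nsq:
  fixes h :: "nat \<Rightarrow> 'a::euclidean_space \<Rightarrow> real"
  assumes L: "\<And>k. L2 (h k)" and b: "\<And>k. nsq (h k) \<le> (1/2) ^ k"
  shows "AE x in lebesgue. (\<lambda>k. h k x) \<longlonglongrightarrow> 0"
proof -
  have [measurable]: "h k \<in> borel_measurable lebesgue" for k using L by (simp add: L2_def)
  have i: "integrable lebesgue (\<lambda>x. (h k x)\<^sup>2)" for k using L by (simp add: L2_real_iff)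
  have "(\<integral>\<^sup>+x. (\<Sum>k. ennreal ((h k x)\<^sup>2)) \<partial>lebesgue) = (\<Sum>k. \<integral>\<^sup>+x. ennreal ((h k x)\<^sup>2) \<partial>lebesgue)"
    by (rule nn_integral_suminf) measurable
  also have "\<dots> = (\<Sum>k. ennreal (nsq (h k)))"
    by (simp add: nsq_real nn_integral_eq_integral[OF i])
  also have "\<dots> \<le> (\<Sum>k. ennreal ((1/2) ^ k))"
    by (intro suminf_le ennreal_leI b) auto
  finally have le: "(\<integral>\<^sup>+x. (\<Sum>k. ennreal ((h k x)\<^sup>2)) \<partial>lebesgue) \<le> (\<Sum>k. ennreal ((1/2) ^ k))" .
  have "(\<Sum>k. ennreal ((1/2) ^ k)) \<noteq> top" by (rule ennreal_suminf_neq_top) auto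
  with le have "(\<integral>\<^sup>+x. (\<Sum>k. ennreal ((h k x)\<^sup>2)) \<partial>lebesgue) \<noteq> \<infinity>"
    by (metis infinity_ennreal_def top_unique)
  then have "AE x in lebesgue. (\<Sum>k. ennreal ((h k x)\<^sup>2)) \<noteq> \<infinity>"
    by (intro nn_integral_PInf_AE) measurable
  then show ?thesis
  proof eventually_elim
    case (elim x)
    then have "summable (\<lambda>k. (h k x)\<^sup>2)" by (intro summable_suminf_not_top) auto
    then have "(\<lambda>k. (h k x)\<^sup>2) \<longlonglongrightarrow> 0" by (rule summable_LIMSEQ_zero)
    then show ?case by (simp add: power_tendsto_0_iff)
  qed
qed

section \<open>Approximating sequences and independence of their choice\<close>

lemma real_sqrt_less_of_power2: "r > 0 \<Longrightarrow> d < r\<^sup>2 \<Longrightarrow> sqrt d < r"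
  by (metis real_sqrt_less_iff real_sqrt_abs abs_of_pos)

lemma approx_seq_Cauchy:
  assumes "\<And>k. f k \<in> H12" "\<And>k. f' k \<in> H12"
    and "\<And>e. e > 0 \<Longrightarrow> \<exists>N. \<forall>m\<ge>N. \<forall>k\<ge>N. Dir (\<lambda>x. f m x - f k x) < e"
    and "(\<lambda>k. Dir (\<lambda>x. f k x - f' k x)) \<longlonglongrightarrow> 0" and e: "e > 0"
  shows "\<exists>N. \<forall>m\<ge>N. \<forall>k\<ge>N. Dir (\<lambda>x. f' m x - f' k x) < e"
proof -
  define r where "r = sqrt e / 3"
  have r: "r > 0" using e by (simp add: r_def)
  obtain N1 where N1: "\<And>m k. m \<ge> N1 \<Longrightarrow> k \<ge> N1 \<Longrightarrow> Dir (\<lambda>x. f m x - f k x) < r\<^sup>2"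
    using assms(3)[of "r\<^sup>2"] r by auto
  have "\<forall>\<^sub>F k in sequentially. Dir (\<lambda>x. f k x - f' k x) < r\<^sup>2"
    using r by (intro order_tendstoD(2)[OF assms(4)]) simp
  then obtain N2 where N2: "\<And>k. k \<ge> N2 \<Longrightarrow> Dir (\<lambda>x. f k x - f' k x) < r\<^sup>2"
    by (auto simp: eventually_sequentially)
  have "Dir (\<lambda>x. f' m x - f' k x) < e" if m: "m \<ge> max N1 N2" and k: "k \<ge> max N1 N2" for m k
  proof -
    note sq = real_sqrt_less_of_power2[OF r]
    note H = assms(1,2) H12_diff
    let ?d = "\<lambda>x. f' m x - f' k x" and ?c = "\<lambda>x. f m x - f k x"
    let ?u = "\<lambda>x. f k x - f' k x" and ?v = "\<lambda>x. f m x - f' m x"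
    have "sqrt (Dir ?d) \<le> sqrt (Dir (\<lambda>x. ?d x - ?c x)) + sqrt (Dir ?c)"
      by (intro sqrt_Dir_triangle(1) H)
    \<comment> \<open>Regrouped so that only differences of members of \<open>H12\<close> occur: the
      errors at k and at m and the Cauchy difference each contribute less than r.\<close>
    also have "(\<lambda>x. ?d x - ?c x) = (\<lambda>x. ?u x - ?v x)" by auto
    also have "sqrt (Dir (\<lambda>x. ?u x - ?v x)) \<le> sqrt (Dir ?u) + sqrt (Dir ?v)"
      by (intro sqrt_Dir_triangle(2) H)
    finally have "sqrt (Dir ?d) < 3 * r"
      using sq[OF N1[of m k]] sq[OF N2[of k]] sq[OF N2[of m]] m k by simp
    then show ?thesis using e by (simp add: r_def)
  qed
  then show ?thesis by blast
qed

text \<open>Each member is replaced by a test function within 2^(-k) both in L2 and in D. The first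
  bound keeps the almost everywhere limit, the second the Cauchy property.\<close>

lemma approx_seq_test:
  fixes b :: "real^'n::finite \<Rightarrow> real"
  assumes n: "CARD('n) \<ge> 3" and f: "approx_seq b f"
  shows "\<exists>\<psi>. (\<forall>k. test_on (- {0}) (\<psi> k)) \<and> approx_seq b \<psi> \<and> (\<lambda>k. Dir (\<lambda>x. f k x - \<psi> k x)) \<longlonglongrightarrow> 0"
proof -
  have fH: "f k \<in> H12" for k using f by (simp add: approx_seq_def)
  have "\<exists>\<phi>. test_on (- {0}) \<phi> \<and> nsq (\<lambda>x. f k x - \<phi> x) < (1/2)^k \<and> Dir (\<lambda>x. f k x - \<phi> x) < (1/2)^k" for k
  proof -
    have "(1/2::real)^k > 0" by simp
    from H12_approx_test[OF n fH[of k] this] show ?thesis by blast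
  qed
  then have "\<forall>k. \<exists>\<phi>. test_on (- {0}) \<phi> \<and> nsq (\<lambda>x. f k x - \<phi> x) < (1/2)^k \<and> Dir (\<lambda>x. f k x - \<phi> x) < (1/2)^k"
    by (rule allI)
  from choice[OF this] obtain \<psi> where \<psi>: "\<And>k. test_on (- {0}) (\<psi> k)" "\<And>k. nsq (\<lambda>x. f k x - \<psi> k x) < (1/2)^k"
    "\<And>k. Dir (\<lambda>x. f k x - \<psi> k x) < (1/2)^k" by blast
  have H: "\<psi> k \<in> H12" for k using test_on_H12(1)[OF \<psi>(1)] .
  have D0: "(\<lambda>k. Dir (\<lambda>x. f k x - \<psi> k x)) \<longlonglongrightarrow> 0"
  proof (rule tendsto_sandwich[OF _ _ tendsto_const])
    show "(\<lambda>k. (1/2::real)^k) \<longlonglongrightarrow> 0" by (rule LIMSEQ_power_zero) simp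
    show "\<forall>\<^sub>F k in sequentially. Dir (\<lambda>x. f k x - \<psi> k x) \<le> (1/2)^k"
      by (rule always_eventually) (simp add: less_imp_le[OF \<psi>(3)])
  qed (simp add: Dir_nonneg)
  have "AE x in lebesgue. (\<lambda>k. f k x - \<psi> k x) \<longlonglongrightarrow> 0"
  proof (rule AE_tendsto_0_of_nsq)
    have "L2 (f k)" for k using fH[of k] unfolding H12_iff by blast
    then show "L2 (\<lambda>x. f k x - \<psi> k x)" for k by (intro L2_diff test_on_L2[OF \<psi>(1)])
    show "nsq (\<lambda>x. f k x - \<psi> k x) \<le> (1/2)^k" for k by (rule less_imp_le[OF \<psi>(2)])
  qed
  moreover have "AE x in lebesgue. (\<lambda>k. f k x) \<longlonglongrightarrow> b x" using f by (simp add: approx_seq_def)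
  ultimately have "AE x in lebesgue. (\<lambda>k. \<psi> k x) \<longlonglongrightarrow> b x"
  proof eventually_elim
    case (elim x)
    from tendsto_diff[OF elim(2,1)] show ?case by simp
  qed
  moreover have "\<exists>N. \<forall>m\<ge>N. \<forall>k\<ge>N. Dir (\<lambda>x. \<psi> m x - \<psi> k x) < e" if "e > 0" for e
    by (rule approx_seq_Cauchy[OF fH H _ D0 that]) (use f in \<open>auto simp: approx_seq_def\<close>)
  ultimately have "approx_seq b \<psi>" using H by (simp add: approx_seq_def)
  then show ?thesis using \<psi>(1) D0 by blast
qed

text \<open>Reverse triangle inequality for the seminorm given by the square root of
  \<open>Dir\<close>.\<close>

lemma tendsto_Dir_of_diff:
  assumes "\<And>k. f k \<in> H12" "\<And>k. f' k \<in> H12" "(\<lambda>k. Dir (\<lambda>x. f k x - f' k x)) \<longlonglongrightarrow> 0"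
    "(\<lambda>k. Dir (f k)) \<longlonglongrightarrow> l"
  shows "(\<lambda>k. Dir (f' k)) \<longlonglongrightarrow> l"
proof -
  have A: "\<bar>sqrt (Dir (f' k)) - sqrt (Dir (f k))\<bar> \<le> sqrt (Dir (\<lambda>x. f k x - f' k x))" for k
    using sqrt_Dir_triangle(1)[OF assms(1,2), of k k] sqrt_Dir_triangle(1)[OF assms(2,1), of k k]
    unfolding Dir_diff_commute[OF assms(2,1), of k k] by linarith
  have B: "(\<lambda>k. sqrt (Dir (\<lambda>x. f k x - f' k x))) \<longlonglongrightarrow> 0"
    using tendsto_real_sqrt[OF assms(3)] by simp
  have "(\<lambda>k. sqrt (Dir (f' k)) - sqrt (Dir (f k))) \<longlonglongrightarrow> 0"
    by (rule Lim_null_comparison[OF _ B]) (simp add: A always_eventually)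
  from tendsto_add[OF this tendsto_real_sqrt[OF assms(4)]]
  have "(\<lambda>k. sqrt (Dir (f' k))) \<longlonglongrightarrow> sqrt l" by simp
  from tendsto_power[OF this, of 2] have "(\<lambda>k. Dir (f' k)) \<longlonglongrightarrow> (sqrt l)\<^sup>2" by (simp add: Dir_nonneg)
  moreover have "l \<ge> 0" using assms(4) Dir_nonneg by (intro LIMSEQ_le_const) auto
  ultimately show ?thesis by simp
qed

lemma approx_seq_diff:
  assumes f: "approx_seq b f" and f': "approx_seq b f'"
  shows "approx_seq (\<lambda>x. 0) (\<lambda>k x. f k x - f' k x)"
  unfolding approx_seq_def
proof (intro conjI allI impI)
  have H: "f k \<in> H12" "f' k \<in> H12" for k using f f' by (auto simp: approx_seq_def)
  show "(\<lambda>x. f k x - f' k x) \<in> H12" for k by (intro H12_diff H)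
  have "AE x in lebesgue. (\<lambda>k. f k x) \<longlonglongrightarrow> b x" "AE x in lebesgue. (\<lambda>k. f' k x) \<longlonglongrightarrow> b x"
    using f f' by (auto simp: approx_seq_def)
  then show "AE x in lebesgue. (\<lambda>k. f k x - f' k x) \<longlonglongrightarrow> 0"
  proof eventually_elim
    case (elim x)
    from tendsto_diff[OF elim] show ?case by simp
  qed
  fix e :: real assume e: "e > 0"
  define r where "r = sqrt e / 2"
  have r: "r > 0" using e by (simp add: r_def)
  obtain N1 where N1: "\<And>m k. m \<ge> N1 \<Longrightarrow> k \<ge> N1 \<Longrightarrow> Dir (\<lambda>x. f m x - f k x) < r\<^sup>2"
    using f r unfolding approx_seq_def by (meson zero_less_power)
  obtain N2 where N2: "\<And>m k. m \<ge> N2 \<Longrightarrow> k \<ge> N2 \<Longrightarrow> Dir (\<lambda>x. f' m x - f' k x) < r\<^sup>2"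
    using f' r unfolding approx_seq_def by (meson zero_less_power)
  have "Dir (\<lambda>x. (f m x - f' m x) - (f k x - f' k x)) < e" if m: "m \<ge> max N1 N2" and k: "k \<ge> max N1 N2" for m k
  proof -
    have "(\<lambda>x. (f m x - f' m x) - (f k x - f' k x)) = (\<lambda>x. (f m x - f k x) - (f' m x - f' k x))" by auto
    then have "sqrt (Dir (\<lambda>x. (f m x - f' m x) - (f k x - f' k x))) \<le> sqrt (Dir (\<lambda>x. f m x - f k x)) + sqrt (Dir (\<lambda>x. f' m x - f' k x))"
      using sqrt_Dir_triangle(2)[OF H12_diff[OF H(1) H(1)] H12_diff[OF H(2) H(2)], of m k m k] by simp
    also have "\<dots> < 2 * r"
      using real_sqrt_less_of_power2[OF r N1[of m k]] real_sqrt_less_of_power2[OF r N2[of m k]] m k by simp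
    also have "2 * r = sqrt e" by (simp add: r_def)
    finally show ?thesis by simp
  qed
  then show "\<exists>N. \<forall>m\<ge>N. \<forall>k\<ge>N. Dir (\<lambda>x. (f m x - f' m x) - (f k x - f' k x)) < e" by blast
qed

text \<open>The difference of the two sequences approximates 0; once it is replaced by test
  functions supported off 0, closability applies.\<close>

lemma approx_seq_unique:
  fixes b :: "real^'n::finite \<Rightarrow> real"
  assumes n: "CARD('n) \<ge> 3" and f: "approx_seq b f" "approx_seq b f'"
  shows "(\<lambda>k. Dir (\<lambda>x. f k x - f' k x)) \<longlonglongrightarrow> 0"
proof -
  define h where "h k x = f k x - f' k x" for k x
  have h: "approx_seq (\<lambda>x. 0) h" unfolding h_def by (rule approx_seq_diff[OF f])
  obtain \<psi> where \<psi>: "\<And>k. test_on (- {0}) (\<psi> k)" "approx_seq (\<lambda>x. 0) \<psi>" "(\<lambda>k. Dir (\<lambda>x. h k x - \<psi> k x)) \<longlonglongrightarrow> 0"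
    using approx_seq_test[OF n h] by blast
  have H: "\<psi> k \<in> H12" "h k \<in> H12" for k using \<psi>(2) h by (auto simp: approx_seq_def)
  have "(\<lambda>k. Dir (\<psi> k)) \<longlonglongrightarrow> 0"
    by (rule Cauchy_null_test[OF n \<psi>(1)]) (use \<psi>(2) in \<open>auto simp: approx_seq_def\<close>)
  moreover have "(\<lambda>k. Dir (\<lambda>x. \<psi> k x - h k x)) \<longlonglongrightarrow> 0"
    using \<psi>(3) unfolding Dir_diff_commute[OF H(2,1)] .
  ultimately have "(\<lambda>k. Dir (h k)) \<longlonglongrightarrow> 0"
    using tendsto_Dir_of_diff[of \<psi> h 0] H by blast
  then show ?thesis by (simp add: h_def[abs_def])
qed

text \<open>Along the sequence chosen inside \<open>Dir_e\<close> the square roots of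
  \<open>Dir\<close> form a Cauchy sequence of reals, so the limit exists; uniqueness carries it
  over to f.\<close>

lemma tendsto_Dir_e:
  fixes b :: "real^'n::finite \<Rightarrow> real"
  assumes n: "CARD('n) \<ge> 3" and f: "approx_seq b f"
  shows "(\<lambda>k. Dir (f k)) \<longlonglongrightarrow> Dir_e b"
proof -
  define F where "F = (SOME f. approx_seq b f)"
  have F: "approx_seq b F" using someI[of "approx_seq b" f] f by (simp add: F_def)
  have FH: "F k \<in> H12" for k using F by (simp add: approx_seq_def)
  have "Cauchy (\<lambda>k. sqrt (Dir (F k)))"
  proof (rule CauchyI)
    fix e :: real assume e: "e > 0"
    obtain N where N: "\<And>m k. m \<ge> N \<Longrightarrow> k \<ge> N \<Longrightarrow> Dir (\<lambda>x. F m x - F k x) < e\<^sup>2"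
      using F e unfolding approx_seq_def by (meson zero_less_power)
    have "norm (sqrt (Dir (F m)) - sqrt (Dir (F k))) < e" if mk: "m \<ge> N" "k \<ge> N" for m k
    proof -
      have "sqrt (Dir (\<lambda>x. F m x - F k x)) < e"
        by (rule real_sqrt_less_of_power2[OF e N[OF mk]])
      then show ?thesis
        using sqrt_Dir_triangle(1)[OF FH FH, of m k] sqrt_Dir_triangle(1)[OF FH FH, of k m]
        unfolding Dir_diff_commute[OF FH FH, of k m] real_norm_def by linarith
    qed
    then show "\<exists>M. \<forall>m\<ge>M. \<forall>k\<ge>M. norm (sqrt (Dir (F m)) - sqrt (Dir (F k))) < e" by blast
  qed
  then obtain l where "(\<lambda>k. sqrt (Dir (F k))) \<longlonglongrightarrow> l" using Cauchy_convergent convergent_def by blast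
  from tendsto_power[OF this, of 2] have l: "(\<lambda>k. Dir (F k)) \<longlonglongrightarrow> l\<^sup>2" by (simp add: Dir_nonneg)
  then have "Dir_e b = l\<^sup>2" unfolding Dir_e_def F_def[symmetric] by (rule limI)
  with l have "(\<lambda>k. Dir (F k)) \<longlonglongrightarrow> Dir_e b" by simp
  then show ?thesis
    by (rule tendsto_Dir_of_diff[rotated 3]) (use approx_seq_unique[OF n F f] FH f in \<open>auto simp: approx_seq_def\<close>)
qed

section \<open>Change of variables for conformal maps\<close>

text \<open>Dividing by s gives an orthogonal map, whose determinant is 1 in absolute value.\<close>

lemma abs_det_conformal:
  fixes A :: "real^'n::finite \<Rightarrow> real^'n"
  assumes "linear A" "s > 0" "\<And>h. norm (A h) = s * norm h"
  shows "\<bar>det (matrix A)\<bar> = s ^ CARD('n)"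
proof -
  define B where "B h = (1/s) *\<^sub>R A h" for h
  have l: "linear B" unfolding B_def by (intro linear_compose_scale_right assms)
  then have "orthogonal_transformation B"
    unfolding orthogonal_transformation using assms by (simp add: B_def)
  then have d: "\<bar>det (matrix B)\<bar> = 1" by (rule orthogonal_transformation_det)
  have "matrix A = (\<chi> i. s *s (matrix B $ i))"
    using assms(2) by (simp add: matrix_def B_def vec_eq_iff)
  then have "det (matrix A) = s ^ CARD('n) * det (matrix B)"
    using det_rows_mul[of "\<lambda>_. s" "\<lambda>i. matrix B $ i"] by simp
  then show ?thesis using d assms(2) by (simp add: abs_mult)
qed

lemma conformal_change_of_variables_wellorder:
  fixes g :: "real^'m::{finite,wellorder} \<Rightarrow> real^'m::_" and F :: "real^'m::_ \<Rightarrow> real"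
  assumes S: "S \<in> sets lebesgue"
    and der: "\<And>x. x \<in> S \<Longrightarrow> (g has_derivative g' x) (at x within S)" and inj: "inj_on g S"
    and s: "\<And>x. x \<in> S \<Longrightarrow> s x > 0" and conf: "\<And>x h. x \<in> S \<Longrightarrow> norm (g' x h) = s x * norm h"
    and F: "integrable lebesgue F" "\<And>y. y \<notin> g ` S \<Longrightarrow> F y = 0"
  shows "(\<integral>x. indicator S x * (s x ^ CARD('m) * F (g x)) \<partial>lebesgue) = (\<integral>x. F x \<partial>lebesgue)"
proof -
  have det: "\<bar>det (matrix (g' x))\<bar> = s x ^ CARD('m)" if "x \<in> S" for x
    by (rule abs_det_conformal) (use der[OF that] s[OF that] conf[OF that] has_derivative_linear in auto)
  \<comment> \<open>The change of variables theorem concerns integrands with values in a coordinate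
    space, so F is viewed in \<open>real^1\<close>.\<close>
  define F1 :: "real^'m::_ \<Rightarrow> real^1" where "F1 y = vec (F y)" for y
  have F_ind: "(\<lambda>y. indicator (g ` S) y *\<^sub>R F y) = F" using F(2) by (force simp: indicator_def)
  have Fa: "F absolutely_integrable_on (g ` S)"
    unfolding set_integrable_def F_ind by (rule F(1))
  then have "F1 absolutely_integrable_on (g ` S)"
    by (simp add: absolutely_integrable_on_1_iff F1_def)
  then have *: "(\<lambda>x. \<bar>det (matrix (g' x))\<bar> *\<^sub>R F1 (g x)) absolutely_integrable_on S"
    "integral S (\<lambda>x. \<bar>det (matrix (g' x))\<bar> *\<^sub>R F1 (g x)) = integral (g ` S) F1"
    using has_absolute_integral_change_of_variables[OF S der inj, of F1 "integral (g ` S) F1"] by auto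
  let ?D = "\<lambda>x. \<bar>det (matrix (g' x))\<bar> * F (g x)"
  have D: "?D absolutely_integrable_on S" "integral S ?D = integral (g ` S) F"
    using * by (auto simp: absolutely_integrable_on_1_iff integral_on_1_eq F1_def vec_eq_iff)
  have "(\<integral>x. indicator S x * (s x ^ CARD('m) * F (g x)) \<partial>lebesgue) = (\<integral>x. indicator S x *\<^sub>R ?D x \<partial>lebesgue)"
    by (rule Bochner_Integration.integral_cong) (auto simp: det indicator_def)
  also have "\<dots> = integral S ?D"
    using set_lebesgue_integral_eq_integral(2)[OF D(1)] by (simp add: set_lebesgue_integral_def)
  also have "\<dots> = (\<integral>y. indicator (g ` S) y *\<^sub>R F y \<partial>lebesgue)"
    using set_lebesgue_integral_eq_integral(2)[OF Fa] D(2) by (simp add: set_lebesgue_integral_def)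
  finally show ?thesis unfolding F_ind .
qed

text \<open>The library proves the change of variables formula only for well-ordered index types. Any finite
  index type has a well-ordered copy, and the formula transfers along the coordinate relabelling.\<close>

typedef 'a wo = "UNIV :: 'a set" morphisms of_wo to_wo ..

lemma of_wo_to_wo [simp]: "of_wo (to_wo x) = x" "to_wo (of_wo y) = y"
  by (simp_all add: to_wo_inverse of_wo_inverse)

instance wo :: (finite) finite
proof
  have "(UNIV :: 'a wo set) = range to_wo" by (metis of_wo_to_wo(2) surj_def)
  then show "finite (UNIV :: 'a wo set)" by (metis finite finite_imageI)
qed

text \<open>Any injection into the naturals serves: the order pulled back along it is a
  well-order.\<close>

definition wo_index :: "'a::finite wo \<Rightarrow> nat" where
  "wo_index = (SOME f. inj f)"

lemma inj_wo_index: "inj wo_index"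
  unfolding wo_index_def using finite_imp_inj_to_nat_seg[of "UNIV :: 'a wo set"] by (metis finite someI_ex)

instantiation wo :: (finite) wellorder
begin

definition less_eq_wo :: "'a wo \<Rightarrow> 'a wo \<Rightarrow> bool" where "x \<le> y \<longleftrightarrow> wo_index x \<le> wo_index y"
definition less_wo :: "'a wo \<Rightarrow> 'a wo \<Rightarrow> bool" where "x < y \<longleftrightarrow> wo_index x < wo_index y"

instance
proof
  fix P :: "'a wo \<Rightarrow> bool" and a
  assume step: "\<And>x. (\<And>y. y < x \<Longrightarrow> P y) \<Longrightarrow> P x"
  show "P a"
    by (induction a rule: measure_induct_rule[of wo_index]) (use step in \<open>auto simp: less_wo_def\<close>)
qed (use inj_wo_index in \<open>auto simp: less_eq_wo_def less_wo_def inj_def\<close>)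

end

definition relabel :: "real^'n::finite \<Rightarrow> real^('n wo)" where
  "relabel x = (\<chi> i. x $ of_wo i)"

definition unlabel :: "real^('n::finite wo) \<Rightarrow> real^'n" where
  "unlabel y = (\<chi> j. y $ to_wo j)"

lemma relabel_unlabel [simp]: "relabel (unlabel y) = y" "unlabel (relabel x) = x"
  by (simp_all add: relabel_def unlabel_def vec_eq_iff)

lemma bij_to_wo: "bij to_wo"
  by (metis of_wo_to_wo bijI')

lemma CARD_wo: "CARD('n::finite wo) = CARD('n)"
  by (rule bij_betw_same_card[OF bij_to_wo, symmetric])

lemma linear_relabel: "linear relabel" "linear unlabel"
  by (rule linearI; simp add: relabel_def unlabel_def vec_eq_iff)+

lemma inner_unlabel: "unlabel x \<bullet> unlabel y = x \<bullet> y"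
proof -
  have "(\<Sum>j\<in>UNIV. x $ to_wo j \<bullet> y $ to_wo j) = (\<Sum>i\<in>UNIV. x $ i \<bullet> y $ i)"
    by (rule sum.reindex_bij_betw[OF bij_to_wo])
  then show ?thesis by (simp add: unlabel_def inner_vec_def)
qed

lemma norm_relabel: "norm (unlabel y) = norm y" "norm (relabel x) = norm x"
  using inner_unlabel[of y y] inner_unlabel[of "relabel x" "relabel x"] by (simp_all add: norm_eq_sqrt_inner)

lemma unlabel_Basis: "b \<in> Basis \<Longrightarrow> unlabel b \<in> Basis"
proof -
  assume "b \<in> Basis"
  then obtain i where "b = axis i 1" by (auto simp: Basis_vec_def)
  then have "unlabel b = axis (of_wo i) 1"
    by (auto simp: unlabel_def axis_def vec_eq_iff)
  then show ?thesis by (auto simp: Basis_vec_def)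
qed

lemma relabel_Basis: "b \<in> Basis \<Longrightarrow> relabel b \<in> Basis"
proof -
  assume "b \<in> Basis"
  then obtain i where "b = axis i 1" by (auto simp: Basis_vec_def)
  then have "relabel b = axis (to_wo i) 1"
    by (auto simp: relabel_def axis_def vec_eq_iff)
  then show ?thesis by (auto simp: Basis_vec_def)
qed

lemma continuous_relabel: "continuous_on T relabel" "continuous_on T' unlabel"
  using linear_relabel linear_continuous_on linear_conv_bounded_linear by blast+

lemma relabel_measurable [measurable]:
  "relabel \<in> borel_measurable borel" "unlabel \<in> borel_measurable borel"
  by (intro borel_measurable_continuous_onI continuous_relabel)+

text \<open>Lebesgue measure is determined by boxes, and the relabelling permutes the basis, so it
  maps boxes to boxes of the same volume.\<close>

lemma distr_lborel_relabel: "lborel = distr lborel borel (relabel :: real^'n::finite \<Rightarrow> _)"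
proof (rule lborel_eqI)
  fix l u :: "real^('n wo)"
  assume le: "\<And>b. b \<in> Basis \<Longrightarrow> l \<bullet> b \<le> u \<bullet> b"
  have ru: "relabel x \<bullet> b = x \<bullet> unlabel b" for x and b :: "real^('n wo)"
    using inner_unlabel[of "relabel x" b] by simp
  have ru': "l \<bullet> relabel b = unlabel l \<bullet> b" for b and l :: "real^('n wo)"
    using inner_unlabel[of l "relabel b"] by simp
  have "relabel -` box l u = box (unlabel l) (unlabel u)"
  proof (intro set_eqI iffI)
    fix x assume "x \<in> relabel -` box l u"
    then have "l \<bullet> relabel b < relabel x \<bullet> relabel b" "relabel x \<bullet> relabel b < u \<bullet> relabel b" if "b \<in> Basis" for b
      using relabel_Basis[OF that] by (auto simp: mem_box)
    then show "x \<in> box (unlabel l) (unlabel u)" by (auto simp: mem_box ru ru')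
  next
    fix x assume "x \<in> box (unlabel l) (unlabel u)"
    then have "unlabel l \<bullet> unlabel b < x \<bullet> unlabel b" "x \<bullet> unlabel b < unlabel u \<bullet> unlabel b" if "b \<in> Basis" for b
      using unlabel_Basis[OF that] by (auto simp: mem_box)
    then show "x \<in> relabel -` box l u" by (auto simp: mem_box ru inner_unlabel)
  qed
  then have "emeasure (distr lborel borel relabel) (box l u) = emeasure lborel (box (unlabel l) (unlabel u))"
    by (simp add: emeasure_distr)
  also have "\<dots> = (\<Prod>b\<in>Basis. (unlabel u - unlabel l) \<bullet> b)"
  proof (rule emeasure_lborel_box)
    show "unlabel l \<bullet> b \<le> unlabel u \<bullet> b" if "b \<in> Basis" for b
      using le[OF relabel_Basis[OF that]] by (simp add: ru')
  qed
  also have "(\<Prod>b\<in>Basis. (unlabel u - unlabel l) \<bullet> b) = (\<Prod>b\<in>Basis. (u - l) \<bullet> b)"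
    by (rule prod.reindex_bij_witness[of _ unlabel relabel])
      (auto simp: unlabel_Basis relabel_Basis inner_diff_left ru' linear_diff[OF linear_relabel(2)])
  finally show "emeasure (distr lborel borel relabel) (box l u) = (\<Prod>b\<in>Basis. (u - l) \<bullet> b)" .
qed simp

lemma lborel_integral_relabel:
  fixes H :: "real^'n::finite \<Rightarrow> real"
  assumes "H \<in> borel_measurable borel"
  shows "(\<integral>y. H (unlabel y) \<partial>lborel) = (\<integral>x. H x \<partial>lborel)"
    and "integrable lborel (\<lambda>y. H (unlabel y)) \<longleftrightarrow> integrable lborel H"
proof -
  have m: "(\<lambda>y. H (unlabel y)) \<in> borel_measurable borel" using assms by measurable
  have r: "relabel \<in> lborel \<rightarrow>\<^sub>M borel" by simp
  show "(\<integral>y. H (unlabel y) \<partial>lborel) = (\<integral>x. H x \<partial>lborel)"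
    using integral_distr[OF r m] unfolding distr_lborel_relabel[symmetric] by simp
  show "integrable lborel (\<lambda>y. H (unlabel y)) \<longleftrightarrow> integrable lborel H"
    using integrable_distr_eq[OF r m] unfolding distr_lborel_relabel[symmetric] by simp
qed

text \<open>The assumption \<open>meas\<close> is explicit because s carries no measurability of its
  own; it permits the passage between \<open>lebesgue\<close> and \<open>lborel\<close>, where the
  relabelling acts. In the application the integrand turns out to be continuous with compact
  support.\<close>

lemma conformal_change_of_variables:
  fixes g :: "real^'n::finite \<Rightarrow> real^'n" and F :: "real^'n \<Rightarrow> real"
  assumes S: "open S"
    and der: "\<And>x. x \<in> S \<Longrightarrow> (g has_derivative g' x) (at x)" and inj: "inj_on g S"
    and s: "\<And>x. x \<in> S \<Longrightarrow> s x > 0" and conf: "\<And>x h. x \<in> S \<Longrightarrow> norm (g' x h) = s x * norm h"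
    and F: "cont_compact F" "\<And>y. y \<notin> g ` S \<Longrightarrow> F y = 0"
    and meas: "(\<lambda>x. indicator S x * (s x ^ CARD('n) * F (g x))) \<in> borel_measurable borel"
  shows "(\<integral>x. indicator S x * (s x ^ CARD('n) * F (g x)) \<partial>lebesgue) = (\<integral>x. F x \<partial>lebesgue)"
proof -
  define S2 where "S2 = (unlabel :: _ \<Rightarrow> real^'n) -` S"
  define g2 where "g2 y = relabel (g (unlabel y))" for y
  define F2 where "F2 y = F (unlabel y)" for y
  have o: "open S2" unfolding S2_def by (intro open_vimage S continuous_relabel)
  have ind: "indicator S2 y = (indicator S (unlabel y) :: real)" for y by (simp add: S2_def indicator_def)
  have Fm: "F \<in> borel_measurable borel" using cont_compact_measurable[OF F(1)] .
  have F2m: "F2 \<in> borel_measurable borel" unfolding F2_def using Fm by measurable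
  let ?H = "\<lambda>x. indicator S x * (s x ^ CARD('n) * F (g x))"
  have "(\<integral>y. indicator S2 y * (s (unlabel y) ^ CARD('n wo) * F2 (g2 y)) \<partial>lebesgue) = (\<integral>y. F2 y \<partial>lebesgue)"
  proof (rule conformal_change_of_variables_wellorder)
    show "S2 \<in> sets lebesgue" using o by auto
    show "inj_on g2 S2"
      using inj by (auto simp: inj_on_def g2_def S2_def) (metis relabel_unlabel)
    show "integrable lebesgue F2"
      using integrable_completion[of F2 lborel] F2m cont_compact_integrable(1)[OF F(1)]
        lborel_integral_relabel(2)[OF Fm] by (simp add: F2_def[abs_def])
    show "F2 y = 0" if "y \<notin> g2 ` S2" for y
      unfolding F2_def
    proof (rule F(2), rule notI)
      assume "unlabel y \<in> g ` S"
      then obtain x where x: "x \<in> S" "unlabel y = g x" by blast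
      then have "y = g2 (relabel x)" "relabel x \<in> S2"
        by (auto simp: g2_def S2_def) (metis relabel_unlabel(1))
      then show False using that by blast
    qed
    fix y assume y: "y \<in> S2"
    then have x: "unlabel y \<in> S" by (simp add: S2_def)
    show "s (unlabel y) > 0" by (rule s[OF x])
    have u: "(unlabel has_derivative unlabel) (at y)"
      using linear_relabel(2) by (intro bounded_linear_imp_has_derivative) (simp add: linear_conv_bounded_linear)
    have r: "(relabel has_derivative relabel) (at (g (unlabel y)))"
      using linear_relabel(1) by (intro bounded_linear_imp_has_derivative) (simp add: linear_conv_bounded_linear)
    have "(g2 has_derivative (\<lambda>h. relabel (g' (unlabel y) (unlabel h)))) (at y)"
      unfolding g2_def by (rule has_derivative_compose[OF has_derivative_compose[OF u der[OF x]] r])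
    then show "(g2 has_derivative (\<lambda>h. relabel (g' (unlabel y) (unlabel h)))) (at y within S2)"
      by (rule has_derivative_at_withinI)
    show "norm (relabel (g' (unlabel y) (unlabel h))) = s (unlabel y) * norm h" for h
      by (simp add: norm_relabel conf[OF x])
  qed
  moreover have "(\<integral>y. indicator S2 y * (s (unlabel y) ^ CARD('n wo) * F2 (g2 y)) \<partial>lebesgue) = (\<integral>x. ?H x \<partial>lebesgue)"
  proof -
    have m2: "(\<lambda>y. ?H (unlabel y)) \<in> borel_measurable borel"
      using meas relabel_measurable(2) by (rule measurable_compose[rotated])
    have "(\<lambda>y. indicator S2 y * (s (unlabel y) ^ CARD('n wo) * F2 (g2 y))) = (\<lambda>y. ?H (unlabel y))"
      by (auto simp: ind CARD_wo F2_def g2_def)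
    then show ?thesis
      using integral_completion[of "\<lambda>y. ?H (unlabel y)" lborel] m2
        integral_completion[of ?H lborel] meas lborel_integral_relabel(1)[OF meas] by simp
  qed
  moreover have "(\<integral>y. F2 y \<partial>lebesgue) = (\<integral>x. F x \<partial>lebesgue)"
    using integral_completion[of F2 lborel] F2m integral_completion[of F lborel] Fm lborel_integral_relabel(1)[OF Fm]
    by (simp add: F2_def[abs_def])
  ultimately show ?thesis by simp
qed

section \<open>Conformal invariance\<close>

text \<open>Being s times an orthogonal map, A multiplies inner products by s^2. Writing v = A z
  gives u = s^2 z, while |v| = s |z|. It is used with v the gradient of \<phi> at g x and u that of
  the composition at x.\<close>

lemma conformal_adjoint:
  fixes A :: "real^'n::finite \<Rightarrow> real^'n"
  assumes A: "linear A" "s > 0" "\<And>h. norm (A h) = s * norm h" and uv: "\<And>h. u \<bullet> h = v \<bullet> A h"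
  shows "norm u = s * norm v"
proof -
  have "inj A"
    unfolding linear_injective_0[OF A(1)] using A(2,3) by (metis mult_eq_0_iff norm_eq_zero order_less_irrefl)
  then have "surj A" using linear_inj_imp_surj[OF A(1)] by blast
  then obtain z where z: "v = A z" by blast
  define B where "B h = (1/s) *\<^sub>R A h" for h
  have "linear B" unfolding B_def by (intro linear_compose_scale_right A)
  then have o: "orthogonal_transformation B"
    unfolding orthogonal_transformation using A by (simp add: B_def)
  have "A x = s *\<^sub>R B x" for x using A(2) by (simp add: B_def)
  then have "A x \<bullet> A y = s\<^sup>2 * (x \<bullet> y)" for x y
    using o by (simp add: orthogonal_transformation_def power2_eq_square)
  then have "u \<bullet> h = (s\<^sup>2 *\<^sub>R z) \<bullet> h" for h using uv z by simp
  then have "u = s\<^sup>2 *\<^sub>R z" using vector_eq_rdot by blast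
  then show ?thesis using A(2,3) z by (simp add: power2_eq_square)
qed

text \<open>The map g has inverse k and scales lengths infinitesimally by s; the weight w is the power
  s^((n-2)/2), whose harmonicity is what makes b |-> w * (b o g) a D-isometry.\<close>

locale conformal_change =
  fixes g k :: "real^'n::finite \<Rightarrow> real^'n" and S :: "(real^'n) set" and s w :: "real^'n \<Rightarrow> real"
  assumes dim: "CARD('n) \<ge> 3"
    and open_S: "open S" and null_S: "negligible (- S)"
    and inverse: "\<And>y. g (k y) = y" "\<And>x. k (g x) = x"
    and g_smooth: "\<And>j. smooth_on S (\<lambda>x. g x $ j)"
    and conf: "\<And>x h. x \<in> S \<Longrightarrow> norm (\<chi> j. grad (\<lambda>x. g x $ j) x \<bullet> h) = s x * norm h"
    and s_pos: "\<And>x. x \<in> S \<Longrightarrow> s x > 0"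
    and w_smooth: "smooth_on S w"
    and weight: "\<And>x. x \<in> S \<Longrightarrow> (w x * s x)\<^sup>2 = s x ^ CARD('n)"
    and harmonic: "\<And>x. x \<in> S \<Longrightarrow> (\<Sum>i\<in>UNIV. partial_deriv i (partial_deriv i w) x) = 0"
    and k_diff: "k differentiable_on (- {0})" and k_image: "k ` (- {0}) \<subseteq> S"
    and g_borel: "g \<in> borel_measurable borel"
begin

text \<open>The operator T. The locale assumption \<open>weight\<close> fixes w in the squared form
  w^2 s^2 = s^n, so that odd n calls for no fractional power of s.\<close>

definition pull :: "(real^'n \<Rightarrow> real) \<Rightarrow> real^'n \<Rightarrow> real" where
  "pull b x = w x * b (g x)"

text \<open>The exceptional set lies in the image of a null set under k, and differentiable maps
  preserve null sets. The point 0, where k need not be differentiable, contributes a single further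
  point.\<close>

lemma AE_pull:
  assumes "AE y in lebesgue. P y"
  shows "AE x in lebesgue. P (g x)"
proof -
  define N where "N = {y. \<not> P y}"
  have "negligible N"
    using assms by (simp add: completion.AE_iff_null_sets negligible_iff_null_sets N_def)
  then have "negligible (N - {0})" by (rule negligible_subset) auto
  then have "negligible (k ` (N - {0}))"
    by (rule negligible_differentiable_image_negligible[rotated])
      (auto intro: differentiable_on_subset[OF k_diff])
  then have "negligible (insert (k 0) (k ` (N - {0})))" by simp
  moreover have "{x. \<not> P (g x)} \<subseteq> insert (k 0) (k ` (N - {0}))"
  proof
    fix x assume "x \<in> {x. \<not> P (g x)}"
    then have "g x \<in> N" by (simp add: N_def)
    moreover have "x = k (g x)" by (simp add: inverse)
    ultimately show "x \<in> insert (k 0) (k ` (N - {0}))" by (metis DiffI image_eqI insert_iff empty_iff)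
  qed
  ultimately have "negligible {x. \<not> P (g x)}" by (rule negligible_subset)
  then show ?thesis by (simp add: completion.AE_iff_null_sets negligible_iff_null_sets)
qed

text \<open>Lebesgue measurable functions do not compose with Borel maps in general. Here a Borel
  representative composes, and \<open>AE_pull\<close> makes the set where the compositions differ
  null.\<close>

lemma measurable_pull:
  fixes a :: "real^'n \<Rightarrow> real"
  assumes "a \<in> borel_measurable lebesgue"
  shows "(\<lambda>x. a (g x)) \<in> borel_measurable lebesgue"
proof -
  obtain a' where a': "a' \<in> borel_measurable lborel" "AE x in lborel. a x = a' x"
    using completion_ex_borel_measurable_real[OF assms] by blast
  have "AE x in lebesgue. a x = a' x" using a'(2) by (rule AE_completion)
  from AE_pull[OF this] have N: "{x. a (g x) \<noteq> a' (g x)} \<in> null_sets lebesgue"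
    by (simp add: completion.AE_iff_null_sets)
  have "(\<lambda>x. a' (g x)) \<in> borel_measurable borel" using a'(1) g_borel by (auto intro: measurable_compose)
  then have m: "(\<lambda>x. a' (g x)) \<in> borel_measurable lebesgue" by (auto intro!: measurable_completion)
  show ?thesis
  proof (rule measurableI)
    fix B :: "real set" assume B: "B \<in> sets borel"
    let ?N = "{x. a (g x) \<noteq> a' (g x)}"
    have eq: "(\<lambda>x. a (g x)) -` B \<inter> space lebesgue = ((\<lambda>x. a' (g x)) -` B - ?N) \<union> ((\<lambda>x. a (g x)) -` B \<inter> ?N)"
      by auto
    have s1: "(\<lambda>x. a' (g x)) -` B \<in> sets lebesgue" using measurable_sets[OF m B] by simp
    have s2: "(\<lambda>x. a (g x)) -` B \<inter> ?N \<in> null_sets lebesgue"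
      by (rule completion.complete2[OF _ N]) auto
    show "(\<lambda>x. a (g x)) -` B \<inter> space lebesgue \<in> sets lebesgue"
      unfolding eq by (rule sets.Un[OF sets.Diff[OF s1 null_setsD2[OF N]] null_setsD2[OF s2]])
  qed simp
qed

lemma test_on_compose:
  assumes "test_on (- {0}) \<phi>"
  shows "test_on S (\<lambda>x. \<phi> (g x))"
proof -
  obtain K where K: "compact K" "K \<subseteq> - {0}" "\<And>x. x \<notin> K \<Longrightarrow> \<phi> x = 0"
    using assms by (auto simp: test_on_def)
  show ?thesis
  proof (rule test_onI[OF open_S])
    show "smooth_on S (\<lambda>x. \<phi> (g x))"
      by (rule smooth_on_compose[OF open_S _ test_on_smooth[OF assms] g_smooth]) simp
    \<comment> \<open>The new support: k is continuous off 0 and maps K into S.\<close>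
    show "compact (k ` K)"
      by (intro compact_continuous_image K continuous_on_subset[OF differentiable_imp_continuous_on[OF k_diff]])
    show "k ` K \<subseteq> S" using K(2) k_image by blast
    show "\<phi> (g x) = 0" if "x \<notin> k ` K" for x
      using that K(3)[of "g x"] inverse(2)[of x] by (metis image_eqI)
  qed
qed

lemma test_on_pull: "test_on (- {0}) \<phi> \<Longrightarrow> test_on S (pull \<phi>)"
  unfolding pull_def[abs_def] by (intro test_on_mult open_S test_on_compose w_smooth)

lemma g_has_derivative:
  assumes "x \<in> S"
  shows "(g has_derivative (\<lambda>h. \<chi> j. grad (\<lambda>x. g x $ j) x \<bullet> h)) (at x)"
  by (rule has_derivative_vec_grad) (rule smooth_on_differentiable[OF g_smooth assms])

lemma norm_grad_compose:
  assumes t: "test_on (- {0}) \<phi>" and x: "x \<in> S"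
  shows "norm (grad (\<lambda>x. \<phi> (g x)) x) = s x * norm (grad \<phi> (g x))"
proof (rule conformal_adjoint[OF has_derivative_linear[OF g_has_derivative[OF x]] s_pos[OF x] conf[OF x]])
  fix h
  have 1: "((\<lambda>x. \<phi> (g x)) has_derivative (\<lambda>h. grad \<phi> (g x) \<bullet> (\<chi> j. grad (\<lambda>x. g x $ j) x \<bullet> h))) (at x)"
    by (rule has_derivative_compose[OF g_has_derivative[OF x] has_derivative_grad[OF test_on_differentiable[OF t]]])
  have 2: "((\<lambda>x. \<phi> (g x)) has_derivative (\<lambda>h. grad (\<lambda>x. \<phi> (g x)) x \<bullet> h)) (at x)"
    by (rule has_derivative_grad[OF test_on_differentiable[OF test_on_compose[OF t]]])
  show "grad (\<lambda>x. \<phi> (g x)) x \<bullet> h = grad \<phi> (g x) \<bullet> (\<chi> j. grad (\<lambda>x. g x $ j) x \<bullet> h)"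
    using fun_cong[OF has_derivative_unique[OF 2 1], of h] .
qed

lemma Dir_pull:
  assumes t: "test_on (- {0}) \<phi>"
  shows "Dir (pull \<phi>) = Dir \<phi>"
proof -
  define u where "u x = \<phi> (g x)" for x
  define F where "F y = (norm (grad \<phi> y))\<^sup>2" for y
  have ut: "test_on S u" unfolding u_def[abs_def] by (rule test_on_compose[OF t])
  have us: "smooth_on S u" using test_on_smooth[OF ut] smooth_on_mono by blast
  \<comment> \<open>The components of the field in the divergence term; the trailing factor u makes
    each of them a test function although w is smooth on S only.\<close>
  define V where "V i x = (w x * partial_deriv i w x * u x) * u x" for i x
  have Vt: "test_on S (V i)" for i unfolding V_def
    by (intro test_on_mult open_S ut smooth_on_mult w_smooth smooth_on_partial_deriv us)
  have Wt: "test_on S (\<lambda>x. w x * partial_deriv i u x)" for i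
    by (intro test_on_mult open_S test_on_partial_deriv ut w_smooth)
  \<comment> \<open>The term w^2 |grad u|^2, written through test functions so that it is continuous
    with compact support on the whole space.\<close>
  define G where "G x = (\<Sum>i\<in>UNIV. (w x * partial_deriv i u x) * (w x * partial_deriv i u x))" for x
  have Gc: "cont_compact G" unfolding G_def
    by (intro cont_compact_sum cont_compact_mult test_on_cont_compact[OF Wt])
      (use test_on_cont_compact[OF Wt] in \<open>auto simp: cont_compact_def\<close>)
  have G_eq: "G x = indicator S x * (s x ^ CARD('n) * F (g x))" for x
  proof (cases "x \<in> S")
    case True
    have "(norm (grad u x))\<^sup>2 = (\<Sum>i\<in>UNIV. partial_deriv i u x * partial_deriv i u x)"
      by (simp add: power2_norm_eq_inner inner_vec_def)
    then have "G x = (w x)\<^sup>2 * (norm (grad u x))\<^sup>2"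
      by (simp add: G_def sum_distrib_left power2_eq_square[of "w x"] mult_ac)
    \<comment> \<open>The factor s^2 from the gradient and w^2 combine to the Jacobian s^n.\<close>
    also have "\<dots> = (w x * s x)\<^sup>2 * F (g x)"
      using norm_grad_compose[OF t True] by (simp add: u_def[abs_def] F_def power_mult_distrib)
    finally show ?thesis using weight[OF True] True by simp
  next
    case False
    have "w x * partial_deriv i u x = 0" for i
      using Wt[of i] False unfolding test_on_def by blast
    then have "G x = 0" by (simp only: G_def) simp
    then show ?thesis using False by simp
  qed
  have id: "(norm (grad (pull \<phi>) x))\<^sup>2 = G x + (\<Sum>i\<in>UNIV. partial_deriv i (V i) x)" if x: "x \<in> S" for x
  proof -
    have du: "u differentiable (at x)" by (rule test_on_differentiable[OF ut])
    have dw: "w differentiable (at x)" by (rule smooth_on_differentiable[OF w_smooth x])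
    have dpw: "partial_deriv i w differentiable (at x)" for i
      by (rule smooth_on_differentiable[OF smooth_on_partial_deriv[OF w_smooth] x])
    have p: "pull \<phi> = (\<lambda>x. w x * u x)" by (auto simp: pull_def u_def)
    have "grad (pull \<phi>) x = w x *\<^sub>R grad u x + u x *\<^sub>R grad w x"
      unfolding p by (rule grad_mult[OF dw du])
    then have 1: "(norm (grad (pull \<phi>) x))\<^sup>2 = (\<Sum>i\<in>UNIV. (w x * partial_deriv i u x + u x * partial_deriv i w x) * (w x * partial_deriv i u x + u x * partial_deriv i w x))"
      by (simp add: power2_norm_eq_inner inner_vec_def)
    have 2: "partial_deriv i (V i) x = (u x * partial_deriv i w x) * (u x * partial_deriv i w x)
        + 2 * (w x * partial_deriv i u x) * (u x * partial_deriv i w x)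
        + w x * (u x)\<^sup>2 * partial_deriv i (partial_deriv i w) x" for i
      unfolding V_def[abs_def]
      by (simp add: partial_deriv_mult differentiable_mult du dw dpw power2_eq_square algebra_simps)
    \<comment> \<open>The third summand adds up to w u^2 times the Laplacian of w, which is 0 on
      S.\<close>
    have "(\<Sum>i\<in>UNIV. partial_deriv i (V i) x) = (\<Sum>i\<in>UNIV. (u x * partial_deriv i w x) * (u x * partial_deriv i w x)
        + 2 * (w x * partial_deriv i u x) * (u x * partial_deriv i w x))"
      unfolding 2 sum.distrib[of "\<lambda>i. _ i + _ i"] sum_distrib_left[symmetric] harmonic[OF x] by simp
    then show ?thesis unfolding 1 G_def
      by (simp add: sum.distrib[symmetric] algebra_simps)
  qed
  have pt: "test_on S (pull \<phi>)" by (rule test_on_pull[OF t])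
  have AES: "AE x in lebesgue. x \<in> S"
    using null_S by (simp add: completion.AE_iff_null_sets negligible_iff_null_sets Compl_eq)
  have Gi: "integrable lebesgue G" by (rule cont_compact_integrable(2)[OF Gc])
  have Vi: "integrable lebesgue (partial_deriv i (V i))" for i
    by (rule cont_compact_integrable(2)[OF test_on_cont_compact[OF test_on_partial_deriv[OF Vt]]])
  have "Dir (pull \<phi>) = (\<integral>x. (norm (grad (pull \<phi>) x))\<^sup>2 \<partial>lebesgue)"
    using test_on_H12(2)[OF pt] by (simp add: nsq_def)
  also have "\<dots> = (\<integral>x. G x + (\<Sum>i\<in>UNIV. partial_deriv i (V i) x) \<partial>lebesgue)"
  proof (rule integral_cong_AE)
    show "AE x in lebesgue. (norm (grad (pull \<phi>) x))\<^sup>2 = G x + (\<Sum>i\<in>UNIV. partial_deriv i (V i) x)"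
      using AES by eventually_elim (rule id)
    show "(\<lambda>x. (norm (grad (pull \<phi>) x))\<^sup>2) \<in> borel_measurable lebesgue"
      using L2_integrable[OF test_on_L2_grad[OF pt]] by (rule borel_measurable_integrable)
    show "(\<lambda>x. G x + (\<Sum>i\<in>UNIV. partial_deriv i (V i) x)) \<in> borel_measurable lebesgue"
      by (intro borel_measurable_integrable Bochner_Integration.integrable_add Bochner_Integration.integrable_sum Gi Vi)
  qed
  also have "\<dots> = (\<integral>x. G x \<partial>lebesgue)"
    using Gi Vi by (simp add: integral_partial_deriv_test_lebesgue[OF Vt])
  also have "\<dots> = (\<integral>x. indicator S x * (s x ^ CARD('n) * F (g x)) \<partial>lebesgue)"
    using G_eq by simp
  also have "\<dots> = (\<integral>y. F y \<partial>lebesgue)"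
  proof (rule conformal_change_of_variables[OF open_S g_has_derivative _ s_pos conf])
    show "inj_on g S" using inverse(2) by (metis inj_onI)
    show "cont_compact F" unfolding F_def by (rule cont_compact_norm_grad_power2[OF t])
    show "F y = 0" if "y \<notin> g ` S" for y
    proof -
      \<comment> \<open>k maps nonzero points into S, so the image of S under g misses at most 0,
        and there the gradient of \<phi> is 0.\<close>
      have "y = 0" using that k_image inverse(1) by (metis ComplI image_eqI image_subset_iff singletonD)
      have "partial_deriv i \<phi> 0 = 0" for i
        using test_on_partial_deriv[OF t, of i] unfolding test_on_def by blast
      then show ?thesis using \<open>y = 0\<close> by (simp add: F_def power2_norm_eq_inner inner_vec_def)
    qed
    show "(\<lambda>x. indicator S x * (s x ^ CARD('n) * F (g x))) \<in> borel_measurable borel"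
      using cont_compact_measurable[OF Gc] G_eq by (metis (no_types, lifting) ext)
  qed
  also have "\<dots> = Dir \<phi>" using test_on_H12(2)[OF t] by (simp add: nsq_def F_def)
  finally show ?thesis .
qed

text \<open>Approximate b by test functions supported off 0. Their images are test functions at the
  same mutual distances in D, and they converge almost everywhere because null sets are
  preserved.\<close>

lemma pull_H12e:
  assumes "b \<in> H12e"
  shows "pull b \<in> H12e" "Dir_e (pull b) = Dir_e b"
proof -
  obtain f where "approx_seq b f" using assms by (auto simp: H12e_def)
  from approx_seq_test[OF dim this] obtain \<psi> where \<psi>: "\<And>k. test_on (- {0}) (\<psi> k)" "approx_seq b \<psi>"
    by blast
  have "approx_seq (pull b) (\<lambda>k. pull (\<psi> k))"
    unfolding approx_seq_def
  proof (intro conjI allI impI)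
    show "pull (\<psi> k) \<in> H12" for k using test_on_H12(1)[OF test_on_pull[OF \<psi>(1)]] .
    have d: "Dir (\<lambda>x. pull (\<psi> m) x - pull (\<psi> k) x) = Dir (\<lambda>x. \<psi> m x - \<psi> k x)" for m k
    proof -
      have "(\<lambda>x. pull (\<psi> m) x - pull (\<psi> k) x) = pull (\<lambda>x. \<psi> m x - \<psi> k x)"
        by (auto simp: pull_def right_diff_distrib)
      then show ?thesis using Dir_pull[OF test_on_diff[OF \<psi>(1) \<psi>(1)]] by simp
    qed
    show "\<exists>N. \<forall>m\<ge>N. \<forall>k\<ge>N. Dir (\<lambda>x. pull (\<psi> m) x - pull (\<psi> k) x) < e" if "e > 0" for e
      unfolding d using \<psi>(2) that by (simp add: approx_seq_def)
    have "AE y in lebesgue. (\<lambda>k. \<psi> k y) \<longlonglongrightarrow> b y" using \<psi>(2) by (simp add: approx_seq_def)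
    from AE_pull[OF this] show "AE x in lebesgue. (\<lambda>k. pull (\<psi> k) x) \<longlonglongrightarrow> pull b x"
      by eventually_elim (auto simp: pull_def intro: tendsto_mult_left)
  qed
  then show "pull b \<in> H12e" by (auto simp: H12e_def)
  have "(\<lambda>k. Dir (pull (\<psi> k))) \<longlonglongrightarrow> Dir_e (pull b)"
    by (rule tendsto_Dir_e[OF dim \<open>approx_seq (pull b) _\<close>])
  then have "(\<lambda>k. Dir (\<psi> k)) \<longlonglongrightarrow> Dir_e (pull b)" by (simp add: Dir_pull[OF \<psi>(1)])
  moreover have "(\<lambda>k. Dir (\<psi> k)) \<longlonglongrightarrow> Dir_e b" by (rule tendsto_Dir_e[OF dim \<psi>(2)])
  ultimately show "Dir_e (pull b) = Dir_e b" by (rule LIMSEQ_unique)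
qed

end

text \<open>\<open>approx_seq b\<close> sees b only through an almost everywhere limit, so the two
  predicates coincide and the choice inside \<open>Dir_e\<close> picks the same sequence.\<close>

lemma H12e_cong_AE:
  assumes "AE x in lebesgue. b x = c x"
  shows "b \<in> H12e \<longleftrightarrow> c \<in> H12e" "Dir_e b = Dir_e c"
proof -
  have "(AE x in lebesgue. (\<lambda>k. f k x) \<longlonglongrightarrow> b x) \<longleftrightarrow> (AE x in lebesgue. (\<lambda>k. f k x) \<longlonglongrightarrow> c x)" for f
    by (rule iffI; rule AE_mp[OF assms], rule AE_mp) auto
  then have "approx_seq b = approx_seq c" unfolding approx_seq_def[abs_def] by presburger
  then show "b \<in> H12e \<longleftrightarrow> c \<in> H12e" "Dir_e b = Dir_e c" by (simp_all add: H12e_def Dir_e_def)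
qed

text \<open>One pair of mutually inverse maps is read in both directions, each with its own weight.
  Reciprocity of the weights is asked only off 0, since the weight of the inversion takes the value
  0 at 0.\<close>

locale conformal_pair =
  A: conformal_change g k S s w + B: conformal_change k g S' s' w'
  for g k :: "real^'n::finite \<Rightarrow> real^'n" and S S' s s' w w' +
  assumes w_inverse: "\<And>x. x \<noteq> 0 \<Longrightarrow> w x * w' (g x) = 1" "\<And>y. y \<noteq> 0 \<Longrightarrow> w' y * w (k y) = 1"
begin

text \<open>Multiplication by a o g is conjugate to multiplication by a under the isometry A.pull with inverse B.pull.\<close>

lemma multiplier_compose:
  fixes a :: "real^'n \<Rightarrow> real"
  assumes a: "a \<in> multipliers"
  shows "(\<lambda>x. a (g x)) \<in> multipliers" "mult_norm (\<lambda>x. a (g x)) = mult_norm a"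
proof -
  have am: "(\<lambda>x. a x * b x) \<in> H12e" if "b \<in> H12e" for b using a that by (simp add: multipliers_def)
  have AB: "AE x in lebesgue. A.pull (\<lambda>y. a y * B.pull b y) x = a (g x) * b x" for b
    using AE_nonzero
  proof eventually_elim
    case (elim x)
    have "A.pull (\<lambda>y. a y * B.pull b y) x = (w x * w' (g x)) * (a (g x) * b x)"
      by (simp add: A.pull_def B.pull_def A.inverse)
    then show ?case by (simp add: w_inverse(1)[OF elim])
  qed
  have BA: "AE y in lebesgue. a y * B.pull (A.pull b) y = a y * b y" for b
    using AE_nonzero
  proof eventually_elim
    case (elim y)
    have "B.pull (A.pull b) y = (w' y * w (k y)) * b y"
      by (simp add: A.pull_def B.pull_def A.inverse)
    then show ?case by (simp add: w_inverse(2)[OF elim])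
  qed
  have H: "(\<lambda>x. a (g x) * b x) \<in> H12e" "Dir_e (\<lambda>x. a (g x) * b x) = Dir_e (\<lambda>y. a y * B.pull b y)"
    if b: "b \<in> H12e" for b
    using A.pull_H12e[OF am[OF B.pull_H12e(1)[OF b]]] H12e_cong_AE[OF AB[of b]] by auto
  have "a \<in> borel_measurable lebesgue" using a by (simp add: multipliers_def)
  then show "(\<lambda>x. a (g x)) \<in> multipliers"
    using H(1) A.measurable_pull by (simp add: multipliers_def)
  show "mult_norm (\<lambda>x. a (g x)) = mult_norm a"
    unfolding mult_norm_def
  proof (rule antisym)
    show "(SUP b\<in>{b \<in> H12e. Dir_e b \<le> 1}. ereal (sqrt (Dir_e (\<lambda>x. a (g x) * b x))))
      \<le> (SUP b\<in>{b \<in> H12e. Dir_e b \<le> 1}. ereal (sqrt (Dir_e (\<lambda>x. a x * b x))))"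
    proof (rule SUP_mono)
      fix b :: "real^'n \<Rightarrow> real" assume "b \<in> {b \<in> H12e. Dir_e b \<le> 1}"
      \<comment> \<open>The isometry keeps the unit ball, so every candidate b on the left has a
        candidate with equal value on the right.\<close>
      then have "B.pull b \<in> {b \<in> H12e. Dir_e b \<le> 1}"
        "Dir_e (\<lambda>x. a (g x) * b x) = Dir_e (\<lambda>y. a y * B.pull b y)"
        using B.pull_H12e H(2) by auto
      then show "\<exists>c\<in>{b \<in> H12e. Dir_e b \<le> 1}. ereal (sqrt (Dir_e (\<lambda>x. a (g x) * b x))) \<le> ereal (sqrt (Dir_e (\<lambda>x. a x * c x)))"
        by (intro bexI[of _ "B.pull b"]) simp_all
    qed
    show "(SUP b\<in>{b \<in> H12e. Dir_e b \<le> 1}. ereal (sqrt (Dir_e (\<lambda>x. a x * b x))))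
      \<le> (SUP b\<in>{b \<in> H12e. Dir_e b \<le> 1}. ereal (sqrt (Dir_e (\<lambda>x. a (g x) * b x))))"
    proof (rule SUP_mono)
      fix b :: "real^'n \<Rightarrow> real" assume "b \<in> {b \<in> H12e. Dir_e b \<le> 1}"
      then have b: "b \<in> H12e" "Dir_e b \<le> 1" by auto
      \<comment> \<open>The reverse inequality takes its witness from the inverse isometry; the two
        cancel almost everywhere.\<close>
      have "Dir_e (\<lambda>x. a (g x) * A.pull b x) = Dir_e (\<lambda>x. a x * b x)"
        using H(2)[OF A.pull_H12e(1)[OF b(1)]] H12e_cong_AE(2)[OF BA[of b]] by simp
      moreover have "A.pull b \<in> {b \<in> H12e. Dir_e b \<le> 1}" using A.pull_H12e[OF b(1)] b(2) by simp
      ultimately show "\<exists>c\<in>{b \<in> H12e. Dir_e b \<le> 1}. ereal (sqrt (Dir_e (\<lambda>x. a x * b x))) \<le> ereal (sqrt (Dir_e (\<lambda>x. a (g x) * c x)))"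
        by (intro bexI[of _ "A.pull b"]) simp_all
    qed
  qed
qed

end

section \<open>The generators of the Moebius group\<close>

text \<open>The weight is the constant s^((n-2)/2), so harmonicity is trivial.\<close>

lemma conformal_change_similarity:
  fixes A B :: "real^'n::finite \<Rightarrow> real^'n"
  assumes n: "CARD('n) \<ge> 3" and A: "linear A" and B: "linear B" and s: "s > 0" and conf: "\<And>h. norm (A h) = s * norm h"
    and inv: "\<And>x. B (A x) = x" "\<And>y. A (B y) = y"
  shows "conformal_change (\<lambda>x. A x + c) (\<lambda>y. B (y - c)) UNIV (\<lambda>x. s) (\<lambda>x. sqrt (s ^ CARD('n)) / s)"
proof
  \<comment> \<open>Each component is affine in the coordinates, hence smooth by the closure
    rules.\<close>
  have comp: "(\<lambda>x. (A x + c) $ j) = (\<lambda>x. (\<Sum>i\<in>UNIV. x $ i * A (axis i 1) $ j) + c $ j)" for j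
  proof (rule ext)
    fix x
    have "A x = A (\<Sum>i\<in>UNIV. x $ i *\<^sub>R axis i 1)"
      using basis_expansion[of x] by (simp add: scalar_mult_eq_scaleR)
    also have "\<dots> = (\<Sum>i\<in>UNIV. x $ i *\<^sub>R A (axis i 1))"
      by (simp add: linear_sum[OF A] linear_cmul[OF A])
    finally show "(A x + c) $ j = (\<Sum>i\<in>UNIV. x $ i * A (axis i 1) $ j) + c $ j"
      by simp
  qed
  show "smooth_on UNIV (\<lambda>x. (A x + c) $ j)" for j
    unfolding comp by (intro smooth_on_add smooth_on_sum smooth_on_mult smooth_on_const smooth_on_nth open_UNIV)
  have bA: "bounded_linear A" and bB: "bounded_linear B" using A B by (simp_all add: linear_conv_bounded_linear)
  show "norm (\<chi> j. grad (\<lambda>x. (A x + c) $ j) x \<bullet> h) = s * norm h" for x h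
  proof -
    have dA: "((\<lambda>x. A x + c) has_derivative A) (at x)"
      using bounded_linear_imp_has_derivative[OF bA] by (auto intro!: derivative_eq_intros)
    have "((\<lambda>x. A x + c) has_derivative (\<lambda>h. \<chi> j. grad (\<lambda>x. (A x + c) $ j) x \<bullet> h)) (at x)"
      by (rule has_derivative_vec_grad)
        (use bounded_linear.has_derivative[OF bounded_linear_vec_nth dA] in \<open>blast intro: differentiableI\<close>)
    from fun_cong[OF has_derivative_unique[OF this dA]] show ?thesis by (simp add: conf)
  qed
  have z: "partial_deriv i (\<lambda>x::real^'n. d) = (\<lambda>x. 0)" for i and d :: real
    by (auto intro!: ext simp: partial_deriv_eqI[OF has_derivative_const])
  show "(\<Sum>i\<in>UNIV. partial_deriv i (partial_deriv i (\<lambda>x. sqrt (s ^ CARD('n)) / s)) x) = 0" for x :: "real^'n"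
    by (simp add: z)
  show "(\<lambda>y. B (y - c)) differentiable_on - {0}"
    by (intro differentiable_at_imp_differentiable_on differentiableI[of _ B])
      (auto intro!: bounded_linear.has_derivative[OF bB, THEN has_derivative_eq_rhs] derivative_eq_intros)
  show "(\<lambda>x. A x + c) \<in> borel_measurable borel"
    by (intro borel_measurable_continuous_onI continuous_intros linear_continuous_on bA)
qed (use n s inv in \<open>auto simp: power_divide smooth_on_const\<close>)

text \<open>The pair is instantiated with the inverse of \<gamma> in the role of g, because a is
  composed with the inverse. That map is again a similarity, with factor 1/s and translation part -
  B c.\<close>

lemma multiplier_similarity:
  fixes A :: "real^'n::finite \<Rightarrow> real^'n" and c :: "real^'n"
  assumes n: "CARD('n) \<ge> 3" and A: "linear A" and s: "s > 0" and conf: "\<And>h. norm (A h) = s * norm h"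
    and a: "a \<in> multipliers"
  defines "\<gamma> \<equiv> \<lambda>x. A x + c"
  shows "bij \<gamma>" "a \<circ> inv \<gamma> \<in> multipliers" "mult_norm (a \<circ> inv \<gamma>) = mult_norm a"
proof -
  have "inj A"
    unfolding linear_injective_0[OF A] using s conf by (metis mult_eq_0_iff norm_eq_zero order_less_irrefl)
  then obtain B where B: "linear B" "\<And>x. B (A x) = x" "\<And>y. A (B y) = y"
    using linear_injective_isomorphism[OF A] by blast
  have Bconf: "norm (B h) = (1/s) * norm h" for h using conf[of "B h"] B(3)[of h] s by simp
  have 1: "(\<lambda>x. A (x - (- B c))) = \<gamma>"
    by (auto simp: \<gamma>_def linear_add[OF A] linear_diff[OF A] linear_neg[OF A] B(3))
  have 2: "(\<lambda>x. B (x - c)) = (\<lambda>x. B x + - B c)" by (auto simp: linear_diff[OF B(1)])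
  have left: "B (\<gamma> x - c) = x" and right: "\<gamma> (B (x - c)) = x" for x
    by (auto simp: \<gamma>_def B)
  have inv\<gamma>: "inv \<gamma> = (\<lambda>x. B (x - c))" by (rule inv_equality) (auto simp: left right)
  show "bij \<gamma>" using left right by (metis bijI')
  interpret conformal_pair "\<lambda>x. B (x - c)" \<gamma> UNIV UNIV "\<lambda>x. 1/s" "\<lambda>x. s"
    "\<lambda>x. sqrt ((1/s) ^ CARD('n)) / (1/s)" "\<lambda>x. sqrt (s ^ CARD('n)) / s"
  proof (intro conformal_pair.intro conformal_pair_axioms.intro)
    show "conformal_change (\<lambda>x. B (x - c)) \<gamma> UNIV (\<lambda>x. 1/s) (\<lambda>x. sqrt ((1/s) ^ CARD('n)) / (1/s))"
      unfolding 2 1[symmetric] by (rule conformal_change_similarity[OF n B(1) A]) (use s Bconf B in auto)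
    show "conformal_change \<gamma> (\<lambda>x. B (x - c)) UNIV (\<lambda>x. s) (\<lambda>x. sqrt (s ^ CARD('n)) / s)"
      unfolding \<gamma>_def by (rule conformal_change_similarity[OF n A B(1) s conf B(2,3)])
  qed (use s in \<open>auto simp: real_sqrt_divide power_divide\<close>)
  show "a \<circ> inv \<gamma> \<in> multipliers" "mult_norm (a \<circ> inv \<gamma>) = mult_norm a"
    using multiplier_compose[OF a] by (simp_all add: inv\<gamma> o_def)
qed

section \<open>The inversion and the Kelvin transform\<close>

lemma grad_inverse_norm_power:
  fixes x :: "real^'n::finite"
  assumes x: "x \<noteq> 0"
  shows "grad (\<lambda>x. inverse (norm x) ^ p) x = (- real p * inverse (norm x) ^ (p + 2)) *\<^sub>R x"
proof (rule grad_eqI)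
  have "(norm has_derivative (\<lambda>h. sgn x \<bullet> h)) (at x)"
    using x has_derivative_norm[of x] by (simp add: inner_commute)
  then have "((\<lambda>x. inverse (norm x) ^ p) has_derivative (\<lambda>h. of_nat p * (- (inverse (norm x) * (sgn x \<bullet> h) * inverse (norm x))) * inverse (norm x) ^ (p - 1))) (at x)"
    using x by (intro has_derivative_power Deriv.has_derivative_inverse) auto
  moreover have "of_nat p * (- (inverse (norm x) * (sgn x \<bullet> h) * inverse (norm x))) * inverse (norm x) ^ (p - 1)
      = ((- real p * inverse (norm x) ^ (p + 2)) *\<^sub>R x) \<bullet> h" for h
    \<comment> \<open>The case p = 0 is separate because of the truncated exponent
      \<open>p - 1\<close>.\<close>
    by (cases p) (simp_all add: sgn_div_norm power_Suc algebra_simps)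
  ultimately show "((\<lambda>x. inverse (norm x) ^ p) has_derivative (\<lambda>h. ((- real p * inverse (norm x) ^ (p + 2)) *\<^sub>R x) \<bullet> h)) (at x)"
    by (rule has_derivative_eq_rhs[OF _ ext])
qed

lemma partial_deriv_inverse_norm_power:
  "x \<noteq> 0 \<Longrightarrow> partial_deriv i (\<lambda>x. inverse (norm x) ^ p) x = (- real p * inverse (norm x) ^ (p + 2)) * x $ i"
  using arg_cong[OF grad_inverse_norm_power, of x "\<lambda>v. v $ i" p]
  by (simp only: grad_nth vector_scaleR_component real_scaleR_def simp_thms)

lemma smooth_on_inverse_norm_power: "smooth_on (- {0}) (\<lambda>x. inverse (norm x) ^ p)"
  by (intro smooth_on_power smooth_on_inverse smooth_on_norm) auto

text \<open>The Laplacian of |x|^(-p) is p (p + 2 - n) |x|^(-p-2), which vanishes for p = n -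
  2.\<close>

lemma inverse_norm_power_harmonic:
  fixes x :: "real^'n::finite"
  assumes x: "x \<noteq> 0" and n: "CARD('n) = p + 2"
  shows "(\<Sum>i\<in>UNIV. partial_deriv i (partial_deriv i (\<lambda>x. inverse (norm x) ^ p)) x) = 0"
proof -
  let ?r = "inverse (norm x)"
  have o: "open (- {0 :: real^'n})" by (intro open_Compl closed_singleton)
  have dr: "(\<lambda>x. inverse (norm x) ^ (p + 2)) differentiable (at x)"
    using smooth_on_differentiable[OF smooth_on_inverse_norm_power] x by auto
  have dn: "(\<lambda>x. x $ i) differentiable (at x)" for i using smooth_on_differentiable[OF smooth_on_nth] by blast
  have dc: "(\<lambda>x::real^'n. - real p) differentiable (at x)" by simp
  have pn: "partial_deriv i (\<lambda>x. x $ i) x = 1" for i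
    using partial_deriv_eqI[OF bounded_linear_imp_has_derivative[OF bounded_linear_vec_nth[of i]], of i x] by simp
  have pc: "partial_deriv i (\<lambda>x. - real p) x = 0" for i
    by (simp add: partial_deriv_eqI[OF has_derivative_const])
  have pr: "partial_deriv i (\<lambda>x. inverse (norm x) ^ (p + 2)) x = (- real (p + 2) * ?r ^ (p + 2 + 2)) * x $ i" for i
    by (rule partial_deriv_inverse_norm_power[OF x])
  have dd: "partial_deriv i (partial_deriv i (\<lambda>x. inverse (norm x) ^ p)) x
      = - real p * ?r ^ (p + 2) + real p * real (p + 2) * ?r ^ (p + 2 + 2) * (x $ i * x $ i)" for i
  proof -
    have "partial_deriv i (partial_deriv i (\<lambda>x. inverse (norm x) ^ p)) x
        = partial_deriv i (\<lambda>y. (- real p * inverse (norm y) ^ (p + 2)) * y $ i) x"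
      by (rule partial_deriv_cong_open(1)[OF o])
        (use x partial_deriv_inverse_norm_power in auto)
    also have "\<dots> = (- real p * ?r ^ (p + 2)) * 1
        + ((- real p) * ((- real (p + 2) * ?r ^ (p + 2 + 2)) * x $ i) + 0 * ?r ^ (p + 2)) * x $ i"
      unfolding partial_deriv_mult[OF differentiable_mult[OF dc dr] dn] partial_deriv_mult[OF dc dr] pn pc pr ..
    finally show ?thesis by (simp only: mult_zero_left add_0_right mult_1_right)
  qed
  have "(\<Sum>i\<in>UNIV. partial_deriv i (partial_deriv i (\<lambda>x. inverse (norm x) ^ p)) x)
      = - (real CARD('n) * real p * ?r ^ (p + 2)) + real p * real (p + 2) * ?r ^ (p + 2 + 2) * (x \<bullet> x)"
    unfolding dd sum.distrib sum_distrib_left[symmetric] by (simp add: inner_vec_def)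
  also have "real p * real (p + 2) * ?r ^ (p + 2 + 2) * (x \<bullet> x) = real p * real (p + 2) * ?r ^ (p + 2)"
  proof -
    have "?r ^ 2 * (x \<bullet> x) = 1" using x by (simp add: dot_square_norm flip: power_mult_distrib)
    then show ?thesis unfolding power_add[of ?r "p + 2" 2] by simp
  qed
  also have "- (real CARD('n) * real p * ?r ^ (p + 2)) + real p * real (p + 2) * ?r ^ (p + 2) = 0"
    unfolding n by (simp add: mult.assoc mult.left_commute)
  finally show ?thesis .
qed

definition inversion_map :: "real^'n::finite \<Rightarrow> real^'n" where
  "inversion_map x = x /\<^sub>R (norm x)\<^sup>2"

lemma inversion_map_involution: "inversion_map (inversion_map x) = x"
proof (cases "x = 0")
  case False
  then show ?thesis by (simp add: inversion_map_def power2_eq_square field_simps)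
qed (simp add: inversion_map_def)

lemma norm_inversion_map: "norm (inversion_map x) = inverse (norm x)"
  by (cases "x = 0") (simp_all add: inversion_map_def power2_eq_square)

lemma inversion_map_hweight: "inversion_map x = hweight x *\<^sub>R x"
  by (simp add: inversion_map_def hweight_def)

text \<open>The derivative at x is |x|^(-2) times the reflection in the hyperplane orthogonal to x,
  hence conformal with factor \<open>hweight x\<close>.\<close>

lemma conformal_change_inversion:
  assumes n: "CARD('n::finite) \<ge> 3"
  shows "conformal_change inversion_map (inversion_map :: real^'n \<Rightarrow> real^'n) (- {0}) hweight
    (\<lambda>x. inverse (norm x) ^ (CARD('n) - 2))"
proof
  let ?J = "inversion_map :: real^'n \<Rightarrow> real^'n"
  have o: "open (- {0 :: real^'n})" by (intro open_Compl closed_singleton)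
  show "open (- {0 :: real^'n})" by (rule o)
  show sm: "smooth_on (- {0}) (\<lambda>x. ?J x $ j)" for j
    unfolding inversion_map_hweight vector_scaleR_component real_scaleR_def
    by (intro smooth_on_mult o smooth_on_hweight smooth_on_nth)
  show "smooth_on (- {0}) (\<lambda>x::real^'n. inverse (norm x) ^ (CARD('n) - 2))"
    by (rule smooth_on_inverse_norm_power)
  show "?J differentiable_on - {0}"
  proof (rule differentiable_at_imp_differentiable_on)
    fix x :: "real^'n" assume "x \<in> - {0}"
    then have "\<And>j. (\<lambda>x. ?J x $ j) differentiable (at x)" using smooth_on_differentiable[OF sm] by blast
    from has_derivative_vec_grad[OF this] show "?J differentiable (at x)" by (rule differentiableI)
  qed
  show "?J \<in> borel_measurable borel" unfolding inversion_map_def[abs_def] by measurable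
  show "?J ` (- {0}) \<subseteq> - {0}" 
  proof (rule image_subsetI)
    fix x :: "real^'n" assume "x \<in> - {0}"
    then have "norm (?J x) \<noteq> 0" by (simp add: norm_inversion_map)
    then show "?J x \<in> - {0}" by auto
  qed
  fix x :: "real^'n" assume "x \<in> - {0}"
  then have x: "x \<noteq> 0" by simp
  then show "hweight x > 0" by (simp add: hweight_def)
  show "(\<Sum>i\<in>UNIV. partial_deriv i (partial_deriv i (\<lambda>x::real^'n. inverse (norm x) ^ (CARD('n) - 2))) x) = 0"
    by (rule inverse_norm_power_harmonic[OF x]) (use n in simp)
  show "(inverse (norm x) ^ (CARD('n) - 2) * hweight x)\<^sup>2 = hweight x ^ CARD('n)"
  proof -
    have h: "hweight x = inverse (norm x) ^ 2" by (simp add: hweight_def power_inverse)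
    have "inverse (norm x) ^ (CARD('n) - 2) * hweight x = inverse (norm x) ^ CARD('n)"
    proof -
      have "CARD('n) - 2 + 2 = CARD('n)" using n by simp
      then show ?thesis unfolding h power_add[symmetric] by (rule arg_cong)
    qed
    then show ?thesis unfolding h by (simp add: power_mult[symmetric] mult.commute)
  qed
  show "norm (\<chi> j. grad (\<lambda>x. ?J x $ j) x \<bullet> h) = hweight x * norm h" for h
  proof -
    have dq: "(hweight has_derivative (\<lambda>h. grad hweight x \<bullet> h)) (at x)"
      using smooth_on_differentiable[OF smooth_on_hweight] x by (intro has_derivative_grad) auto
    have d1: "(?J has_derivative (\<lambda>h. hweight x *\<^sub>R h + (grad hweight x \<bullet> h) *\<^sub>R x)) (at x)"
      unfolding inversion_map_hweight[abs_def] by (rule has_derivative_scaleR[OF dq has_derivative_ident])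
    have "\<And>j. (\<lambda>x. ?J x $ j) differentiable (at x)" using smooth_on_differentiable[OF sm] x by blast
    from has_derivative_unique[OF has_derivative_vec_grad[OF this] d1]
    have e: "(\<chi> j. grad (\<lambda>x. ?J x $ j) x \<bullet> h) = hweight x *\<^sub>R h + (grad hweight x \<bullet> h) *\<^sub>R x"
      by (rule fun_cong)
    let ?q = "hweight x" and ?t = "x \<bullet> h"
    have "(norm (\<chi> j. grad (\<lambda>x. ?J x $ j) x \<bullet> h))\<^sup>2 = (?q *\<^sub>R h - (2 * ?q\<^sup>2 * ?t) *\<^sub>R x) \<bullet> (?q *\<^sub>R h - (2 * ?q\<^sup>2 * ?t) *\<^sub>R x)"
      unfolding e grad_hweight[OF x] power2_norm_eq_inner by simp
    \<comment> \<open>The last term becomes 4 q^3 t^2 by \<open>hweight_inner\<close> and cancels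
      the middle one.\<close>
    also have "\<dots> = ?q\<^sup>2 * (h \<bullet> h) - 4 * (?q ^ 3 * ?t\<^sup>2) + 4 * ?q\<^sup>2 * ?t\<^sup>2 * (?q\<^sup>2 * (x \<bullet> x))"
      using inner_commute[of h x] by (simp add: inner_diff power2_eq_square power3_eq_cube algebra_simps)
    also have "\<dots> = (?q * norm h)\<^sup>2"
      unfolding hweight_inner[OF x]
      by (simp add: power_mult_distrib dot_square_norm) (simp add: power2_eq_square power3_eq_cube)
    finally show ?thesis using hweight_nonneg[of x] by (simp add: power2_eq_iff_nonneg)
  qed
qed (use n in \<open>auto simp: inversion_map_involution\<close>)

text \<open>An involution plays both roles of the pair with one weight, and the weights at x and at
  its image are reciprocal because the inversion inverts the norm.\<close>

lemma multiplier_inversion: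
  assumes n: "CARD('n::finite) \<ge> 3" and a: "a \<in> multipliers"
  shows "bij (inversion_map :: real^'n \<Rightarrow> real^'n)" "a \<circ> inv (inversion_map :: real^'n \<Rightarrow> real^'n) \<in> multipliers"
    "mult_norm (a \<circ> inv (inversion_map :: real^'n \<Rightarrow> real^'n)) = mult_norm a"
proof -
  let ?J = "inversion_map :: real^'n \<Rightarrow> real^'n"
  have invJ: "inv ?J = ?J" by (rule inv_equality) (auto simp: inversion_map_involution)
  show "bij ?J" by (metis bijI' inversion_map_involution)
  interpret conformal_pair ?J ?J "- {0}" "- {0}" hweight hweight
    "\<lambda>x. inverse (norm x) ^ (CARD('n) - 2)" "\<lambda>x. inverse (norm x) ^ (CARD('n) - 2)"
    by (intro conformal_pair.intro conformal_pair_axioms.intro conformal_change_inversion n)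
      (auto simp: norm_inversion_map power_mult_distrib[symmetric])
  show "a \<circ> inv ?J \<in> multipliers" "mult_norm (a \<circ> inv ?J) = mult_norm a"
    using multiplier_compose[OF a] by (simp_all add: invJ o_def)
qed

text \<open>Translations, orthogonal maps and dilations are all similarities, with factor and
  translation part 1 and c, 1 and 0, s and 0; only the inversion needs the Kelvin transform.\<close>

lemma multiplier_generator:
  fixes g :: "real^'n::finite \<Rightarrow> real^'n"
  assumes n: "CARD('n) \<ge> 3" and g: "mobius_generator g" and a: "a \<in> multipliers"
  shows "bij g \<and> a \<circ> inv g \<in> multipliers \<and> mult_norm (a \<circ> inv g) = mult_norm a"
  using g
proof cases
  case (translation c)
  then show ?thesis using multiplier_similarity[OF n linear_ident _ _ a, of 1 c] by simp
next
  case orthogonal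
  then have "linear g" "\<And>h. norm (g h) = 1 * norm h" by (auto simp: orthogonal_transformation)
  then show ?thesis using multiplier_similarity[OF n _ _ _ a, of g 1 0] by simp
next
  case (dilation s)
  then show ?thesis
    using multiplier_similarity[OF n linear_scale_self _ _ a, of s s 0] by simp
next
  case inversion
  then have "g = inversion_map" by (auto simp: inversion_map_def)
  then show ?thesis using multiplier_inversion[OF n a] by simp
qed

theorem mainTheorem11:
  fixes \<gamma> :: "real^'n::finite \<Rightarrow> real^'n" and a :: "real^'n \<Rightarrow> real"
  assumes "CARD('n) \<ge> 3"
    and "\<gamma> \<in> mobius_group"
    and "a \<in> multipliers"
  shows "a \<circ> inv \<gamma> \<in> multipliers \<and> mult_norm (a \<circ> inv \<gamma>) = mult_norm a"
proof -
  \<comment> \<open>Bijectivity joins the induction because it is needed to write the inverse of a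
    composition as the composition of the inverses in reverse order.\<close>
  have "bij \<gamma> \<and> a \<circ> inv \<gamma> \<in> multipliers \<and> mult_norm (a \<circ> inv \<gamma>) = mult_norm a"
    using assms(2)
  proof induction
    case ident
    then show ?case using assms(3) bij_id[unfolded id_def] by simp
  next
    case (comp \<gamma> g)
    \<comment> \<open>The result for generators is applied to the multiplier supplied by the
      induction hypothesis.\<close>
    let ?a = "a \<circ> inv \<gamma>"
    have G: "bij g \<and> ?a \<circ> inv g \<in> multipliers \<and> mult_norm (?a \<circ> inv g) = mult_norm ?a"
      using multiplier_generator[OF assms(1)] comp by blast
    then have eq: "a \<circ> inv (g \<circ> \<gamma>) = ?a \<circ> inv g"
      using comp.IH by (simp add: o_inv_distrib o_assoc)
    have "bij (g \<circ> \<gamma>)" using G comp.IH bij_comp by blast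
    moreover have "mult_norm (?a \<circ> inv g) = mult_norm a" using G comp.IH by metis
    ultimately show ?case unfolding eq using G by blast
  qed
  then show ?thesis by blast
qed

end
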